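(* Let $k \geq 1$ be an integer, let $G$ be a mop of order $n \geq 2k+3$, and let $n_2$ be the number of vertices of $G$ of degree $2$. Then \[\iota_k(G) \leq \frac{n-n_2}{k+2}.\] Moreover, the bound is sharp: for each $k\ge 1$ there are infinitely many values of $n$ for which there is an $n$-vertex mop $G$ attaining equality.
   Context: All graphs are finite and simple. The order of $G$ is $|V(G)|$. A triangulated disc is a plane graph whose interior faces are triangles and whose exterior (unbounded) face is bounded by a simple cycle. A maximal outerplanar graph, or mop, is a triangulated disc $G$ such that the boundary of the exterior face of $G$ contains all the vertices of $G$ (so a mop has at least 3 vertices). For $S\subseteq V(G)$, $N_G[S]$ is the closed neighborhood of $S$, i.e. $S$ together with all vertices adjacent to a vertex of $S$; $G-N_G[S]$ is the subgraph induced by the remaining vertices. A set $S\subseteq V(G)$ is a $K_{1,k+1}$-isolating set of $G$ if $G-N_G[S]$ contains no copy of the star $K_{1,k+1}$ (equivalently for $k\ge 0$, every vertex of $G-N_G[S]$ has degree at most $k$ in $G-N_G[S]$). $\iota_k(G)$ denotes the minimum size of a $K_{1,k+1}$-isolating set of $G$. *)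

theory Defs
  imports "HOL-Analysis.Analysis"
begin

record 'a sgraph =
  verts :: "'a set"
  edges :: "'a set set"

definition simple_graph :: "'a sgraph \<Rightarrow> bool" where
  "simple_graph G \<longleftrightarrow> finite (verts G) \<and> (\<forall>e\<in>edges G. e \<subseteq> verts G \<and> card e = 2)"

definition graph_order :: "'a sgraph \<Rightarrow> nat" where
  "graph_order G = card (verts G)"

definition neighbours :: "'a sgraph \<Rightarrow> 'a \<Rightarrow> 'a set" where
  "neighbours G v = {u \<in> verts G. {u, v} \<in> edges G}"

definition degree :: "'a sgraph \<Rightarrow> 'a \<Rightarrow> nat" where
  "degree G v = card (neighbours G v)"

definition closed_nbhd :: "'a sgraph \<Rightarrow> 'a set \<Rightarrow> 'a set" where
  "closed_nbhd G S = S \<union> (\<Union>v\<in>S. neighbours G v)"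

definition delete_verts :: "'a sgraph \<Rightarrow> 'a set \<Rightarrow> 'a sgraph" where
  "delete_verts G X = \<lparr>verts = verts G - X, edges = {e \<in> edges G. e \<inter> X = {}}\<rparr>"

text \<open>A copy of \<open>H\<close> in \<open>G\<close> is a subgraph of \<open>G\<close>, not necessarily induced, isomorphic to \<open>H\<close>.\<close>

definition contains_copy :: "'a sgraph \<Rightarrow> 'b sgraph \<Rightarrow> bool" where
  "contains_copy G H \<longleftrightarrow>
     (\<exists>f. inj_on f (verts H) \<and> f ` verts H \<subseteq> verts G \<and> (\<forall>e\<in>edges H. f ` e \<in> edges G))"

definition star :: "nat \<Rightarrow> nat sgraph" where
  "star m = \<lparr>verts = {0..m}, edges = {{0, i} | i. i \<in> {1..m}}\<rparr>"

definition star_isolating :: "nat \<Rightarrow> 'a sgraph \<Rightarrow> 'a set \<Rightarrow> bool" where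
  "star_isolating k G S \<longleftrightarrow>
     S \<subseteq> verts G \<and> \<not> contains_copy (delete_verts G (closed_nbhd G S)) (star (k + 1))"

definition iota :: "nat \<Rightarrow> 'a sgraph \<Rightarrow> nat" where
  "iota k G = Min {card S | S. star_isolating k G S}"

definition num_deg2 :: "'a sgraph \<Rightarrow> nat" where
  "num_deg2 G = card {v \<in> verts G. degree G v = 2}"

definition cycle_edges :: "'a list \<Rightarrow> 'a set set" where
  "cycle_edges vs = {{vs ! i, vs ! (Suc i mod length vs)} | i. i < length vs}"

definition is_cycle :: "'a sgraph \<Rightarrow> 'a list \<Rightarrow> bool" where
  "is_cycle G vs \<longleftrightarrow> length vs \<ge> 3 \<and> distinct vs \<and> set vs \<subseteq> verts G \<and> cycle_edges vs \<subseteq> edges G"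

text \<open>
  A plane graph is a simple graph \<open>G\<close> with vertices placed at \<open>p\<close> and edges drawn as arcs \<open>g\<close>
  in the plane, such that the interior of an edge contains no vertex and no point of another edge.
\<close>

definition plane_graph :: "'a sgraph \<Rightarrow> ('a \<Rightarrow> complex) \<Rightarrow> ('a set \<Rightarrow> real \<Rightarrow> complex) \<Rightarrow> bool" where
  "plane_graph G p g \<longleftrightarrow>
     simple_graph G \<and> inj_on p (verts G) \<and>
     (\<forall>e\<in>edges G. arc (g e) \<and> {pathstart (g e), pathfinish (g e)} = p ` e) \<and>
     (\<forall>e\<in>edges G. (path_image (g e) - p ` e) \<inter> p ` verts G = {}) \<and>
     (\<forall>e\<in>edges G. \<forall>f\<in>edges G. e \<noteq> f \<longrightarrow> (path_image (g e) - p ` e) \<inter> path_image (g f) = {})"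

definition drawn_edges :: "('a set \<Rightarrow> real \<Rightarrow> complex) \<Rightarrow> 'a set set \<Rightarrow> complex set" where
  "drawn_edges g A = (\<Union>e\<in>A. path_image (g e))"

definition faces ::
  "'a sgraph \<Rightarrow> ('a \<Rightarrow> complex) \<Rightarrow> ('a set \<Rightarrow> real \<Rightarrow> complex) \<Rightarrow> complex set set" where
  "faces G p g = components (- (p ` verts G \<union> drawn_edges g (edges G)))"

definition bounded_by_cycle ::
  "'a sgraph \<Rightarrow> ('a set \<Rightarrow> real \<Rightarrow> complex) \<Rightarrow> complex set \<Rightarrow> 'a list \<Rightarrow> bool" where
  "bounded_by_cycle G g F vs \<longleftrightarrow> is_cycle G vs \<and> frontier F = drawn_edges g (cycle_edges vs)"

text \<open>The drawing is compact, so exactly one face is unbounded.\<close>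

definition triangulated_disc ::
  "'a sgraph \<Rightarrow> ('a \<Rightarrow> complex) \<Rightarrow> ('a set \<Rightarrow> real \<Rightarrow> complex) \<Rightarrow> bool" where
  "triangulated_disc G p g \<longleftrightarrow>
     plane_graph G p g \<and>
     (\<forall>F\<in>faces G p g. bounded F \<longrightarrow> (\<exists>vs. length vs = 3 \<and> bounded_by_cycle G g F vs)) \<and>
     (\<forall>F\<in>faces G p g. \<not> bounded F \<longrightarrow> (\<exists>vs. bounded_by_cycle G g F vs))"

definition mop :: "'a sgraph \<Rightarrow> bool" where
  "mop G \<longleftrightarrow>
     (\<exists>p g. triangulated_disc G p g \<and>
        (\<forall>F\<in>faces G p g. \<not> bounded F \<longrightarrow> p ` verts G \<subseteq> frontier F))"

end

theory Submission imports Defs "HOL-Library.Tree" begin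

text \<open>
  The upper bound comes from a statement about the core of \<open>G\<close>, the graph left after deleting the
  degree-two vertices.  For \<open>n \<ge> 4\<close> no two degree-two vertices are adjacent, the core is again a
  triangulated polygon (possibly a single edge), and every vertex has at most two neighbours of
  degree two, as these are consecutive to it on the outer cycle.  Put \<open>d = k + 2\<close> and suppose that
  \<open>S\<close> is a set of core vertices such that every core vertex outside \<open>N[S]\<close> has at most \<open>d - 4\<close>
  core neighbours outside \<open>N[S]\<close>.  In \<open>G\<close> such a vertex has at most \<open>d - 4 + 2 = k\<close> neighbours
  outside \<open>N[S]\<close>, so \<open>S\<close> is isolating; a degree-two vertex never causes trouble if \<open>k \<ge> 2\<close>, and
  for \<open>k = 1\<close> the condition says that \<open>S\<close> dominates the core.  The core has \<open>n - n\<^sub>2\<close>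
  vertices, and \<open>n \<ge> 2k + 3\<close> together with \<open>n\<^sub>2 \<le> n / 2\<close> makes this at least \<open>d\<close>.

  So the heart is \<open>mop_low_degree_set\<close>: a triangulated polygon on \<open>m \<ge> d \<ge> 3\<close> vertices has such
  a set \<open>S\<close> with \<open>d |S| \<le> m\<close>.  A triangulated polygon with a chosen outer edge is a binary tree:
  the triangle at that edge is the root and the two polygons cut off by its other sides are the
  subtrees.  Take a minimal subtree with at least \<open>d - 1\<close> interior vertices; it cuts off a polygon
  at a chord \<open>uw\<close>, its root \<open>z\<close> spans the triangle \<open>u z w\<close>, and each side beyond \<open>uz\<close> or \<open>zw\<close> has at most
  \<open>d - 2\<close> interior vertices.  If at least \<open>d\<close> vertices are cut off, put \<open>z\<close> into \<open>S\<close>: this dominates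
  the triangle and one vertex of each nonempty side, and induction applies to the polygon that
  remains after discarding everything beyond \<open>uw\<close>.  If exactly \<open>d - 1\<close> vertices are cut off, put a suitable end of
  \<open>uw\<close> into \<open>S\<close> and save one more vertex by contracting \<open>uw\<close> before applying induction.

  Passing between the topological definition of a mop and binary trees rests on one fact
  (\<open>polygon_split\<close>): a chord drawn inside a closed curve separates the inside into two parts, and
  the edges and the inner faces of the drawing are distributed over the two smaller polygons.
  Reading the recursion one way gives \<open>mop_imp_tree\<close>; reading it the other way shows that every
  drawing of a tree inside its outer cycle has triangular inner faces.

  For sharpness, chain together blocks with \<open>k + 4\<close> vertices.  Each block has two vertices of
  degree two and a hub whose \<open>k + 1\<close> private neighbours, like the hub itself, have all their neighbours inside
  the block, so an isolating set must meet every block.  To see that the chain is a mop, draw its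
  vertices and outer edges on the unit circle and the other edges as straight chords.
\<close>

section \<open>Triangulated polygons as binary trees\<close>

text \<open>
  The polygon with vertices \<open>x\<close>, \<open>inorder t\<close>, \<open>y\<close> in cyclic order, rooted at its outer edge
  \<open>xy\<close>: a leaf is a single edge, and the root label is the apex of the triangle at \<open>xy\<close>.
\<close>
fun tree_edges :: "'a \<Rightarrow> 'a tree \<Rightarrow> 'a \<Rightarrow> 'a set set" where
  "tree_edges x Leaf y = {{x, y}}"
| "tree_edges x (Node l z r) y = insert {x, y} (tree_edges x l z \<union> tree_edges z r y)"

abbreviation outline :: "'a \<Rightarrow> 'a tree \<Rightarrow> 'a \<Rightarrow> 'a list" where
  "outline x t y \<equiv> x # inorder t @ [y]"

lemma tree_edges_subset: "e \<in> tree_edges x t y \<Longrightarrow> e \<subseteq> set (outline x t y)"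
  by (induction t arbitrary: x y) fastforce+

lemma root_edge: "{x, y} \<in> tree_edges x t y"
  by (cases t) auto

lemma card_tree_edge: "e \<in> tree_edges x t y \<Longrightarrow> distinct (outline x t y) \<Longrightarrow> card e = 2"
proof (induction t arbitrary: x y)
  case (Node l z r)
  then show ?case by (auto simp: card_2_iff)
qed (auto simp: card_2_iff)

lemma tree_edges_map:
  "tree_edges (f x) (map_tree f t) (f y) = image f ` tree_edges x t y"
  by (induction t arbitrary: x y) (auto simp: image_Un)

text \<open>
  An outer edge of a polygon other than the root edge lies in the outline of exactly one of the two
  subpolygons; this is the case distinction of all inductions that follow an outer edge downwards.
\<close>
lemma consecutive_append:
  assumes "as @ u # w # bs = X @ v # Y"
  shows "(\<exists>bs'. X @ [v] = as @ u # w # bs' \<and> bs = bs' @ Y) \<or>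
         (\<exists>as'. v # Y = as' @ u # w # bs \<and> as = X @ as')"
  using assms by (auto simp: append_eq_append_conv2 append_eq_Cons_conv Cons_eq_append_conv)

text \<open>
  Contraction of an outer edge.  Renaming one end of the edge to the other yields an outline with a
  doubled vertex; the triangle at the edge degenerates, and replacing the parent of the corresponding
  leaf by the sibling of that leaf removes it.  Only the loop \<open>{u}\<close> disappears from the edge set.
\<close>
lemma collapse_doubled_vertex:
  assumes "t \<noteq> Leaf" "outline x t y = as @ u # u # bs"
  shows "\<exists>t'. outline x t' y = as @ u # bs \<and> tree_edges x t y = insert {u} (tree_edges x t' y)"
  using assms
proof (induction t arbitrary: x y as bs)
  case (Node l v r)
  have eq: "as @ u # u # bs = (x # inorder l) @ v # (inorder r @ [y])"
    using Node.prems by simp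
  from consecutive_append[OF this] show ?case
  proof (elim disjE exE conjE)
    fix bs' assume h: "(x # inorder l) @ [v] = as @ u # u # bs'" "bs = bs' @ inorder r @ [y]"
    show ?thesis
    proof (cases "l = Leaf")
      case True
      with h have "as = []" "x = u" "v = u" "bs' = []"
        by (auto simp: append_eq_Cons_conv Cons_eq_append_conv)
      with True h show ?thesis using root_edge[of u y r]
        by (intro exI[of _ r]) auto
    next
      case False
      with Node.IH(1)[of x v as bs'] h obtain l' where
        "outline x l' v = as @ u # bs'" "tree_edges x l v = insert {u} (tree_edges x l' v)" by auto
      with h show ?thesis by (intro exI[of _ "Node l' v r"]) auto
    qed
  next
    fix as' assume h: "v # inorder r @ [y] = as' @ u # u # bs" "as = (x # inorder l) @ as'"
    show ?thesis
    proof (cases "r = Leaf")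
      case True
      with h have "as' = []" "y = u" "v = u" "bs = []"
        by (auto simp: append_eq_Cons_conv Cons_eq_append_conv)
      with True h show ?thesis using root_edge[of x u l]
        by (intro exI[of _ l]) auto
    next
      case False
      with Node.IH(2)[of v y as' bs] h obtain r' where
        "outline v r' y = as' @ u # bs" "tree_edges v r y = insert {u} (tree_edges v r' y)" by auto
      with h show ?thesis by (intro exI[of _ "Node l v r'"]) auto
    qed
  qed
qed simp

lemma graft_tree:
  assumes "outline x t y = as @ u # w # bs"
  shows "\<exists>t'. outline x t' y = as @ u # inorder s @ w # bs \<and>
              tree_edges x t' y = tree_edges x t y \<union> tree_edges u s w"
  using assms
proof (induction t arbitrary: x y as bs)
  case Leaf
  then show ?case using root_edge[of u w s]
    by (intro exI[of _ s]) (auto simp: append_eq_Cons_conv Cons_eq_append_conv)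
next
  case (Node l v r)
  have eq: "as @ u # w # bs = (x # inorder l) @ v # (inorder r @ [y])"
    using Node.prems by simp
  from consecutive_append[OF this] show ?case
  proof (elim disjE exE conjE)
    fix bs' assume h: "(x # inorder l) @ [v] = as @ u # w # bs'" "bs = bs' @ inorder r @ [y]"
    with Node.IH(1)[of x v as bs'] obtain l' where
        "outline x l' v = as @ u # inorder s @ w # bs'"
        "tree_edges x l' v = tree_edges x l v \<union> tree_edges u s w" by auto
    with h show ?thesis by (intro exI[of _ "Node l' v r"]) auto
  next
    fix as' assume h: "v # inorder r @ [y] = as' @ u # w # bs" "as = (x # inorder l) @ as'"
    with Node.IH(2)[of v y as' bs] obtain r' where
        "outline v r' y = as' @ u # inorder s @ w # bs"
        "tree_edges v r' y = tree_edges v r y \<union> tree_edges u s w" by auto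
    with h show ?thesis by (intro exI[of _ "Node l v r'"]) auto
  qed
qed

lemma outer_edge_in_triangle:
  assumes "t \<noteq> Leaf" "outline x t y = as @ u # w # bs" "distinct (outline x t y)"
  shows "\<exists>v \<in> set (outline x t y) - {u, w}. {u, v} \<in> tree_edges x t y \<and> {w, v} \<in> tree_edges x t y"
  using assms
proof (induction t arbitrary: x y as bs)
  case (Node l v r)
  have eq: "as @ u # w # bs = (x # inorder l) @ v # (inorder r @ [y])"
    using Node.prems by simp
  from consecutive_append[OF this] show ?case
  proof (elim disjE exE conjE)
    fix bs' assume h: "(x # inorder l) @ [v] = as @ u # w # bs'" "bs = bs' @ inorder r @ [y]"
    show ?thesis
    proof (cases "l = Leaf")
      case True
      with h have "x = u" "v = w" "as = []"
        by (auto simp: append_eq_Cons_conv Cons_eq_append_conv)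
      then show ?thesis using True Node.prems root_edge[of w y r] by (intro bexI[of _ y]) auto
    next
      case False
      from Node.prems(3) have "distinct (outline x l v)" by auto
      moreover from h have "outline x l v = as @ u # w # bs'" by simp
      ultimately obtain q where
        "q \<in> set (outline x l v) - {u, w}" "{u, q} \<in> tree_edges x l v" "{w, q} \<in> tree_edges x l v"
        using Node.IH(1)[OF False, of x v as bs'] by blast
      then show ?thesis by (intro bexI[of _ q]) auto
    qed
  next
    fix as' assume h: "v # inorder r @ [y] = as' @ u # w # bs" "as = (x # inorder l) @ as'"
    show ?thesis
    proof (cases "r = Leaf")
      case True
      with h have "v = u" "y = w" "bs = []"
        by (auto simp: append_eq_Cons_conv Cons_eq_append_conv)
      then show ?thesis using True Node.prems root_edge[of x u l]
        by (intro bexI[of _ x]) (auto simp: insert_commute)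
    next
      case False
      from Node.prems(3) have "distinct (outline v r y)" by auto
      moreover from h have "outline v r y = as' @ u # w # bs" by simp
      ultimately obtain q where
        "q \<in> set (outline v r y) - {u, w}" "{u, q} \<in> tree_edges v r y" "{w, q} \<in> tree_edges v r y"
        using Node.IH(2)[OF False, of v y as' bs] by blast
      then show ?thesis by (intro bexI[of _ q]) auto
    qed
  qed
qed simp

text \<open>
  Descending from the root into a subtree of size at least \<open>s\<close> as long as possible ends at a subtree
  both of whose children are smaller than \<open>s\<close>.  Here \<open>t1\<close> is the tree with this subtree
  replaced by a leaf, that is, the polygon on the other side of the chord \<open>uw\<close>.
\<close>
lemma minimal_heavy_subtree:
  assumes "s \<le> size t" "1 \<le> s"
  obtains t1 as bs u l z r w where "s \<le> size l + size r + 1" "size l < s" "size r < s"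
    "tree_edges x t y = tree_edges x t1 y \<union> tree_edges u (Node l z r) w"
    "outline x t1 y = as @ u # w # bs"
    "outline x t y = as @ u # inorder l @ z # inorder r @ w # bs"
  using assms(1)
proof (induction t arbitrary: x y thesis)
  case Leaf
  then show ?case using assms(2) by simp
next
  case (Node l z r)
  consider "s \<le> size l" | "s \<le> size r" | "size l < s" "size r < s" by linarith
  then show ?case
  proof cases
    case 1
    show ?thesis
    proof (rule Node.IH(1)[OF _ 1])
      fix l' r' t1 u z' w as bs
      assume h: "s \<le> size l' + size r' + 1" "size l' < s" "size r' < s"
        "tree_edges x l z = tree_edges x t1 z \<union> tree_edges u (Node l' z' r') w"
        "outline x t1 z = as @ u # w # bs"
        "outline x l z = as @ u # inorder l' @ z' # inorder r' @ w # bs"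
      show ?thesis
      proof (rule Node.prems(1)[OF h(1-3)])
        show "tree_edges x (Node l z r) y = tree_edges x (Node t1 z r) y \<union> tree_edges u (Node l' z' r') w"
          using h(4) by auto
        show "outline x (Node t1 z r) y = as @ u # w # bs @ inorder r @ [y]"
          using arg_cong[OF h(5), of "\<lambda>us. us @ inorder r @ [y]"] by simp
        show "outline x (Node l z r) y =
            as @ u # inorder l' @ z' # inorder r' @ w # bs @ inorder r @ [y]"
          using arg_cong[OF h(6), of "\<lambda>us. us @ inorder r @ [y]"] by simp
      qed
    qed
  next
    case 2
    show ?thesis
    proof (rule Node.IH(2)[OF _ 2])
      fix l' r' t1 u z' w as bs
      assume h: "s \<le> size l' + size r' + 1" "size l' < s" "size r' < s"
        "tree_edges z r y = tree_edges z t1 y \<union> tree_edges u (Node l' z' r') w"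
        "outline z t1 y = as @ u # w # bs"
        "outline z r y = as @ u # inorder l' @ z' # inorder r' @ w # bs"
      show ?thesis
      proof (rule Node.prems(1)[OF h(1-3)])
        show "tree_edges x (Node l z r) y = tree_edges x (Node l z t1) y \<union> tree_edges u (Node l' z' r') w"
          using h(4) by auto
        show "outline x (Node l z t1) y = (x # inorder l @ as) @ u # w # bs"
          using h(5) by simp
        show "outline x (Node l z r) y =
            (x # inorder l @ as) @ u # inorder l' @ z' # inorder r' @ w # bs"
          using h(6) by simp
      qed
    qed
  next
    case 3
    show ?thesis
    proof (rule Node.prems(1)[OF _ 3])
      show "tree_edges x (Node l z r) y = tree_edges x Leaf y \<union> tree_edges x (Node l z r) y" by auto
      show "outline x Leaf y = [] @ x # y # []" by simp
      show "outline x (Node l z r) y = [] @ x # inorder l @ z # inorder r @ y # []" by simp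
      show "s \<le> size l + size r + 1" using Node.prems(2) by simp
    qed
  qed
qed

section \<open>A small set whose removal leaves low degrees\<close>

definition dominated :: "'a set set \<Rightarrow> 'a set \<Rightarrow> 'a set" where
  "dominated E S = S \<union> {v. \<exists>s\<in>S. {s, v} \<in> E}"

text \<open>
  The degree condition is \<open>degree \<le> d - 4\<close>, written additively: for \<open>d = 3\<close> it cannot be met, so
  that \<open>S\<close> is then a dominating set.
\<close>
definition leaves_low_degree :: "nat \<Rightarrow> 'a set \<Rightarrow> 'a set set \<Rightarrow> 'a set \<Rightarrow> bool" where
  "leaves_low_degree d V E S \<longleftrightarrow>
     S \<subseteq> V \<and> (\<forall>v \<in> V - dominated E S. card ({w. {v, w} \<in> E} - dominated E S) + 4 \<le> d)"

text \<open>
  A vertex confined to a set \<open>W\<close> of at most \<open>d - 3\<close> vertices has at most \<open>d - 4\<close> neighbours.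
\<close>
lemma card_inside_piece:
  assumes "finite W" "v \<in> W" "X \<subseteq> W - {v}" "card W + 3 \<le> d"
  shows "card X + 4 \<le> (d::nat)"
proof -
  have "card X \<le> card (W - {v})" by (rule card_mono[OF _ assms(3)]) (simp add: assms(1))
  moreover have "card W = Suc (card (W - {v}))" by (rule card.remove[OF assms(1,2)])
  ultimately show ?thesis using assms(4) by simp
qed

lemma root_label_adjacent:
  assumes "t \<noteq> Leaf"
  shows "\<exists>q \<in> set (inorder t). {x, q} \<in> tree_edges x t y \<and> {y, q} \<in> tree_edges x t y"
proof (cases t)
  case (Node l z r)
  then show ?thesis using root_edge[of x z l] root_edge[of z y r]
    by (intro bexI[of _ z]) (auto simp: insert_commute)
qed (use assms in simp)

text \<open>
  Induction on the number of vertices.  Once a set \<open>D\<close> of dominated vertices contains \<open>u\<close>, \<open>z\<close>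
  and \<open>w\<close>, the rest of the polygon splits into the two sides of the cut-off part (the labels of \<open>l\<close> and
  of \<open>r\<close>) and the vertices beyond \<open>uw\<close>, with no edges between them, so that the three pieces can be
  treated separately.
\<close>
theorem mop_low_degree_set:
  assumes "distinct (outline x t y)" "3 \<le> d" "d \<le> size t + 2"
  shows "\<exists>S. leaves_low_degree d (set (outline x t y)) (tree_edges x t y) S \<and> d * card S \<le> size t + 2"
  using assms(1,3)
proof (induction "size t" arbitrary: x t y rule: less_induct)
  case less
  define V where "V = set (outline x t y)"
  define E where "E = tree_edges x t y"
  have finV [simp]: "finite V" by (simp add: V_def)
  have loopfree: "{v, v} \<notin> E" for v
    using card_tree_edge[OF _ less.prems(1), of "{v}"] unfolding E_def by auto
  have EV: "{v, q} \<in> E \<Longrightarrow> v \<in> V \<and> q \<in> V" for v q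
    using tree_edges_subset[of "{v, q}" x t y] unfolding E_def V_def by auto
  define low where "low D v \<longleftrightarrow> card ({q. {v, q} \<in> E} - D) + 4 \<le> d" for D v
  \<comment> \<open>With exactly \<open>d\<close> vertices, an end of the root edge dominates the whole root triangle and
     leaves at most \<open>d - 3\<close> vertices.\<close>
  consider "size t + 2 = d" | "d - 1 \<le> size t" using less.prems(2) by linarith
  then show ?case
  proof cases
    case 1
    then have "t \<noteq> Leaf" using assms(2) by auto
    then obtain l z r where t: "t = Node l z r" by (cases t) auto
    have D: "{x, y, z} \<subseteq> dominated E {x}"
      using root_edge[of x z l] by (auto simp: dominated_def E_def t)
    have "card (V - {x, y, z}) + 3 = d"
    proof -
      have "card V = d" using distinct_card[OF less.prems(1)] 1 by (simp add: V_def)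
      moreover have "card {x, y, z} = 3" using less.prems(1) by (auto simp: t)
      moreover have "{x, y, z} \<subseteq> V" by (auto simp: V_def t)
      ultimately show ?thesis using card_Diff_subset[of "{x,y,z}" V] card_mono[of V "{x,y,z}"] by auto
    qed
    moreover have "{q. {v, q} \<in> E} - dominated E {x} \<subseteq> V - {x, y, z} - {v}" for v
      using loopfree[of v] EV[of v] D by auto
    ultimately have "low (dominated E {x}) v" if "v \<in> V - dominated E {x}" for v
      using that D unfolding low_def by (intro card_inside_piece[of "V - {x, y, z}"]) auto
    then show ?thesis using 1
      unfolding leaves_low_degree_def low_def V_def[symmetric] E_def[symmetric]
      by (intro exI[of _ "{x}"]) (auto simp: V_def)
  next
    case 2
    obtain t1 as bs u l z r w where heavy: "d - 1 \<le> size l + size r + 1" "size l < d - 1" "size r < d - 1"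
      and Eeq: "tree_edges x t y = tree_edges x t1 y \<union> tree_edges u (Node l z r) w"
      and out1: "outline x t1 y = as @ u # w # bs"
      and out: "outline x t y = as @ u # inorder l @ z # inorder r @ w # bs"
      by (rule minimal_heavy_subtree[OF 2, of x y]) (use assms(2) in auto)
    define V1 where "V1 = set (outline x t1 y)"
    define E1 where "E1 = tree_edges x t1 y"
    have dist: "distinct (as @ u # inorder l @ z # inorder r @ w # bs)"
      using less.prems(1) unfolding out .
    have dist1: "distinct (outline x t1 y)" using dist unfolding out1 by auto
    have V1: "V1 = set as \<union> {u, w} \<union> set bs" unfolding V1_def out1 by auto
    have V: "V = V1 \<union> set (inorder l) \<union> {z} \<union> set (inorder r)" unfolding V_def V1 out by auto
    have E: "E = E1 \<union> {{u, w}} \<union> tree_edges u l z \<union> tree_edges z r w"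
      unfolding E_def E1_def Eeq by auto
    have finV1 [simp]: "finite V1" by (simp add: V1)
    have size_t: "size t = size t1 + size l + size r + 1"
      using arg_cong[OF out1, of length] arg_cong[OF out, of length] by simp
    have card_rest: "card (V1 - {u, w}) = size t1"
    proof -
      have "card V1 = size t1 + 2" using distinct_card[OF dist1] by (simp add: V1_def)
      moreover have "u \<noteq> w" using dist by auto
      ultimately show ?thesis using card_Diff_subset[of "{u, w}" V1] by (simp add: V1)
    qed
    have E1V: "e \<subseteq> V1" if "e \<in> E1" for e
      using tree_edges_subset[of e x t1 y] that unfolding E1_def V1_def by auto
    have El: "e \<subseteq> insert u (insert z (set (inorder l)))" if "e \<in> tree_edges u l z" for e
      using tree_edges_subset[OF that] by auto
    have Er: "e \<subseteq> insert z (insert w (set (inorder r)))" if "e \<in> tree_edges z r w" for e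
      using tree_edges_subset[OF that] by auto
    have nl: "q \<in> insert u (insert z (set (inorder l)))" if "v \<in> set (inorder l)" "{v, q} \<in> E" for v q
      using that E1V[of "{v, q}"] El[of "{v, q}"] Er[of "{v, q}"] dist unfolding E V1
      by (auto simp: doubleton_eq_iff)
    have nr: "q \<in> insert z (insert w (set (inorder r)))" if "v \<in> set (inorder r)" "{v, q} \<in> E" for v q
      using that E1V[of "{v, q}"] El[of "{v, q}"] Er[of "{v, q}"] dist unfolding E V1
      by (auto simp: doubleton_eq_iff)
    have n1: "{v, q} \<in> E1" if "v \<in> V1 - {u, w}" "{v, q} \<in> E" for v q
      using that El[of "{v, q}"] Er[of "{v, q}"] dist unfolding E V1
      by (auto simp: doubleton_eq_iff)
    have piece: "low D v" if "v \<in> W" "v \<notin> D" "W \<subseteq> V" "card (W - D) + 3 \<le> d"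
        "\<And>q. {v, q} \<in> E \<Longrightarrow> q \<in> W \<union> D" for D W v
      unfolding low_def
    proof (rule card_inside_piece)
      show "finite (W - D)" using that(3) finite_subset finV by blast
    qed (use that loopfree[of v] in auto)
    \<comment> \<open>A side has at most \<open>d - 2\<close> vertices, one too many: either it is smaller or one of its vertices
       is dominated.\<close>
    have l_side: "low D v" if "u \<in> D" "z \<in> D" "v \<in> set (inorder l)" "v \<notin> D"
        "size l + 3 \<le> d \<or> set (inorder l) \<inter> D \<noteq> {}" for D v
    proof (rule piece[OF that(3,4)])
      have "card (set (inorder l)) \<le> size l" using card_length[of "inorder l"] by simp
      moreover have "card (set (inorder l) - D) \<le> card (set (inorder l))"
        by (intro card_mono) auto
      moreover have "card (set (inorder l) - D) < card (set (inorder l))" if "set (inorder l) \<inter> D \<noteq> {}"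
        using that by (intro psubset_card_mono) auto
      ultimately show "card (set (inorder l) - D) + 3 \<le> d" using heavy(2) that(5) by linarith
      show "q \<in> set (inorder l) \<union> D" if "{v, q} \<in> E" for q
        using nl[of v q] that \<open>v \<in> set (inorder l)\<close> \<open>u \<in> D\<close> \<open>z \<in> D\<close> by auto
    qed (auto simp: V)
    have r_side: "low D v" if "w \<in> D" "z \<in> D" "v \<in> set (inorder r)" "v \<notin> D"
        "size r + 3 \<le> d \<or> set (inorder r) \<inter> D \<noteq> {}" for D v
    proof (rule piece[OF that(3,4)])
      have "card (set (inorder r)) \<le> size r" using card_length[of "inorder r"] by simp
      moreover have "card (set (inorder r) - D) \<le> card (set (inorder r))"
        by (intro card_mono) auto
      moreover have "card (set (inorder r) - D) < card (set (inorder r))" if "set (inorder r) \<inter> D \<noteq> {}"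
        using that by (intro psubset_card_mono) auto
      ultimately show "card (set (inorder r) - D) + 3 \<le> d" using heavy(3) that(5) by linarith
      show "q \<in> set (inorder r) \<union> D" if "{v, q} \<in> E" for q
        using nr[of v q] that \<open>v \<in> set (inorder r)\<close> \<open>w \<in> D\<close> \<open>z \<in> D\<close> by auto
    qed (auto simp: V)
    have rest: "low D v" if "u \<in> D" "w \<in> D" "v \<in> V1" "v \<notin> D" "card (V1 - {u, w} - D) + 3 \<le> d" for D v
    proof (rule piece[OF _ that(4)])
      show "v \<in> V1 - {u, w}" using that by auto
      show "q \<in> V1 - {u, w} \<union> D" if "{v, q} \<in> E" for q
        using n1[of v q] E1V[of "{v, q}"] that \<open>u \<in> D\<close> \<open>w \<in> D\<close> \<open>v \<in> V1\<close> \<open>v \<notin> D\<close> by auto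
    qed (use that in \<open>auto simp: V\<close>)
    \<comment> \<open>It suffices to treat the three pieces one by one.\<close>
    have conclude: ?thesis if "S \<subseteq> V" "d * card S \<le> size t + 2" "z \<in> dominated E S"
        "\<And>v. v \<in> V1 - dominated E S \<Longrightarrow> low (dominated E S) v"
        "\<And>v. v \<in> set (inorder l) - dominated E S \<Longrightarrow> low (dominated E S) v"
        "\<And>v. v \<in> set (inorder r) - dominated E S \<Longrightarrow> low (dominated E S) v" for S
      using that unfolding leaves_low_degree_def low_def V_def[symmetric] E_def[symmetric]
      by (intro exI[of _ S]) (auto simp: V)
    have edges_uwz: "{u, w} \<in> E" "{z, u} \<in> E" "{z, w} \<in> E"
      using root_edge[of u z l] root_edge[of z w r] by (auto simp: E insert_commute)
    consider "d \<le> size l + size r + 1" | "size l + size r + 1 = d - 1" using heavy(1) by linarith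
    then show ?thesis
    proof cases
      case 1
      \<comment> \<open>The apex \<open>z\<close> dominates \<open>u\<close>, \<open>w\<close> and a vertex of each nonempty side; at least \<open>d\<close>
         vertices are discarded with the cut-off part.\<close>
      have with_z: ?thesis if S1: "S1 \<subseteq> V1" "d * card S1 + d \<le> size t + 2"
        "\<And>v. v \<in> V1 - dominated E (insert z S1) \<Longrightarrow> low (dominated E (insert z S1)) v" for S1
      proof (rule conclude)
        let ?D = "dominated E (insert z S1)"
        have D: "u \<in> ?D" "w \<in> ?D" "z \<in> ?D" using edges_uwz by (auto simp: dominated_def)
        show "z \<in> ?D" by fact
        show "insert z S1 \<subseteq> V" using S1 by (auto simp: V)
        have "finite S1" using S1(1) finite_subset finV1 by blast
        then have "card (insert z S1) \<le> card S1 + 1" by (simp add: card_insert_if)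
        then have "d * card (insert z S1) \<le> d * (card S1 + 1)" by (rule mult_le_mono2)
        then show "d * card (insert z S1) \<le> size t + 2" using S1(2) by simp
        show "low ?D v" if "v \<in> set (inorder l) - ?D" for v
        proof (rule l_side)
          from that have "l \<noteq> Leaf" by auto
          from root_label_adjacent[OF this, of u z] show "size l + 3 \<le> d \<or> set (inorder l) \<inter> ?D \<noteq> {}"
            unfolding E dominated_def by blast
        qed (use that D in auto)
        show "low ?D v" if "v \<in> set (inorder r) - ?D" for v
        proof (rule r_side)
          from that have "r \<noteq> Leaf" by auto
          from root_label_adjacent[OF this, of z w] show "size r + 3 \<le> d \<or> set (inorder r) \<inter> ?D \<noteq> {}"
            unfolding E dominated_def by blast
        qed (use that D in auto)
      qed (use S1 in auto)
      show ?thesis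
      proof (cases "d \<le> size t1 + 2")
        case True
        from less.hyps[OF _ dist1 True] size_t obtain S1 where
          S1: "leaves_low_degree d V1 E1 S1" "d * card S1 \<le> size t1 + 2"
          unfolding V1_def E1_def by auto
        then have S1_sub: "S1 \<subseteq> V1" and
          S1_low: "\<And>v. v \<in> V1 - dominated E1 S1 \<Longrightarrow> card ({q. {v, q} \<in> E1} - dominated E1 S1) + 4 \<le> d"
          unfolding leaves_low_degree_def by blast+
        have sub: "dominated E1 S1 \<subseteq> dominated E (insert z S1)" by (auto simp: dominated_def E)
        show ?thesis
        proof (rule with_z)
          fix v assume v: "v \<in> V1 - dominated E (insert z S1)"
          have "u \<in> dominated E (insert z S1)" "w \<in> dominated E (insert z S1)"
            using edges_uwz by (auto simp: dominated_def)
          with v have v': "v \<in> V1 - {u, w}" by auto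
          have "card ({q. {v, q} \<in> E} - dominated E (insert z S1)) \<le> card ({q. {v, q} \<in> E1} - dominated E1 S1)"
          proof (rule card_mono)
            have "{q. {v, q} \<in> E1} \<subseteq> V1" using E1V by auto
            then show "finite ({q. {v, q} \<in> E1} - dominated E1 S1)" using finite_subset finV1 by blast
          qed (use n1[OF v'] sub in auto)
          moreover have "v \<in> V1 - dominated E1 S1" using v sub by auto
          ultimately show "low (dominated E (insert z S1)) v"
            using S1_low[of v] unfolding low_def by linarith
        next
          show "S1 \<subseteq> V1" by (fact S1_sub)
          show "d * card S1 + d \<le> size t + 2" using S1(2) 1 size_t by linarith
        qed
      next
        case False
        show ?thesis
        \<comment> \<open>Fewer than \<open>d - 2\<close> vertices lie beyond \<open>uw\<close>, too few to matter.\<close>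
        proof (rule with_z[of "{}"])
          fix v assume v: "v \<in> V1 - dominated E {z}"
          show "low (dominated E {z}) v"
          proof (rule rest)
            have "card (V1 - {u, w} - dominated E {z}) \<le> card (V1 - {u, w})" by (intro card_mono) auto
            then show "card (V1 - {u, w} - dominated E {z}) + 3 \<le> d"
              using card_rest False by linarith
          qed (use v edges_uwz in \<open>auto simp: dominated_def\<close>)
        qed (use 1 size_t in auto)
      qed
    next
      case 2
      \<comment> \<open>Now the two sides together have \<open>d - 2\<close> vertices, so at most one of them is too large.  The
         end \<open>c\<close> of the chord is chosen on that side, where it dominates a vertex.\<close>
      have "\<exists>c c'. {c, c'} = {u, w} \<and> (size l + 3 \<le> d \<or> c = u) \<and> (size r + 3 \<le> d \<or> c = w)"
      proof (cases "size r + 3 \<le> d")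
        case True
        then show ?thesis by (intro exI[of _ u] exI[of _ w]) auto
      next
        case False
        then have "size l + 3 \<le> d" using 2 assms(2) heavy by linarith
        then show ?thesis by (intro exI[of _ w] exI[of _ u]) auto
      qed
      then obtain c c' where c: "{c, c'} = {u, w}"
        and cl: "size l + 3 \<le> d \<or> c = u" and cr: "size r + 3 \<le> d \<or> c = w" by blast
      have cV1: "c \<in> V1" "c' \<in> V1" using c V1 by (auto simp: doubleton_eq_iff)
      have Dc: "{u, w, z} \<subseteq> dominated E S" if "c \<in> S" for S
      proof -
        have "c = u \<or> c = w" using c by (auto simp: doubleton_eq_iff)
        then show ?thesis using that edges_uwz by (auto simp: dominated_def insert_commute)
      qed
      have with_c: ?thesis if S': "S' \<subseteq> V1" "d * card S' + d \<le> size t + 2"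
        "\<And>v. v \<in> V1 - dominated E (insert c S') \<Longrightarrow> low (dominated E (insert c S')) v" for S'
      proof (rule conclude)
        let ?D = "dominated E (insert c S')"
        have D: "u \<in> ?D" "w \<in> ?D" "z \<in> ?D" using Dc[of "insert c S'"] by auto
        show "z \<in> ?D" by fact
        show "insert c S' \<subseteq> V" using S' cV1 by (auto simp: V)
        have "finite S'" using S'(1) finite_subset finV1 by blast
        then have "card (insert c S') \<le> card S' + 1" by (simp add: card_insert_if)
        then have "d * card (insert c S') \<le> d * (card S' + 1)" by (rule mult_le_mono2)
        then show "d * card (insert c S') \<le> size t + 2" using S'(2) by simp
        show "low ?D v" if "v \<in> set (inorder l) - ?D" for v
        proof (rule l_side)
          from that have "l \<noteq> Leaf" by auto
          from root_label_adjacent[OF this, of u z] cl show "size l + 3 \<le> d \<or> set (inorder l) \<inter> ?D \<noteq> {}"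
            unfolding E dominated_def by blast
        qed (use that D in auto)
        show "low ?D v" if "v \<in> set (inorder r) - ?D" for v
        proof (rule r_side)
          from that have "r \<noteq> Leaf" by auto
          from root_label_adjacent[OF this, of z w] cr show "size r + 3 \<le> d \<or> set (inorder r) \<inter> ?D \<noteq> {}"
            unfolding E dominated_def by blast
        qed (use that D in auto)
      qed (use S' in auto)
      show ?thesis
      proof (cases "d \<le> size t1 + 1")
        case True
        \<comment> \<open>Contract \<open>uw\<close> to the end \<open>c'\<close> that is not in \<open>S\<close>.  If the solution \<open>S'\<close> for the contracted
           polygon uses \<open>c'\<close>, then \<open>insert c S'\<close> contains both ends, so whatever the merged vertex
           dominates is dominated in the original polygon as well.\<close>
        define \<rho> where "\<rho> v = (if v = c then c' else v)" for v
        have c_notin: "c \<notin> set as" "c \<notin> set bs" using dist c by (auto simp: doubleton_eq_iff)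
        have fix_as: "map \<rho> as = as" and fix_bs: "map \<rho> bs = bs"
          using c_notin by (auto simp: \<rho>_def intro!: map_idI)
        have uw: "\<rho> u = c'" "\<rho> w = c'" using c by (auto simp: \<rho>_def doubleton_eq_iff)
        have "outline (\<rho> x) (map_tree \<rho> t1) (\<rho> y) = as @ c' # c' # bs"
          using arg_cong[OF out1, of "map \<rho>"] by (simp add: fix_as fix_bs uw inorder_map)
        moreover have "t1 \<noteq> Leaf" using True assms(2) by auto
        ultimately obtain t2 where out2: "outline (\<rho> x) t2 (\<rho> y) = as @ c' # bs"
          and E2: "image \<rho> ` E1 = insert {c'} (tree_edges (\<rho> x) t2 (\<rho> y))"
          using collapse_doubled_vertex[of "map_tree \<rho> t1" "\<rho> x" "\<rho> y" as c' bs]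
          unfolding E1_def tree_edges_map by auto
        define E2 where "E2 = tree_edges (\<rho> x) t2 (\<rho> y)"
        have size2: "size t2 + 1 = size t1"
          using arg_cong[OF out2, of length] arg_cong[OF out1, of length] by simp
        have dist2: "distinct (outline (\<rho> x) t2 (\<rho> y))" unfolding out2
          using dist c by (auto simp: doubleton_eq_iff)
        from less.hyps[OF _ dist2] size2 size_t True obtain S' where
          S': "leaves_low_degree d (set (as @ c' # bs)) E2 S'" "d * card S' \<le> size t2 + 2"
          unfolding E2_def out2 by auto
        then have S'_sub: "S' \<subseteq> set (as @ c' # bs)" and
          S'_low: "\<And>v. v \<in> set (as @ c' # bs) - dominated E2 S' \<Longrightarrow>
                       card ({q. {v, q} \<in> E2} - dominated E2 S') + 4 \<le> d"
          unfolding leaves_low_degree_def by blast+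
        let ?D = "dominated E (insert c S')"
        have D: "u \<in> ?D" "w \<in> ?D" "z \<in> ?D" using Dc[of "insert c S'"] by auto
        have undom: "q \<notin> dominated E2 S'" if q: "q \<in> V1 - {u, w}" "q \<notin> ?D" for q
        proof
          assume "q \<in> dominated E2 S'"
          moreover have "q \<notin> S'" using q by (auto simp: dominated_def)
          ultimately obtain s where s: "s \<in> S'" "{s, q} \<in> E2" by (auto simp: dominated_def)
          then obtain f where f: "f \<in> E1" "\<rho> ` f = {s, q}" using E2 unfolding E2_def by (metis image_iff insertI2)
          then obtain f1 f2 where f12: "f1 \<in> f" "f2 \<in> f" "\<rho> f1 = q" "\<rho> f2 = s" by (metis imageE insertI1 insertI2)
          have "f1 = q" using f12 q c by (auto simp: \<rho>_def split: if_splits)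
          have "q \<noteq> s" using \<open>q \<notin> S'\<close> s by auto
          then have "f1 \<noteq> f2" using f12 by auto
          moreover have "card f = 2" using card_tree_edge[OF _ dist1] f(1) unfolding E1_def by auto
          ultimately have "f = {f2, q}" using f12 \<open>f1 = q\<close>
            by (auto simp: card_2_iff)
          moreover have "f2 \<in> insert c S'" using f12 s by (auto simp: \<rho>_def split: if_splits)
          ultimately show False using q f(1) by (auto simp: dominated_def E)
        qed
        show ?thesis
        proof (rule with_c)
          fix v assume v: "v \<in> V1 - ?D"
          with D have v': "v \<in> V1 - {u, w}" by auto
          have "{v, q} \<in> E2" if "{v, q} \<in> E1" "q \<notin> {u, w}" for q
          proof -
            have "\<rho> ` {v, q} = {v, q}" using v' that c by (auto simp: \<rho>_def)
            then have "{v, q} \<in> insert {c'} E2" using E2 that(1) unfolding E2_def by (metis image_eqI)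
            moreover have "{v, q} \<noteq> {c'}" using v' c by auto
            ultimately show ?thesis by auto
          qed
          then have *: "{q. {v, q} \<in> E} - ?D \<subseteq> {q. {v, q} \<in> E2} - dominated E2 S'"
            using n1[OF v'] D undom E1V by blast
          have "{q. {v, q} \<in> E2} \<subseteq> set (as @ c' # bs)"
            using tree_edges_subset[of _ "\<rho> x" t2 "\<rho> y"] unfolding out2 E2_def by auto
          then have "finite ({q. {v, q} \<in> E2} - dominated E2 S')"
            using finite_subset by blast
          from card_mono[OF this *] have "card ({q. {v, q} \<in> E} - ?D) \<le> card ({q. {v, q} \<in> E2} - dominated E2 S')" .
          moreover have "v \<in> set (as @ c' # bs)" using v' V1 by auto
          then have "v \<in> set (as @ c' # bs) - dominated E2 S'" using v undom[OF v'] by auto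
          ultimately show "low ?D v"
            using S'_low[of v] unfolding low_def by linarith
        next
          show "S' \<subseteq> V1" using S'_sub cV1 unfolding V1 by auto
          show "d * card S' + d \<le> size t + 2" using S'(2) size2 size_t 2 assms(2) by linarith
        qed
      next
        case False
        show ?thesis
        \<comment> \<open>At most \<open>d - 2\<close> vertices lie beyond \<open>uw\<close>, and \<open>c\<close> dominates one of them.\<close>
        proof (rule with_c[of "{}"])
          fix v assume v: "v \<in> V1 - dominated E {c}"
          have D: "u \<in> dominated E {c}" "w \<in> dominated E {c}" using Dc[of "{c}"] by auto
          show "low (dominated E {c}) v"
          proof (rule rest)
            have "v \<in> V1 - {u, w}" using v D by auto
            then have "t1 \<noteq> Leaf" using out1 unfolding V1_def
              by (auto simp: append_eq_Cons_conv Cons_eq_append_conv)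
            from outer_edge_in_triangle[OF this out1 dist1] obtain q where
              "q \<in> V1 - {u, w}" "{u, q} \<in> E1" "{w, q} \<in> E1" unfolding E1_def V1_def by blast
            moreover have "c = u \<or> c = w" using c by (auto simp: doubleton_eq_iff)
            ultimately have "q \<in> V1 - {u, w}" "{c, q} \<in> E" unfolding E by blast+
            then have "q \<in> V1 - {u, w}" "q \<in> dominated E {c}" by (auto simp: dominated_def)
            then have "V1 - {u, w} - dominated E {c} \<subset> V1 - {u, w}" by blast
            then have "card (V1 - {u, w} - dominated E {c}) < card (V1 - {u, w})"
              using psubset_card_mono finite_Diff[OF finV1] by blast
            then show "card (V1 - {u, w} - dominated E {c}) + 3 \<le> d"
              using card_rest False by linarith
            show "v \<in> V1" "v \<notin> dominated E {c}" using v by blast+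
          qed (fact D)+
        next
          show "d * card {} + d \<le> size t + 2" using \<open>d - 1 \<le> size t\<close> by simp
        qed simp
      qed
    qed
  qed
qed

section \<open>The core of a triangulated polygon\<close>

text \<open>
  The interior vertices of degree two: the labels of the nodes without children.
\<close>
fun ears :: "'a tree \<Rightarrow> 'a set" where
  "ears Leaf = {}"
| "ears (Node l v r) = (if l = Leaf \<and> r = Leaf then {v} else ears l \<union> ears r)"

fun prune :: "'a tree \<Rightarrow> 'a tree" where
  "prune Leaf = Leaf"
| "prune (Node l v r) = (if l = Leaf \<and> r = Leaf then Leaf else Node (prune l) v (prune r))"

lemma ears_subset: "ears t \<subseteq> set (inorder t)"
  by (induction t) auto

lemma finite_ears: "finite (ears t)"
  using ears_subset finite_subset by fastforce

lemma double_card_ears: "2 * card (ears t) \<le> size t + 1"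
proof (induction t)
  case (Node l v r)
  have "card (ears l \<union> ears r) \<le> card (ears l) + card (ears r)" by (rule card_Un_le)
  then show ?case using Node by (cases "l = Leaf"; cases "r = Leaf") auto
qed simp

lemma ears_endpoints:
  assumes "distinct (outline x t y)"
  shows "x \<notin> ears t" "y \<notin> ears t"
  using ears_subset[of t] assms by auto

lemma inorder_prune:
  assumes "distinct (inorder t)"
  shows "inorder (prune t) = filter (\<lambda>v. v \<notin> ears t) (inorder t)"
  using assms
proof (induction t)
  case (Node l v r)
  have sub: "ears l \<subseteq> set (inorder l)" "ears r \<subseteq> set (inorder r)" by (rule ears_subset)+
  have "filter (\<lambda>w. w \<notin> ears l \<union> ears r) (inorder l) = filter (\<lambda>w. w \<notin> ears l) (inorder l)"
    by (rule filter_cong) (use sub Node.prems in auto)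
  moreover have "filter (\<lambda>w. w \<notin> ears l \<union> ears r) (inorder r) = filter (\<lambda>w. w \<notin> ears r) (inorder r)"
    by (rule filter_cong) (use sub Node.prems in auto)
  moreover have "v \<notin> ears l \<union> ears r" using sub Node.prems by auto
  ultimately show ?case using Node by auto
qed simp

lemma tree_edges_prune:
  assumes "distinct (outline x t y)"
  shows "tree_edges x (prune t) y = {e \<in> tree_edges x t y. e \<inter> ears t = {}}"
  using assms
proof (induction t arbitrary: x y)
  case (Node l v r)
  have sub: "ears l \<subseteq> set (inorder l)" "ears r \<subseteq> set (inorder r)" by (rule ears_subset)+
  have dl: "distinct (outline x l v)" and dr: "distinct (outline v r y)" using Node.prems by auto
  show ?case
  proof (cases "l = Leaf \<and> r = Leaf")
    case True
    then show ?thesis using Node.prems by auto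
  next
    case False
    have eL: "e \<inter> ears r = {}" if "e \<in> tree_edges x l v" for e
      using tree_edges_subset[OF that] sub Node.prems by auto
    have eR: "e \<inter> ears l = {}" if "e \<in> tree_edges v r y" for e
      using tree_edges_subset[OF that] sub Node.prems by auto
    have "{x, y} \<inter> (ears l \<union> ears r) = {}" using sub Node.prems by auto
    then have "{e \<in> tree_edges x (Node l v r) y. e \<inter> (ears l \<union> ears r) = {}} =
        insert {x, y} ({e \<in> tree_edges x l v. e \<inter> ears l = {}} \<union> {e \<in> tree_edges v r y. e \<inter> ears r = {}})"
      using eL eR unfolding tree_edges.simps by blast
    then show ?thesis using False Node.IH(1)[OF dl] Node.IH(2)[OF dr] by (simp add: if_not_P)
  qed
qed auto

lemma ears_independent:
  assumes "distinct (outline x t y)" "e \<in> tree_edges x t y" "v \<in> e \<inter> ears t" "w \<in> e \<inter> ears t"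
  shows "v = w"
  using assms
proof (induction t arbitrary: x y)
  case (Node l z r)
  have sub: "ears l \<subseteq> set (inorder l)" "ears r \<subseteq> set (inorder r)" by (rule ears_subset)+
  have dl: "distinct (outline x l z)" and dr: "distinct (outline z r y)" using Node.prems by auto
  show ?case
  proof (cases "l = Leaf \<and> r = Leaf")
    case True
    then show ?thesis using Node.prems by auto
  next
    case False
    have eL: "e \<inter> ears r = {}" if "e \<in> tree_edges x l z" for e
      using tree_edges_subset[OF that] sub Node.prems(1) by auto
    have eR: "e \<inter> ears l = {}" if "e \<in> tree_edges z r y" for e
      using tree_edges_subset[OF that] sub Node.prems(1) by auto
    have eXY: "{x, y} \<inter> (ears l \<union> ears r) = {}" using sub Node.prems(1) by auto
    have vw: "v \<in> e" "w \<in> e" "v \<in> ears l \<union> ears r" "w \<in> ears l \<union> ears r" using Node.prems(3,4) False by auto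
    consider "e = {x, y}" | "e \<in> tree_edges x l z" | "e \<in> tree_edges z r y" using Node.prems(2) by auto
    then show ?thesis
    proof cases
      case 1 then show ?thesis using vw eXY by blast
    next
      case 2
      then have "v \<in> e \<inter> ears l" "w \<in> e \<inter> ears l" using vw eL[OF 2] by blast+
      then show ?thesis by (rule Node.IH(1)[OF dl 2])
    next
      case 3
      then have "v \<in> e \<inter> ears r" "w \<in> e \<inter> ears r" using vw eR[OF 3] by blast+
      then show ?thesis by (rule Node.IH(2)[OF dr 3])
    qed
  qed
qed simp

text \<open>
  An end of the root edge meets at most one ear, because it belongs to only one of the two
  subpolygons.  An apex belongs to both and may meet one ear of each.
\<close>
lemma ears_at_vertex:
  assumes "distinct (outline x t y)"
  shows "\<exists>a. {w \<in> ears t. {x, w} \<in> tree_edges x t y} \<subseteq> {a}" (is ?X)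
    and "\<exists>a. {w \<in> ears t. {y, w} \<in> tree_edges x t y} \<subseteq> {a}" (is ?Y)
    and "\<exists>a b. {w \<in> ears t. {v, w} \<in> tree_edges x t y} \<subseteq> {a, b}" (is ?V)
proof -
  have "?X \<and> ?Y \<and> (\<forall>v. \<exists>a b. {w \<in> ears t. {v, w} \<in> tree_edges x t y} \<subseteq> {a, b})"
    using assms
  proof (induction t arbitrary: x y)
    case (Node l z r)
    have sub: "ears l \<subseteq> set (inorder l)" "ears r \<subseteq> set (inorder r)" by (rule ears_subset)+
    have dl: "distinct (outline x l z)" and dr: "distinct (outline z r y)" using Node.prems by auto
    show ?case
    proof (cases "l = Leaf \<and> r = Leaf")
      case True
      then show ?thesis by auto
    next
      case False
      let ?N = "\<lambda>v. {w \<in> ears (Node l z r). {v, w} \<in> tree_edges x (Node l z r) y}"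
      let ?L = "\<lambda>v. {w \<in> ears l. {v, w} \<in> tree_edges x l z}"
      let ?R = "\<lambda>v. {w \<in> ears r. {v, w} \<in> tree_edges z r y}"
      have eL: "w \<notin> ears r" if "{v, w} \<in> tree_edges x l z" for v w
        using tree_edges_subset[OF that] sub Node.prems by auto
      have eR: "w \<notin> ears l" if "{v, w} \<in> tree_edges z r y" for v w
        using tree_edges_subset[OF that] sub Node.prems by auto
      have eXY: "x \<notin> ears l \<union> ears r" "y \<notin> ears l \<union> ears r" using sub Node.prems(1) by auto
      have N: "?N v \<subseteq> ?L v \<union> ?R v" for v
      proof
        fix w assume "w \<in> ?N v"
        then have w: "w \<in> ears l \<union> ears r"
          "{v, w} = {x, y} \<or> {v, w} \<in> tree_edges x l z \<or> {v, w} \<in> tree_edges z r y" using False by auto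
        then have "{v, w} \<noteq> {x, y}" using eXY by (auto simp: doubleton_eq_iff)
        then show "w \<in> ?L v \<union> ?R v" using w eL eR by blast
      qed
      have comb: "?N v \<subseteq> A \<union> B" if "?L v \<subseteq> A" "?R v \<subseteq> B" for v A B
        using subset_trans[OF N[of v] Un_mono[OF that]] .
      have inL: "v \<in> set (outline x l z)" if "?L v \<noteq> {}" for v
        using that tree_edges_subset[of _ x l z] by blast
      have inR: "v \<in> set (outline z r y)" if "?R v \<noteq> {}" for v
        using that tree_edges_subset[of _ z r y] by blast
      have R0: "?R x \<subseteq> {}" using inR[of x] Node.prems by auto
      obtain a where a: "?L x \<subseteq> {a}" using Node.IH(1)[OF dl] by auto
      have X: "\<exists>a. ?N x \<subseteq> {a}" using comb[OF a R0] unfolding Un_empty_right by (rule exI)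
      have L0: "?L y \<subseteq> {}" using inL[of y] Node.prems by auto
      obtain b where b: "?R y \<subseteq> {b}" using Node.IH(2)[OF dr] by auto
      have Y: "\<exists>a. ?N y \<subseteq> {a}" using comb[OF L0 b] unfolding Un_empty_left by (rule exI)
      have V: "\<exists>a b. ?N v \<subseteq> {a, b}" for v
      proof -
        consider "v = z" | "?L v \<subseteq> {}" | "?R v \<subseteq> {}" using inL[of v] inR[of v] Node.prems by auto
        then show ?thesis
        proof cases
          case 1
          obtain a where a: "?L z \<subseteq> {a}" using Node.IH(1)[OF dl] by auto
          obtain b where b: "?R z \<subseteq> {b}" using Node.IH(2)[OF dr] by auto
          have "{a} \<union> {b} = {a, b}" by auto
          then show ?thesis using comb[OF a b] unfolding 1 by (metis (no_types, lifting))
        next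
          case 2
          obtain a b where ab: "?R v \<subseteq> {a, b}" using Node.IH(2)[OF dr] by meson
          show ?thesis using comb[OF 2 ab] unfolding Un_empty_left by (intro exI)
        next
          case 3
          obtain a b where ab: "?L v \<subseteq> {a, b}" using Node.IH(1)[OF dl] by meson
          show ?thesis using comb[OF ab 3] unfolding Un_empty_right by (intro exI)
        qed
      qed
      show ?thesis by (intro conjI allI X Y V)
    qed
  qed simp
  then show ?X ?Y ?V by blast+
qed

lemma finite_tree_nbs: "finite {w. {v, w} \<in> tree_edges x t y}"
proof (rule finite_subset)
  show "{w. {v, w} \<in> tree_edges x t y} \<subseteq> set (outline x t y)"
    using tree_edges_subset[of _ x t y] by blast
qed simp

lemma three_nbs:
  assumes "{v, a} \<in> tree_edges x t y" "{v, b} \<in> tree_edges x t y" "{v, c} \<in> tree_edges x t y"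
    "a \<noteq> b" "b \<noteq> c" "a \<noteq> c"
  shows "3 \<le> card {w. {v, w} \<in> tree_edges x t y}"
proof -
  have "card {a, b, c} \<le> card {w. {v, w} \<in> tree_edges x t y}"
    using assms by (intro card_mono finite_tree_nbs) auto
  then show ?thesis using assms by simp
qed

lemma endpoint_nbs:
  assumes "distinct (outline x (Node l z r) y)" "l \<noteq> Leaf"
  shows "3 \<le> card {w. {x, w} \<in> tree_edges x (Node l z r) y}"
proof -
  obtain q where "q \<in> set (inorder l)" "{x, q} \<in> tree_edges x l z" using root_label_adjacent[OF assms(2)] by blast
  then show ?thesis using assms(1) root_edge[of x z l]
    by (intro three_nbs[of x y _ _ _ z q]) auto
qed

text \<open>
  Each interior vertex \<open>v\<close> is the apex of a triangle and so has two neighbours; a nonempty subtree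
  on one side of \<open>v\<close> contributes the apex of the next triangle as a third one.
\<close>
lemma interior_degree_two_iff:
  assumes "distinct (outline x t y)" "v \<in> set (inorder t)"
  shows "card {w. {v, w} \<in> tree_edges x t y} = 2 \<longleftrightarrow> v \<in> ears t"
  using assms
proof (induction t arbitrary: x y)
  case (Node l z r)
  have sub: "ears l \<subseteq> set (inorder l)" "ears r \<subseteq> set (inorder r)" by (rule ears_subset)+
  have dl: "distinct (outline x l z)" and dr: "distinct (outline z r y)" using Node.prems by auto
  consider "v = z" "l = Leaf" "r = Leaf" | "v = z" "l \<noteq> Leaf" | "v = z" "r \<noteq> Leaf"
    | "v \<in> set (inorder l)" | "v \<in> set (inorder r)" using Node.prems by auto
  then show ?case
  proof cases
    case 1
    then have "{w. {v, w} \<in> tree_edges x (Node l z r) y} = {x, y}"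
      using Node.prems by (auto simp: doubleton_eq_iff)
    then show ?thesis using 1 Node.prems by simp
  next
    case 2
    obtain q where "q \<in> set (inorder l)" "{z, q} \<in> tree_edges x l z" using root_label_adjacent[OF 2(2)] by blast
    then have "3 \<le> card {w. {v, w} \<in> tree_edges x (Node l z r) y}" 
      using 2 Node.prems root_edge[of x z l] root_edge[of z y r]
      by (intro three_nbs[of _ x _ _ _ y q]) (auto simp: insert_commute)
    then show ?thesis using sub Node.prems 2 by auto
  next
    case 3
    obtain q where "q \<in> set (inorder r)" "{z, q} \<in> tree_edges z r y" using root_label_adjacent[OF 3(2)] by blast
    then have "3 \<le> card {w. {v, w} \<in> tree_edges x (Node l z r) y}" 
      using 3 Node.prems root_edge[of x z l] root_edge[of z y r]
      by (intro three_nbs[of _ x _ _ _ y q]) (auto simp: insert_commute)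
    then show ?thesis using sub Node.prems 3 by auto
  next
    case 4
    have "v \<noteq> x" "v \<noteq> y" "v \<notin> set (outline z r y)" using 4 Node.prems by auto
    then have "{w. {v, w} \<in> tree_edges x (Node l z r) y} = {w. {v, w} \<in> tree_edges x l z}"
      using tree_edges_subset[of _ z r y] by (auto simp: doubleton_eq_iff)
    moreover have "v \<in> ears (Node l z r) \<longleftrightarrow> v \<in> ears l" using 4 sub \<open>v \<notin> set (outline z r y)\<close> by auto
    ultimately show ?thesis using Node.IH(1)[OF dl 4] by simp
  next
    case 5
    have "v \<noteq> x" "v \<noteq> y" "v \<notin> set (outline x l z)" using 5 Node.prems by auto
    then have "{w. {v, w} \<in> tree_edges x (Node l z r) y} = {w. {v, w} \<in> tree_edges z r y}"
      using tree_edges_subset[of _ x l z] by (auto simp: doubleton_eq_iff)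
    moreover have "v \<in> ears (Node l z r) \<longleftrightarrow> v \<in> ears r" using 5 sub \<open>v \<notin> set (outline x l z)\<close> by auto
    ultimately show ?thesis using Node.IH(2)[OF dr 5] by simp
  qed
qed simp

lemma tree_edges_mirror: "tree_edges y (mirror t) x = tree_edges x t y"
  by (induction t arbitrary: x y) (auto simp: insert_commute)

text \<open>
  What the reduction needs to know about the set \<open>Z\<close> of degree-two vertices: deleting \<open>Z\<close> leaves
  a triangulated polygon, \<open>Z\<close> is independent, every vertex has at most two neighbours in \<open>Z\<close>, and
  \<open>Z\<close> contains at most half of the vertices.
\<close>
definition has_core :: "'a set \<Rightarrow> 'a set set \<Rightarrow> 'a set \<Rightarrow> bool" where
  "has_core V E Z \<longleftrightarrow>
     (\<exists>x t y. distinct (outline x t y) \<and> set (outline x t y) = V - Z \<and>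
        tree_edges x t y = {e \<in> E. e \<inter> Z = {}}) \<and>
     (\<forall>e\<in>E. \<forall>v \<in> e \<inter> Z. \<forall>w \<in> e \<inter> Z. v = w) \<and>
     (\<forall>v. \<exists>a b. {w \<in> Z. {v, w} \<in> E} \<subseteq> {a, b}) \<and> 2 * card Z \<le> card V"

lemma core_root_high:
  assumes dist: "distinct (outline x t y)"
  shows "has_core (set (outline x t y)) (tree_edges x t y) (ears t)"
  unfolding has_core_def
proof (intro conjI ballI allI)
  have "inorder (prune t) = filter (\<lambda>v. v \<notin> ears t) (inorder t)" using dist by (intro inorder_prune) auto
  then have "distinct (outline x (prune t) y) \<and> set (outline x (prune t) y) = set (outline x t y) - ears t"
    using dist ears_endpoints[OF dist] by auto
  then show "\<exists>x' t' y'. distinct (outline x' t' y') \<and> set (outline x' t' y') = set (outline x t y) - ears t \<and>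
        tree_edges x' t' y' = {e \<in> tree_edges x t y. e \<inter> ears t = {}}"
    using tree_edges_prune[OF dist] by blast
  show "v = w" if "e \<in> tree_edges x t y" "v \<in> e \<inter> ears t" "w \<in> e \<inter> ears t" for e v w
    using ears_independent[OF dist that] .
  show "\<exists>a b. {w \<in> ears t. {v, w} \<in> tree_edges x t y} \<subseteq> {a, b}" for v
    by (rule ears_at_vertex(3)[OF dist])
  show "2 * card (ears t) \<le> card (set (outline x t y))"
    using double_card_ears[of t] distinct_card[OF dist] by simp
qed

text \<open>
  If an end \<open>x\<close> of the root edge has degree two, then the polygon is rooted anew at the edge \<open>zy\<close>
  of the triangle that contains \<open>x\<close>.
\<close>
lemma core_root_ear:
  assumes dist: "distinct (outline x (Node Leaf z r) y)" 
  shows "has_core (set (outline x (Node Leaf z r) y)) (tree_edges x (Node Leaf z r) y) (insert x (ears r))"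
    (is "has_core ?V ?E ?Z")
  unfolding has_core_def
proof (intro conjI ballI allI)
  have dr: "distinct (outline z r y)" and x: "x \<notin> set (outline z r y)" using dist by auto
  have V: "?V = insert x (set (outline z r y))" by auto
  have E: "?E = {{x, y}, {x, z}} \<union> tree_edges z r y" by auto
  have xE: "x \<notin> e" if "e \<in> tree_edges z r y" for e
    using tree_edges_subset[OF that] x by auto
  have ends: "z \<notin> ears r" "y \<notin> ears r" using ears_endpoints[OF dr] .
  have xr: "x \<notin> ears r" using ears_subset[of r] x by auto
  have "inorder (prune r) = filter (\<lambda>v. v \<notin> ears r) (inorder r)" using dr by (intro inorder_prune) auto
  then have "distinct (outline z (prune r) y)" "set (outline z (prune r) y) = ?V - ?Z"
    using dr ends x xr unfolding V by auto
  moreover have "tree_edges z (prune r) y = {e \<in> ?E. e \<inter> ?Z = {}}"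
    using tree_edges_prune[OF dr] xE unfolding E by auto
  ultimately show "\<exists>x' t' y'. distinct (outline x' t' y') \<and> set (outline x' t' y') = ?V - ?Z \<and>
        tree_edges x' t' y' = {e \<in> ?E. e \<inter> ?Z = {}}" by blast
  show "v = w" if e: "e \<in> ?E" and v: "v \<in> e \<inter> ?Z" and w: "w \<in> e \<inter> ?Z" for e v w
  proof (cases "e \<in> tree_edges z r y")
    case True
    then show ?thesis using ears_independent[OF dr True] v w xE[OF True] by auto
  next
    case False
    then have "e = {x, y} \<or> e = {x, z}" using e E by auto
    then show ?thesis using v w ends by auto
  qed
  have N: "{w \<in> ?Z. {v, w} \<in> ?E} \<subseteq> {x} \<union> {w \<in> ears r. {v, w} \<in> tree_edges z r y}" if "v \<noteq> x" for v
    using that xr unfolding E by (auto simp: doubleton_eq_iff)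
  have N': "{w \<in> ?Z. {v, w} \<in> ?E} \<subseteq> {w \<in> ears r. {v, w} \<in> tree_edges z r y}" if "v \<noteq> x" "v \<noteq> y" "v \<noteq> z" for v
    using that xE xr unfolding E by (auto simp: doubleton_eq_iff)
  show "\<exists>a b. {w \<in> ?Z. {v, w} \<in> ?E} \<subseteq> {a, b}" for v
  proof -
    consider "v = x" | "v = z" | "v = y" | "v \<noteq> x" "v \<noteq> y" "v \<noteq> z" by blast
    then show ?thesis
    proof cases
      case 1
      have "{w \<in> ?Z. {x, w} \<in> ?E} \<subseteq> {y, z}" using xE[of "{x, _}"] dist unfolding E by (auto simp: doubleton_eq_iff)
      then show ?thesis unfolding 1 by (intro exI)
    next
      case 2
      obtain a where "{w \<in> ears r. {z, w} \<in> tree_edges z r y} \<subseteq> {a}" using ears_at_vertex(1)[OF dr] by auto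
      then have "{w \<in> ?Z. {z, w} \<in> ?E} \<subseteq> {x, a}" using N[of z] dist by fastforce
      then show ?thesis unfolding 2 by (intro exI)
    next
      case 3
      obtain a where "{w \<in> ears r. {y, w} \<in> tree_edges z r y} \<subseteq> {a}" using ears_at_vertex(2)[OF dr] by auto
      then have "{w \<in> ?Z. {y, w} \<in> ?E} \<subseteq> {x, a}" using N[of y] dist by fastforce
      then show ?thesis unfolding 3 by (intro exI)
    next
      case 4
      obtain a b where "{w \<in> ears r. {v, w} \<in> tree_edges z r y} \<subseteq> {a, b}" using ears_at_vertex(3)[OF dr] by meson
      then show ?thesis using subset_trans[OF N'[OF 4]] by (intro exI)
    qed
  qed
  have "card ?Z = Suc (card (ears r))" using xr finite_ears[of r] by simp
  moreover have "card ?V = size r + 3" using distinct_card[OF dist] by simp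
  ultimately show "2 * card ?Z \<le> card ?V" using double_card_ears[of r] by simp
qed

text \<open>
  The ends of the root edge are not both of degree two, since the polygon has at least four vertices.
  If \<open>y\<close> is, the mirror image of the tree brings the situation into the form of
  \<open>core_root_ear\<close>.
\<close>
lemma degree_two_core:
  assumes dist: "distinct (outline x t y)" and size: "2 \<le> size t"
  defines "E \<equiv> tree_edges x t y" and "V \<equiv> set (outline x t y)"
  shows "has_core V E {v \<in> V. card {w. {v, w} \<in> E} = 2}" (is "has_core V E ?Z")
proof -
  from size obtain l z r where t: "t = Node l z r" by (cases t) auto
  have ear: "has_core (set (outline a (Node Leaf c s) b)) (tree_edges a (Node Leaf c s) b)
       {v \<in> set (outline a (Node Leaf c s) b). card {w. {v, w} \<in> tree_edges a (Node Leaf c s) b} = 2}"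
    if d: "distinct (outline a (Node Leaf c s) b)" and s: "s \<noteq> Leaf" for a c b :: 'a and s
  proof -
    let ?E = "tree_edges a (Node Leaf c s) b" and ?V = "set (outline a (Node Leaf c s) b)"

    have "{w. {a, w} \<in> ?E} = {b, c}"
      using d tree_edges_subset[of _ c s b] by (auto simp: doubleton_eq_iff)
    moreover have "b \<noteq> c" using d by auto
    ultimately have a2: "card {w. {a, w} \<in> ?E} = 2" by simp
    obtain q where q: "q \<in> set (inorder s)" "{b, q} \<in> tree_edges c s b"
      using root_label_adjacent[OF s] by blast
    have "3 \<le> card {w. {b, w} \<in> ?E}" using q d root_edge[of c b s]
      by (intro three_nbs[of b a _ _ _ c q]) (auto simp: insert_commute)
    then have b: "card {w. {b, w} \<in> ?E} \<noteq> 2" by simp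
    have "{v \<in> ?V. card {w. {v, w} \<in> ?E} = 2} = insert a (ears (Node Leaf c s))"
      using a2 b interior_degree_two_iff[OF d] ears_subset[of "Node Leaf c s"] by auto
    then have "{v \<in> ?V. card {w. {v, w} \<in> ?E} = 2} = insert a (ears s)" using s by simp
    then show ?thesis using core_root_ear[OF d] by simp
  qed
  consider "l \<noteq> Leaf" "r \<noteq> Leaf" | "l = Leaf" "r \<noteq> Leaf" | "l \<noteq> Leaf" "r = Leaf"
    using size t by (cases "l = Leaf"; cases "r = Leaf") auto
  then show ?thesis
  proof cases
    case 1
    have "3 \<le> card {w. {x, w} \<in> E}" using endpoint_nbs[of x l z r y] dist 1 unfolding E_def t by simp
    moreover have "3 \<le> card {w. {y, w} \<in> E}"
    proof -
      have "tree_edges y (Node (mirror r) z (mirror l)) x = E"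
        using tree_edges_mirror[of y t x] unfolding E_def t by simp
      moreover have "distinct (outline y (Node (mirror r) z (mirror l)) x)"
        using dist unfolding t by (auto simp: inorder_mirror)
      moreover have "mirror r \<noteq> Leaf" using 1 by simp
      ultimately show ?thesis using endpoint_nbs[of y "mirror r" z "mirror l" x] by simp
    qed
    ultimately have "?Z = ears t"
      using interior_degree_two_iff[OF dist] ears_subset[of t] unfolding V_def E_def by auto
    then show ?thesis using core_root_high[OF dist] unfolding V_def E_def by simp
  next
    case 2
    then show ?thesis using ear[of x z r y] dist unfolding V_def E_def t by simp
  next
    case 3
    have "tree_edges y (Node Leaf z (mirror l)) x = E"
      using tree_edges_mirror[of y t x] 3 unfolding E_def t by simp
    moreover have "set (outline y (Node Leaf z (mirror l)) x) = V" unfolding V_def t 3 by (auto simp: inorder_mirror)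
    moreover have "distinct (outline y (Node Leaf z (mirror l)) x)"
      using dist unfolding t 3 by (auto simp: inorder_mirror)
    ultimately show ?thesis using ear[of y z "mirror l" x] 3 by simp
  qed
qed


section \<open>Cutting a drawn polygon along a chord\<close>

fun path_edges :: "'a list \<Rightarrow> 'a set set" where
  "path_edges (u # w # vs) = insert {u, w} (path_edges (w # vs))"
| "path_edges _ = {}"

text \<open>
  The edge set \<open>cycle_edges vs\<close> in a form that matches recursion on lists.
\<close>
definition closed_walk_edges :: "'a list \<Rightarrow> 'a set set" where
  "closed_walk_edges vs = insert {hd vs, last vs} (path_edges vs)"

lemma path_edges_append: 
  "path_edges (us @ v # vs) = path_edges (us @ [v]) \<union> path_edges (v # vs)"
proof (induction us)
  case (Cons u us)
  then show ?case by (cases us) auto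
qed simp

lemma path_edges_join:
  assumes "us \<noteq> []" "vs \<noteq> []"
  shows "path_edges (us @ vs) = insert {last us, hd vs} (path_edges us \<union> path_edges vs)"
  using assms
proof (induction us rule: path_edges.induct)
  case ("2_2" v)
  then show ?case by (cases vs) auto
qed auto

lemma path_edges_subset: "e \<in> path_edges vs \<Longrightarrow> e \<subseteq> set vs"
  by (induction vs rule: path_edges.induct) auto

lemma closed_walk_edges_subset: "e \<in> closed_walk_edges vs \<Longrightarrow> length vs \<ge> 3 \<Longrightarrow> e \<subseteq> set vs"
  using path_edges_subset[of e vs] hd_in_set[of vs] last_in_set[of vs]
  unfolding closed_walk_edges_def by fastforce

lemma Union_path_edges: "length vs \<ge> 2 \<Longrightarrow> \<Union>(path_edges vs) = set vs"
proof (induction vs rule: path_edges.induct)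
  case (1 u w vs)
  then show ?case by (cases vs) auto
qed auto

lemma path_edges_nth: "path_edges vs = {{vs ! i, vs ! Suc i} | i. Suc i < length vs}"
proof (induction vs rule: path_edges.induct)
  case (1 u w vs)
  have "{{(u # w # vs) ! i, (u # w # vs) ! Suc i} | i. Suc i < length (u # w # vs)} =
     insert {u, w} {{(w # vs) ! i, (w # vs) ! Suc i} | i. Suc i < length (w # vs)}"
    (is "?L = ?R")
  proof
    show "?L \<subseteq> ?R"
    proof
      fix e assume "e \<in> ?L"
      then obtain i where "e = {(u # w # vs) ! i, (u # w # vs) ! Suc i}" "Suc i < length (u # w # vs)" by blast
      then show "e \<in> ?R" by (cases i) auto
    qed
    show "?R \<subseteq> ?L"
    proof
      fix e assume "e \<in> ?R"
      then consider "e = {u, w}" | i where "e = {(w # vs) ! i, (w # vs) ! Suc i}" "Suc i < length (w # vs)" by blast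
      then show "e \<in> ?L"
      proof cases
        case 1 then show ?thesis by (intro CollectI exI[of _ 0]) auto
      next
        case (2 i) then show ?thesis by (intro CollectI exI[of _ "Suc i"]) auto
      qed
    qed
  qed
  then show ?case using 1 by simp
qed auto

lemma cycle_edges_closed_walk:
  assumes "vs \<noteq> []"
  shows "cycle_edges vs = closed_walk_edges vs"
proof -
  have "{{vs ! i, vs ! (Suc i mod length vs)} | i. i < length vs} =
     insert {vs ! 0, vs ! (length vs - 1)} {{vs ! i, vs ! Suc i} | i. Suc i < length vs}" (is "?L = ?R")
  proof
    show "?L \<subseteq> ?R"
    proof
      fix e assume "e \<in> ?L"
      then obtain i where i: "e = {vs ! i, vs ! (Suc i mod length vs)}" "i < length vs" by blast
      show "e \<in> ?R"
      proof (cases "Suc i < length vs")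
        case True with i show ?thesis by auto
      next
        case False
        with i(2) have "Suc i = length vs" by linarith
        then have "Suc i mod length vs = 0" "i = length vs - 1" by auto
        with i(1) show ?thesis by (simp add: insert_commute)
      qed
    qed
    show "?R \<subseteq> ?L"
    proof
      fix e assume "e \<in> ?R"
      then consider "e = {vs ! 0, vs ! (length vs - 1)}" | i where "e = {vs ! i, vs ! Suc i}" "Suc i < length vs" by blast
      then show "e \<in> ?L"
      proof cases
        case 1 then show ?thesis using assms
          by (intro CollectI exI[of _ "length vs - 1"]) (auto simp: insert_commute)
      next
        case (2 i) then show ?thesis by (intro CollectI exI[of _ i]) auto
      qed
    qed
  qed
  then show ?thesis
    using assms by (simp add: cycle_edges_def closed_walk_edges_def path_edges_nth hd_conv_nth last_conv_nth)
qed

lemma drawn_edges_Un: "drawn_edges g (A \<union> B) = drawn_edges g A \<union> drawn_edges g B"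
  by (auto simp: drawn_edges_def)

lemma drawn_edges_insert: "drawn_edges g (insert e A) = path_image (g e) \<union> drawn_edges g A"
  by (auto simp: drawn_edges_def)

lemma drawn_edges_mono: "A \<subseteq> B \<Longrightarrow> drawn_edges g A \<subseteq> drawn_edges g B"
  by (auto simp: drawn_edges_def)

lemma tree_edges_restrict:
  assumes "f \<in> tree_edges a s b" "distinct (outline a s b)" "f \<subseteq> X"
  shows "set (outline a s b) \<inter> X \<subseteq> {q} \<Longrightarrow> False"
    and "set (outline a s b) \<inter> X \<subseteq> {q, q'} \<Longrightarrow> f = {q, q'}"
proof -
  have f: "f \<subseteq> set (outline a s b) \<inter> X" "card f = 2"
    using tree_edges_subset[OF assms(1)] assms(3) card_tree_edge[OF assms(1,2)] by auto
  show False if "set (outline a s b) \<inter> X \<subseteq> {q}"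
    using card_mono[of "{q}" f] f that by auto
  show "f = {q, q'}" if "set (outline a s b) \<inter> X \<subseteq> {q, q'}"
  proof (rule card_seteq)
    show "card {q, q'} \<le> card f" using f(2) by (simp add: card_insert_if)
  qed (use f that in auto)
qed

lemma Collect_restrict_Un:
  "{f \<in> insert e (A \<union> B). Q f} = (if Q e then {e} else {}) \<union> ({f \<in> A. Q f} \<union> {f \<in> B. Q f})"
  by auto

text \<open>
  The edges within the two parts into which a side of the root triangle splits the polygon: for the
  side \<open>xz\<close> the first two statements, for the side \<open>zy\<close> the last two.
\<close>
lemma tree_edges_within:
  assumes "distinct (outline x (Node l z r) y)"
  shows "{f \<in> tree_edges x (Node l z r) y. f \<subseteq> set (x # inorder l @ [z])} = tree_edges x l z"
    and "{f \<in> tree_edges x (Node l z r) y. f \<subseteq> set (x # z # inorder r @ [y])} = tree_edges x (Node Leaf z r) y"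
    and "{f \<in> tree_edges x (Node l z r) y. f \<subseteq> set (z # inorder r @ [y])} = tree_edges z r y"
    and "{f \<in> tree_edges x (Node l z r) y. f \<subseteq> set ((x # inorder l) @ [z, y])} = tree_edges x (Node l z Leaf) y"
proof -
  have d: "distinct (outline x l z)" "distinct (outline z r y)" using assms by auto
  have all: "{f \<in> tree_edges a s b. f \<subseteq> X} = tree_edges a s b" if "set (outline a s b) \<subseteq> X" for a s b X
    using tree_edges_subset[of _ a s b] that by blast
  have none: "{f \<in> tree_edges a s b. f \<subseteq> X} = {}"
    if "distinct (outline a s b)" "set (outline a s b) \<inter> X \<subseteq> {q}" for a s b X q
    using tree_edges_restrict(1)[OF _ that(1) _ that(2)] by blast
  have one: "{f \<in> tree_edges a s b. f \<subseteq> X} = {{a, b}}"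
    if "distinct (outline a s b)" "set (outline a s b) \<inter> X \<subseteq> {a, b}" "{a, b} \<subseteq> X" for a s b X
    using tree_edges_restrict(2)[OF _ that(1) _ that(2)] root_edge[of a b s] that(3) by blast
  let ?X1 = "set (x # inorder l @ [z])" and ?X2 = "set (x # z # inorder r @ [y])"
  let ?X3 = "set (z # inorder r @ [y])" and ?X4 = "set ((x # inorder l) @ [z, y])"
  have "{f \<in> tree_edges x l z. f \<subseteq> ?X1} = tree_edges x l z" by (rule all) simp
  moreover have "{f \<in> tree_edges z r y. f \<subseteq> ?X1} = {}" by (rule none[OF d(2), of _ z]) (use assms in auto)
  moreover have "\<not> {x, y} \<subseteq> ?X1" using assms by auto
  ultimately show "{f \<in> tree_edges x (Node l z r) y. f \<subseteq> ?X1} = tree_edges x l z"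
    by (simp only: tree_edges.simps Collect_restrict_Un if_False Un_empty_left Un_empty_right)
  have "{f \<in> tree_edges x l z. f \<subseteq> ?X2} = {{x, z}}" by (rule one[OF d(1)]) (use assms in auto)
  moreover have "{f \<in> tree_edges z r y. f \<subseteq> ?X2} = tree_edges z r y" by (rule all) auto
  moreover have "{x, y} \<subseteq> ?X2" by auto
  ultimately show "{f \<in> tree_edges x (Node l z r) y. f \<subseteq> ?X2} = tree_edges x (Node Leaf z r) y"
    by (simp only: tree_edges.simps Collect_restrict_Un if_True insert_is_Un[symmetric])
  have "{f \<in> tree_edges x l z. f \<subseteq> ?X3} = {}" by (rule none[OF d(1), of _ z]) (use assms in auto)
  moreover have "{f \<in> tree_edges z r y. f \<subseteq> ?X3} = tree_edges z r y" by (rule all) simp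
  moreover have "\<not> {x, y} \<subseteq> ?X3" using assms by auto
  ultimately show "{f \<in> tree_edges x (Node l z r) y. f \<subseteq> ?X3} = tree_edges z r y"
    by (simp only: tree_edges.simps Collect_restrict_Un if_False Un_empty_left Un_empty_right)
  have "{f \<in> tree_edges x l z. f \<subseteq> ?X4} = tree_edges x l z" by (rule all) auto
  moreover have "{f \<in> tree_edges z r y. f \<subseteq> ?X4} = {{z, y}}" by (rule one[OF d(2)]) (use assms in auto)
  moreover have "{x, y} \<subseteq> ?X4" by auto
  ultimately show "{f \<in> tree_edges x (Node l z r) y. f \<subseteq> ?X4} = tree_edges x (Node l z Leaf) y"
    by (simp only: tree_edges.simps Collect_restrict_Un if_True insert_is_Un[symmetric])
qed

text \<open>
  A connected set cannot meet both of two disjoint open sets whose union covers it.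
\<close>
lemma components_Un_disjoint_open:
  fixes U W :: "complex set"
  assumes "open U" "open W" "U \<inter> W = {}"
  shows "components (U \<union> W) = components U \<union> components W"
proof -
  have one: "components (U \<union> W) \<subseteq> components U \<union> components W"
  proof
    fix C assume C: "C \<in> components (U \<union> W)"
    then have "connected C" "C \<subseteq> U \<union> W" using in_components_connected in_components_subset by blast+
    then have "C \<subseteq> U \<or> C \<subseteq> W" using connectedD[of C U W] assms by blast
    then show "C \<in> components U \<union> components W"
      using components_intermediate_subset[OF C] by blast
  qed
  have two: "components U \<subseteq> components (U \<union> W)" if UW: "open U" "open W" "U \<inter> W = {}" for U W :: "complex set"
  proof
    fix C assume C: "C \<in> components U"
    then have C': "connected C" "C \<subseteq> U" "C \<noteq> {}"
      using in_components_connected in_components_subset in_components_nonempty by blast+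
    then obtain D where D: "D \<in> components (U \<union> W)" "C \<subseteq> D"
      using exists_component_superset[of C "U \<union> W"] by blast
    then have "connected D" "D \<subseteq> U \<union> W" using in_components_connected in_components_subset by blast+
    then have "D \<subseteq> U" using connectedD[of D U W] UW C' D(2) by blast
    then have "D \<subseteq> C" using components_maximal[OF C \<open>connected D\<close>] C' D(2) by blast
    then show "C \<in> components (U \<union> W)" using D by auto
  qed
  show ?thesis using one two[OF assms] two[of W U] assms by (auto simp: Un_commute Int_commute)
qed

context
  fixes G :: "'a sgraph" and p :: "'a \<Rightarrow> complex" and g :: "'a set \<Rightarrow> real \<Rightarrow> complex"
  assumes plane: "plane_graph G p g"
begin

lemma edge_pair: "e \<in> edges G \<Longrightarrow> e \<subseteq> verts G \<and> card e = 2 \<and> finite e"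
  using plane card_gt_0_iff[of e] unfolding plane_graph_def simple_graph_def by fastforce

lemma finite_edges: "finite (edges G)"
proof -
  have "edges G \<subseteq> Pow (verts G)" using edge_pair by auto
  moreover have "finite (verts G)" using plane unfolding plane_graph_def simple_graph_def by auto
  ultimately show ?thesis by (meson finite_Pow_iff finite_subset)
qed

lemma edge_arc:
  assumes "e \<in> edges G"
  shows "arc (g e)" "{pathstart (g e), pathfinish (g e)} = p ` e"
  using assms plane unfolding plane_graph_def by auto

lemma vertex_on_edge: 
  assumes "v \<in> verts G" "e \<in> edges G" "p v \<in> path_image (g e)" 
  shows "v \<in> e"
proof -
  have "p v \<in> p ` e" using assms plane unfolding plane_graph_def by blast
  then obtain u where u: "u \<in> e" "p v = p u" by auto
  then have "u \<in> verts G" using edge_pair[OF assms(2)] by auto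
  moreover have "inj_on p (verts G)" using plane unfolding plane_graph_def by simp
  ultimately have "v = u" using inj_onD[of p "verts G" v u] u(2) assms(1) by simp
  then show ?thesis using u(1) by simp
qed

lemma endpoints_on_edge: "e \<in> edges G \<Longrightarrow> p ` e \<subseteq> path_image (g e)"
  by (simp add: edge_arc(2)[symmetric] pathstart_in_path_image pathfinish_in_path_image)

lemma vertex_on_drawn: 
  assumes "v \<in> verts G" "A \<subseteq> edges G" "p v \<in> drawn_edges g A" 
  shows "v \<in> \<Union>A"
  using assms vertex_on_edge unfolding drawn_edges_def by blast

lemma open_edge_avoids:
  assumes "e \<in> edges G" "A \<subseteq> edges G" "e \<notin> A"
  shows "(path_image (g e) - p ` e) \<inter> drawn_edges g A = {}"
proof -
  have "(path_image (g e) - p ` e) \<inter> path_image (g f) = {}" if "f \<in> A" for f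
  proof -
    have "f \<in> edges G" "e \<noteq> f" using assms that by auto
    then show ?thesis using assms(1) plane unfolding plane_graph_def by simp
  qed
  then show ?thesis unfolding drawn_edges_def by blast
qed

text \<open>
  Two disjoint sets of edges are drawn so that they meet only in images of common vertices.
\<close>
lemma drawn_Int:
  assumes "A \<subseteq> edges G" "B \<subseteq> edges G" "A \<inter> B = {}"
  shows "drawn_edges g A \<inter> drawn_edges g B = p ` (\<Union>A \<inter> \<Union>B)"
proof
  show "p ` (\<Union>A \<inter> \<Union>B) \<subseteq> drawn_edges g A \<inter> drawn_edges g B"
    using endpoints_on_edge assms unfolding drawn_edges_def by blast
  show "drawn_edges g A \<inter> drawn_edges g B \<subseteq> p ` (\<Union>A \<inter> \<Union>B)"
  proof
    fix z assume "z \<in> drawn_edges g A \<inter> drawn_edges g B"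
    then obtain e f where ef: "e \<in> A" "f \<in> B" "z \<in> path_image (g e)" "z \<in> path_image (g f)"
      unfolding drawn_edges_def by blast
    have "e \<in> edges G" "f \<in> edges G" "e \<notin> {f}" using ef assms by auto
    then have "z \<in> p ` e" using open_edge_avoids[of e "{f}"] ef unfolding drawn_edges_def by auto
    then obtain v where v: "v \<in> e" "z = p v" by auto
    then have "v \<in> f" using vertex_on_edge[of v f] edge_pair[OF \<open>e \<in> edges G\<close>] \<open>f \<in> edges G\<close> ef by auto
    then show "z \<in> p ` (\<Union>A \<inter> \<Union>B)" using v ef by auto
  qed
qed

lemma edge_directed:
  assumes "{u, w} \<in> edges G"
  shows "\<exists>h. arc h \<and> path_image h = path_image (g {u, w}) \<and> pathstart h = p u \<and> pathfinish h = p w"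
proof -
  have "{pathstart (g {u, w}), pathfinish (g {u, w})} = {p u, p w}" using edge_arc(2)[OF assms] by auto
  then consider "pathstart (g {u, w}) = p u" "pathfinish (g {u, w}) = p w"
    | "pathstart (g {u, w}) = p w" "pathfinish (g {u, w}) = p u" by (auto simp: doubleton_eq_iff)
  then show ?thesis
    by cases (use edge_arc(1)[OF assms] in \<open>auto intro: exI[of _ "g {u, w}"] exI[of _ "reversepath (g {u, w})"]
       simp: arc_reversepath\<close>)
qed

lemma path_arc:
  assumes "path_edges vs \<subseteq> edges G" "distinct vs" "length vs \<ge> 2"
  shows "\<exists>h. arc h \<and> path_image h = drawn_edges g (path_edges vs) \<and>
             pathstart h = p (hd vs) \<and> pathfinish h = p (last vs)"
  using assms
proof (induction vs rule: path_edges.induct)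
  case (1 u w vs)
  then have uw: "{u, w} \<in> edges G" by auto
  from edge_directed[OF this] obtain h1 where
    h1: "arc h1" "path_image h1 = path_image (g {u, w})" "pathstart h1 = p u" "pathfinish h1 = p w" by blast
  show ?case
  proof (cases vs)
    case Nil
    then show ?thesis using h1 by (auto simp: drawn_edges_def)
  next
    case (Cons x xs)
    then obtain h2 where h2: "arc h2" "path_image h2 = drawn_edges g (path_edges (w # vs))"
       "pathstart h2 = p w" "pathfinish h2 = p (last (w # vs))" using 1 by auto
    have "{u, w} \<notin> path_edges (w # vs)" using path_edges_subset[of "{u, w}" "w # vs"] 1(3) by auto
    then have "drawn_edges g {{u, w}} \<inter> drawn_edges g (path_edges (w # vs)) = p ` (\<Union>{{u, w}} \<inter> \<Union>(path_edges (w # vs)))"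
      using 1(2) uw by (intro drawn_Int) auto
    moreover have "\<Union>(path_edges (w # vs)) \<subseteq> set (w # vs)" using path_edges_subset by blast
    ultimately have "path_image h1 \<inter> path_image h2 \<subseteq> {p w}"
      using 1(3) h1 h2 by (auto simp: drawn_edges_def)
    then have "arc (h1 +++ h2)" using h1 h2 by (intro arc_join) auto
    moreover have "path_image (h1 +++ h2) = drawn_edges g (path_edges (u # w # vs))"
      using h1 h2 by (simp add: path_image_join drawn_edges_insert)
    ultimately show ?thesis using h1 h2 by (intro exI[of _ "h1 +++ h2"]) auto
  qed
qed auto

definition outer_curve :: "'a list \<Rightarrow> complex set" where
  "outer_curve vs = drawn_edges g (closed_walk_edges vs)"

lemma closing_edge_not_path:
  assumes "distinct vs" "length vs \<ge> 3"
  shows "{hd vs, last vs} \<notin> path_edges vs"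
proof -
  obtain a b vs' where vs: "vs = a # b # vs'" "vs' \<noteq> []" using assms(2)
    by (cases vs; cases "tl vs"; cases "tl (tl vs)") auto
  then have "{a, last vs} \<notin> path_edges (b # vs')" using path_edges_subset[of "{a, last vs}" "b # vs'"] assms by auto
  moreover have "last vs \<noteq> b" "last vs \<noteq> a" using vs assms by auto
  ultimately show ?thesis using vs by (auto simp: doubleton_eq_iff)
qed

lemma outer_curve_simple:
  assumes "closed_walk_edges vs \<subseteq> edges G" "distinct vs" "length vs \<ge> 3"
  shows "\<exists>c. simple_path c \<and> pathfinish c = pathstart c \<and> path_image c = outer_curve vs"
proof -
  let ?e = "{hd vs, last vs}"
  have e: "?e \<in> edges G" "path_edges vs \<subseteq> edges G" using assms unfolding closed_walk_edges_def by auto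
  obtain h1 where h1: "arc h1" "path_image h1 = drawn_edges g (path_edges vs)"
      "pathstart h1 = p (hd vs)" "pathfinish h1 = p (last vs)"
    using path_arc[OF e(2) assms(2)] assms(3) by auto
  obtain h2 where h2: "arc h2" "path_image h2 = path_image (g ?e)"
      "pathstart h2 = p (last vs)" "pathfinish h2 = p (hd vs)"
    using edge_directed[of "last vs" "hd vs"] e(1) by (auto simp: insert_commute)
  have "drawn_edges g (path_edges vs) \<inter> drawn_edges g {?e} = p ` (\<Union>(path_edges vs) \<inter> \<Union>{?e})"
    using e closing_edge_not_path[OF assms(2,3)] by (intro drawn_Int) auto
  then have "path_image h1 \<inter> path_image h2 \<subseteq> {pathstart h1, pathstart h2}"
    using h1 h2 by (auto simp: drawn_edges_def)
  then have "simple_path (h1 +++ h2)" using h1 h2 by (intro simple_path_join_loop) auto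
  then show ?thesis using h1 h2
    by (intro exI[of _ "h1 +++ h2"])
       (auto simp: path_image_join outer_curve_def closed_walk_edges_def drawn_edges_insert)
qed

lemma outer_curve_Jordan:
  assumes "closed_walk_edges vs \<subseteq> edges G" "distinct vs" "length vs \<ge> 3"
  shows "inside (outer_curve vs) \<noteq> {}" "open (inside (outer_curve vs))"
    "connected (inside (outer_curve vs))" "open (outside (outer_curve vs))"
    "connected (outside (outer_curve vs))" "bounded (inside (outer_curve vs))"
    "\<not> bounded (outside (outer_curve vs))"
    "inside (outer_curve vs) \<inter> outside (outer_curve vs) = {}"
    "inside (outer_curve vs) \<union> outside (outer_curve vs) = - outer_curve vs"
    "frontier (inside (outer_curve vs)) = outer_curve vs"
    "frontier (outside (outer_curve vs)) = outer_curve vs"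
  using outer_curve_simple[OF assms] Jordan_inside_outside by metis+

text \<open>
  A closed curve formed by drawn edges, together with chords drawn in its inside.
\<close>
definition polygon :: "'a list \<Rightarrow> 'a set set \<Rightarrow> bool" where
  "polygon vs E \<longleftrightarrow> distinct vs \<and> length vs \<ge> 3 \<and> closed_walk_edges vs \<subseteq> E \<and> E \<subseteq> edges G \<and>
     (\<forall>e\<in>E. e \<subseteq> set vs) \<and>
     (\<forall>e \<in> E - closed_walk_edges vs. path_image (g e) - p ` e \<subseteq> inside (outer_curve vs))"

definition inner_faces :: "'a list \<Rightarrow> 'a set set \<Rightarrow> complex set set" where
  "inner_faces vs E = components (inside (outer_curve vs) - drawn_edges g E)"

lemma open_edge_connected:
  assumes "e \<in> edges G"
  shows "connected (path_image (g e) - p ` e)" "path_image (g e) - p ` e \<noteq> {}"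
  using edge_arc[OF assms] connected_simple_path_endless[of "g e"] nonempty_simple_path_endless[of "g e"]
  by (simp_all add: arc_imp_simple_path)

text \<open>
  Needed to locate the ends of a chord once its interior has been located.
\<close>
lemma edge_in_closure:
  assumes "e \<in> edges G"
  shows "path_image (g e) \<subseteq> closure (path_image (g e) - p ` e)"
proof -
  have arc: "arc (g e)" by (rule edge_arc(1)[OF assms])
  have "path_image (g e) - {pathstart (g e), pathfinish (g e)} = g e ` {0<..<1}"
    using arc by (intro simple_path_endless arc_imp_simple_path)
  then have "path_image (g e) - p ` e = g e ` {0<..<1}"
    using edge_arc(2)[OF assms] by simp
  moreover have "g e ` closure {0<..<1} \<subseteq> closure (g e ` {0<..<1})"
  proof (rule image_closure_subset)
    show "continuous_on (closure {0<..<1}) (g e)"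
      using arc_imp_path[OF arc] by (simp add: path_def)
  qed (auto intro: closure_subset[THEN subsetD])
  ultimately show ?thesis by (simp add: path_image_def)
qed

lemma closed_drawn: "A \<subseteq> edges G \<Longrightarrow> closed (drawn_edges g A)"
  unfolding drawn_edges_def using finite_edges edge_arc(1) closed_arc_image
  by (intro closed_UN) (auto intro: finite_subset)

lemma outer_curve_vertices:
  assumes "polygon vs E"
  shows "p ` set vs \<subseteq> outer_curve vs"
proof
  fix q assume "q \<in> p ` set vs"
  then obtain v where v: "v \<in> set vs" "q = p v" by auto
  have P: "closed_walk_edges vs \<subseteq> edges G" "length vs \<ge> 3" using assms unfolding polygon_def by auto
  from v P(2) obtain e where "e \<in> path_edges vs" "v \<in> e" using Union_path_edges[of vs] by auto
  then show "q \<in> outer_curve vs" using v P(1) endpoints_on_edge[of e]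
    unfolding outer_curve_def drawn_edges_def closed_walk_edges_def by auto
qed

lemma drawn_in_polygon:
  assumes "polygon vs E"
  shows "drawn_edges g E \<subseteq> inside (outer_curve vs) \<union> outer_curve vs"
proof
  have P: "closed_walk_edges vs \<subseteq> E" "E \<subseteq> edges G" "length vs \<ge> 3" "\<And>e. e \<in> E \<Longrightarrow> e \<subseteq> set vs"
    "\<And>e. e \<in> E \<Longrightarrow> e \<notin> closed_walk_edges vs \<Longrightarrow> path_image (g e) - p ` e \<subseteq> inside (outer_curve vs)"
    using assms unfolding polygon_def by auto
  fix z assume "z \<in> drawn_edges g E"
  then obtain e where e: "e \<in> E" "z \<in> path_image (g e)" unfolding drawn_edges_def by auto
  show "z \<in> inside (outer_curve vs) \<union> outer_curve vs"
  proof (cases "e \<in> closed_walk_edges vs \<or> z \<notin> p ` e")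
    case True
    then show ?thesis using P(5)[OF e(1)] e(2) unfolding outer_curve_def drawn_edges_def by blast
  next
    case False
    then obtain v where "v \<in> e" "z = p v" by auto
    moreover from this have "v \<in> \<Union>(path_edges vs)" using P(4)[OF e(1)] P(3) Union_path_edges[of vs] by auto
    then obtain f where "f \<in> path_edges vs" "v \<in> f" by auto
    ultimately have "z \<in> path_image (g f)" "f \<in> closed_walk_edges vs"
      using endpoints_on_edge[of f] P(1,2) unfolding closed_walk_edges_def by auto
    then show ?thesis unfolding outer_curve_def drawn_edges_def by auto
  qed
qed

text \<open>
  The chord \<open>uw\<close> and the two arcs \<open>A\<close> and \<open>B\<close> of the outer cycle between \<open>u\<close> and \<open>w\<close> form a theta
  curve, so the inside falls into two disjoint open parts and the open chord.  Any other chord is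
  connected and avoids \<open>uw\<close>; hence it lies in one of the parts, and by continuity its ends lie on
  the boundary of that part.
\<close>
lemma polygon_split:
  assumes poly: "polygon vs E" and vs: "vs = as @ u # ms @ w # bs" "ms \<noteq> []" "as @ bs \<noteq> []"
    and uw: "{u, w} \<in> E"
  defines "vs1 \<equiv> u # ms @ [w]" and "vs2 \<equiv> as @ u # w # bs"
  defines "E1 \<equiv> {f \<in> E. f \<subseteq> set vs1}" and "E2 \<equiv> {f \<in> E. f \<subseteq> set vs2}"
  shows "polygon vs1 E1" "polygon vs2 E2" "E = E1 \<union> E2"
    "inner_faces vs E = inner_faces vs1 E1 \<union> inner_faces vs2 E2"
proof -
  define A where "A = path_edges (u # ms @ [w])"
  define B where "B = path_edges (w # bs @ as @ [u])"
  have dist: "distinct vs" and EG: "E \<subseteq> edges G" and Evs: "\<And>e. e \<in> E \<Longrightarrow> e \<subseteq> set vs"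
    and outE: "closed_walk_edges vs \<subseteq> E"
    and chord: "\<And>e. e \<in> E \<Longrightarrow> e \<notin> closed_walk_edges vs \<Longrightarrow> path_image (g e) - p ` e \<subseteq> inside (outer_curve vs)"
    using poly unfolding polygon_def by blast+
  have dist1: "distinct vs1" "length vs1 \<ge> 3" and dist2: "distinct vs2" "length vs2 \<ge> 3"
    using dist vs by (auto simp: vs1_def vs2_def Suc_le_eq neq_Nil_conv)
  have distB: "distinct (w # bs @ as @ [u])" "length (w # bs @ as @ [u]) \<ge> 3"
    using dist vs by (auto simp: Suc_le_eq)
  have B: "B = path_edges (w # bs) \<union> {{last (w # bs), hd (as @ [u])}} \<union> path_edges (as @ [u])"
    unfolding B_def using path_edges_join[of "w # bs" "as @ [u]"] by auto
  have cw: "closed_walk_edges vs = A \<union> B"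
    unfolding B A_def closed_walk_edges_def vs(1)
    using path_edges_append[of as u "ms @ w # bs"] path_edges_append[of "u # ms" w bs]
    by (cases as) (auto simp: insert_commute)
  have cw1: "closed_walk_edges vs1 = insert {u, w} A"
    unfolding vs1_def A_def closed_walk_edges_def by simp
  have cw2: "closed_walk_edges vs2 = insert {u, w} B"
    unfolding B closed_walk_edges_def vs2_def
    using path_edges_append[of as u "w # bs"]
    by (cases as) (auto simp: insert_commute)
  have uwA: "{u, w} \<notin> A" unfolding A_def
    using closing_edge_not_path[OF dist1] by (simp add: vs1_def)
  have uwB: "{u, w} \<notin> B" unfolding B_def
    using closing_edge_not_path[OF distB] by (simp add: insert_commute)
  have UA: "\<Union>A = set vs1" unfolding A_def vs1_def by (rule Union_path_edges) simp
  have UB: "\<Union>B = set vs2" unfolding B_def using Union_path_edges[of "w # bs @ as @ [u]"]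
    by (auto simp: vs2_def)
  have meet: "set vs1 \<inter> set vs2 = {u, w}" using dist by (auto simp: vs(1) vs1_def vs2_def)
  have AE: "A \<subseteq> E" "B \<subseteq> E" using outE cw by auto
  have both: "f = {u, w}" if "f \<in> E" "f \<subseteq> set vs1" "f \<subseteq> set vs2" for f
  proof -
    have "f \<subseteq> {u, w}" using meet that by auto
    moreover have "card f = 2" using edge_pair that(1) EG by auto
    moreover have "card {u, w} = 2" using edge_pair uw EG by auto
    ultimately show ?thesis using card_subset_eq[of "{u, w}" f] by auto
  qed
  have AB: "A \<inter> B = {}" using both AE UA UB uwA by blast
  have AG: "A \<subseteq> edges G" "B \<subseteq> edges G" "{{u, w}} \<subseteq> edges G" using AE EG uw by auto
  let ?e = "{u, w}"
  let ?J = "outer_curve vs" and ?J1 = "outer_curve vs1" and ?J2 = "outer_curve vs2"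
  have J: "?J = drawn_edges g A \<union> drawn_edges g B"
    "?J1 = drawn_edges g A \<union> path_image (g ?e)" "?J2 = drawn_edges g B \<union> path_image (g ?e)"
    unfolding outer_curve_def cw cw1 cw2 by (auto simp: drawn_edges_Un drawn_edges_insert)
  obtain h1 where h1: "arc h1" "path_image h1 = drawn_edges g A" "pathstart h1 = p u" "pathfinish h1 = p w"
    using path_arc[of vs1] dist1 AG unfolding A_def vs1_def by auto
  obtain h2 where h2: "arc h2" "path_image h2 = drawn_edges g B" "pathstart h2 = p w" "pathfinish h2 = p u"
    using path_arc[of "w # bs @ as @ [u]"] distB AG unfolding B_def by auto
  obtain h where h: "arc h" "path_image h = path_image (g ?e)" "pathstart h = p u" "pathfinish h = p w"
    using edge_directed[of u w] AG by auto
  have de: "drawn_edges g {?e} = path_image (g ?e)" by (simp add: drawn_edges_def)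
  have e_chord: "path_image (g ?e) - p ` ?e \<subseteq> inside ?J"
    using chord[OF uw] cw uwA uwB by auto
  have "u \<noteq> w" using dist vs by auto
  have i12: "path_image h1 \<inter> path_image (reversepath h2) = {p u, p w}"
    using drawn_Int[OF AG(1,2) AB] UA UB meet h1 h2 by auto
  have i1: "path_image h1 \<inter> path_image h = {p u, p w}"
    using drawn_Int[OF AG(1,3)] uwA UA h1 h de by (auto simp: vs1_def)
  have i2: "path_image (reversepath h2) \<inter> path_image h = {p u, p w}"
    using drawn_Int[OF AG(2,3)] uwB UB h2 h de by (auto simp: vs2_def)
  have ne: "path_image h \<inter> inside (path_image h1 \<union> path_image (reversepath h2)) \<noteq> {}"
    using e_chord open_edge_connected(2)[of ?e] AG h h1 h2 J by auto
  have puw: "p u \<noteq> p w" using h arc_distinct_ends[OF h(1)] by auto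
  have "inside ?J1 \<inter> inside ?J2 = {} \<and>
        inside ?J1 \<union> inside ?J2 \<union> (path_image (g ?e) - p ` ?e) = inside ?J"
    by (rule split_inside_simple_closed_curve[of h1 "p u" "p w" "reversepath h2" h])
       (use puw i12 i1 i2 ne h h1 h2 in \<open>simp_all add: arc_imp_simple_path simple_path_reversepath J\<close>)
  then have I12: "inside ?J1 \<inter> inside ?J2 = {}"
    and I: "inside ?J1 \<union> inside ?J2 \<union> (path_image (g ?e) - p ` ?e) = inside ?J" by blast+
  have cwG: "closed_walk_edges vs1 \<subseteq> edges G" "closed_walk_edges vs2 \<subseteq> edges G" "closed_walk_edges vs \<subseteq> edges G"
    unfolding cw1 cw2 cw using AG by auto
  note Jord1 = outer_curve_Jordan[OF cwG(1) dist1] and Jord2 = outer_curve_Jordan[OF cwG(2) dist2]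
  have IJ: "inside ?J \<inter> ?J = {}" "inside ?J1 \<inter> ?J1 = {}" "inside ?J2 \<inter> ?J2 = {}"
    using inside_no_overlap by blast+
  \<comment> \<open>The ends of a chord lie in the closure of the part that contains its interior, but on the outer
     cycle, hence on the boundary of that part.\<close>
  have vertex_J: "f \<subseteq> set vs'" 
    if f: "f \<in> E" "path_image (g f) - p ` f \<subseteq> inside (outer_curve vs')" 
      and vs': "vs' = vs1 \<or> vs' = vs2" for f vs'
  proof
    fix v assume v: "v \<in> f"
    have fG: "f \<in> edges G" using f EG by auto
    have "p v \<in> path_image (g f)" using endpoints_on_edge[OF fG] v by auto
    also have "\<dots> \<subseteq> closure (inside (outer_curve vs'))"
      using edge_in_closure[OF fG] closure_mono[OF f(2)] by blast
    also have "\<dots> = inside (outer_curve vs') \<union> outer_curve vs'"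
      using vs' Jord1(10) Jord2(10) closure_Un_frontier by metis
    finally have pv: "p v \<in> inside (outer_curve vs') \<union> outer_curve vs'" .
    have "v \<in> set vs" using Evs f(1) v by auto
    then have "p v \<in> ?J" using outer_curve_vertices[OF poly] by blast
    then have "p v \<notin> inside ?J" using IJ(1) by blast
    then have "p v \<in> outer_curve vs'" using pv I vs' by blast
    then have "v \<in> \<Union>(closed_walk_edges vs')"
      using vertex_on_drawn[of v "closed_walk_edges vs'"] cwG vs' edge_pair[OF fG] v
      unfolding outer_curve_def by blast
    then show "v \<in> set vs'"
      using closed_walk_edges_subset[of _ vs1] closed_walk_edges_subset[of _ vs2] vs' dist1 dist2 by auto
  qed
  have side: "path_image (g f) - p ` f \<subseteq> inside ?J1 \<or> path_image (g f) - p ` f \<subseteq> inside ?J2"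
    if f: "f \<in> E" "f \<notin> A" "f \<notin> B" "f \<noteq> ?e" for f
  proof -
    have fG: "f \<in> edges G" using f EG by auto
    have "(path_image (g f) - p ` f) \<inter> drawn_edges g {?e} = {}"
      using open_edge_avoids[OF fG AG(3)] f by auto
    then have "path_image (g f) - p ` f \<subseteq> inside ?J1 \<union> inside ?J2"
      using chord[OF f(1)] f cw I unfolding de by blast
    then show ?thesis
      using connectedD[OF open_edge_connected(1)[OF fG] Jord1(2) Jord2(2)] I12 by blast
  qed
  show polyE: "E = E1 \<union> E2"
  proof -
    have "f \<subseteq> set vs1 \<or> f \<subseteq> set vs2" if f: "f \<in> E" for f
    proof -
      consider "f \<in> A" | "f \<in> B" | "f = ?e" | "f \<notin> A" "f \<notin> B" "f \<noteq> ?e" by blast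
      then show ?thesis
      proof cases
        case 1 then show ?thesis using UA by blast
      next
        case 2 then show ?thesis using UB by blast
      next
        case 3 then show ?thesis by (simp add: vs1_def)
      next
        case 4 then show ?thesis using side[OF f] vertex_J[OF f] by blast
      qed
    qed
    then show ?thesis unfolding E1_def E2_def by auto
  qed
  show poly1: "polygon vs1 E1" unfolding polygon_def
  proof (intro conjI ballI)
    show "closed_walk_edges vs1 \<subseteq> E1" using AE uw UA unfolding cw1 E1_def by (auto simp: vs1_def)
    fix f assume f: "f \<in> E1 - closed_walk_edges vs1"
    then have f': "f \<in> E" "f \<subseteq> set vs1" "f \<notin> A" "f \<noteq> ?e" unfolding E1_def cw1 by auto
    moreover have "f \<notin> B" using both f' UB by blast
    moreover have "\<not> f \<subseteq> set vs2" using both f' by blast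
    ultimately show "path_image (g f) - p ` f \<subseteq> inside ?J1"
      using side[of f] vertex_J[of f vs2] by blast
  qed (use dist1 EG in \<open>auto simp: E1_def\<close>)
  show poly2: "polygon vs2 E2" unfolding polygon_def
  proof (intro conjI ballI)
    show "closed_walk_edges vs2 \<subseteq> E2" using AE uw UB unfolding cw2 E2_def by (auto simp: vs2_def)
    fix f assume f: "f \<in> E2 - closed_walk_edges vs2"
    then have f': "f \<in> E" "f \<subseteq> set vs2" "f \<notin> B" "f \<noteq> ?e" unfolding E2_def cw2 by auto
    moreover have "f \<notin> A" using both f' UA by blast
    moreover have "\<not> f \<subseteq> set vs1" using both f' by blast
    ultimately show "path_image (g f) - p ` f \<subseteq> inside ?J2"
      using side[of f] vertex_J[of f vs1] by blast
  qed (use dist2 EG in \<open>auto simp: E2_def\<close>)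
  have drawn1: "drawn_edges g E1 \<subseteq> inside ?J1 \<union> ?J1"
    by (rule drawn_in_polygon[OF poly1])
  have drawn2: "drawn_edges g E2 \<subseteq> inside ?J2 \<union> ?J2"
    by (rule drawn_in_polygon[OF poly2])
  have J2I1: "?J2 \<inter> inside ?J1 = {}" "?J1 \<inter> inside ?J2 = {}"
  proof -
    have sub: "inside ?J1 \<subseteq> inside ?J" "inside ?J2 \<subseteq> inside ?J" using I by blast+
    have "?J2 \<subseteq> ?J \<union> ?J1" "?J1 \<subseteq> ?J \<union> ?J2" unfolding J by blast+
    then show "?J2 \<inter> inside ?J1 = {}" "?J1 \<inter> inside ?J2 = {}" using sub IJ by blast+
  qed
  have eE: "path_image (g ?e) \<subseteq> drawn_edges g E" using uw unfolding drawn_edges_def by auto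
  have "inside ?J - drawn_edges g E = (inside ?J1 - drawn_edges g E1) \<union> (inside ?J2 - drawn_edges g E2)"
  proof
    show "inside ?J - drawn_edges g E \<subseteq> (inside ?J1 - drawn_edges g E1) \<union> (inside ?J2 - drawn_edges g E2)"
      using I eE polyE drawn_edges_Un[of g E1 E2] by blast
    have "inside ?J1 \<inter> drawn_edges g E2 = {}" using drawn2 I12 J2I1 by blast
    moreover have "inside ?J2 \<inter> drawn_edges g E1 = {}" using drawn1 I12 J2I1 by blast
    ultimately show "(inside ?J1 - drawn_edges g E1) \<union> (inside ?J2 - drawn_edges g E2) \<subseteq> inside ?J - drawn_edges g E"
      using I polyE drawn_edges_Un[of g E1 E2] by blast
  qed
  moreover have "E1 \<subseteq> edges G" "E2 \<subseteq> edges G" using EG by (auto simp: E1_def E2_def)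
  then have "open (inside ?J1 - drawn_edges g E1)" "open (inside ?J2 - drawn_edges g E2)"
    using Jord1(2) Jord2(2) closed_drawn by (simp_all add: open_Diff)
  moreover have "(inside ?J1 - drawn_edges g E1) \<inter> (inside ?J2 - drawn_edges g E2) = {}"
    using I12 by blast
  ultimately show "inner_faces vs E = inner_faces vs1 E1 \<union> inner_faces vs2 E2"
    unfolding inner_faces_def using components_Un_disjoint_open by simp
qed

lemma polygon_verts: 
  assumes "polygon vs E"
  shows "set vs \<subseteq> verts G"
proof
  have P: "path_edges vs \<subseteq> edges G" "length vs \<ge> 3"
    using assms unfolding polygon_def closed_walk_edges_def by auto
  fix v assume "v \<in> set vs"
  then obtain e where "e \<in> path_edges vs" "v \<in> e" using Union_path_edges[of vs] P(2) by auto
  then show "v \<in> verts G" using edge_pair[of e] P(1) by auto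
qed

lemma chordless_inner_faces:
  assumes "polygon vs E" "E = closed_walk_edges vs"
  shows "inner_faces vs E = {inside (outer_curve vs)}" "frontier (inside (outer_curve vs)) = outer_curve vs"
proof -
  have P: "closed_walk_edges vs \<subseteq> edges G" "distinct vs" "length vs \<ge> 3" using assms unfolding polygon_def by auto
  have "inside (outer_curve vs) - drawn_edges g E = inside (outer_curve vs)"
    using inside_no_overlap[of "outer_curve vs"] unfolding assms(2) outer_curve_def by blast
  then show "inner_faces vs E = {inside (outer_curve vs)}"
    unfolding inner_faces_def using outer_curve_Jordan(1,3)[OF P] components_eq_sing_iff by metis
  show "frontier (inside (outer_curve vs)) = outer_curve vs" by (rule outer_curve_Jordan(10)[OF P])
qed

lemma split_list_two:
  assumes "e = {a, b}" "a \<noteq> b" "e \<subseteq> set vs"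
  shows "\<exists>as u ms w bs. e = {u, w} \<and> vs = as @ u # ms @ w # bs"
proof -
  have "a \<in> set vs" "b \<in> set vs" using assms by auto
  then obtain xs ys where vs: "vs = xs @ a # ys" by (meson split_list)
  with \<open>b \<in> set vs\<close> assms(2) consider "b \<in> set xs" | "b \<in> set ys" by auto
  then show ?thesis
  proof cases
    case 1
    then obtain us ws where "xs = us @ b # ws" by (meson split_list)
    then have "vs = us @ b # ws @ a # ys" "e = {b, a}" using vs assms(1) by auto
    then show ?thesis by blast
  next
    case 2
    then obtain us ws where "ys = us @ b # ws" by (meson split_list)
    then have "vs = xs @ a # us @ b # ws" using vs by auto
    then show ?thesis using assms(1) by blast
  qed
qed

text \<open>
  Without chords the inside is a face whose frontier contains all vertices, so there are only three
  of them.  Otherwise a chord splits the polygon, and the tree of the part beyond the chord is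
  grafted onto the tree of the other part.  The frontier hypothesis, which holds for triangular faces,
  passes to the parts because their faces are faces of the polygon.
\<close>
lemma polygon_imp_tree:
  assumes "polygon vs E"
    and "\<And>F. F \<in> inner_faces vs E \<Longrightarrow> card {v \<in> verts G. p v \<in> frontier F} \<le> 3"
  shows "\<exists>x t y. vs = outline x t y \<and> E = tree_edges x t y"
  using assms
proof (induction "length vs" arbitrary: vs E rule: less_induct)
  case less
  note poly = less.prems(1)
  have P: "closed_walk_edges vs \<subseteq> E" "E \<subseteq> edges G" "distinct vs" "length vs \<ge> 3" "\<And>e. e \<in> E \<Longrightarrow> e \<subseteq> set vs"
    using poly unfolding polygon_def by auto
  show ?case
  proof (cases "E \<subseteq> closed_walk_edges vs")
    case True
    then have E: "E = closed_walk_edges vs" using P by auto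
    note faces = chordless_inner_faces[OF poly E]
    have "finite (verts G)" using plane unfolding plane_graph_def simple_graph_def by auto
    moreover have "set vs \<subseteq> {v \<in> verts G. p v \<in> frontier (inside (outer_curve vs))}"
      using outer_curve_vertices[OF poly] polygon_verts[OF poly] unfolding faces(2) by auto
    ultimately have "card (set vs) \<le> card {v \<in> verts G. p v \<in> frontier (inside (outer_curve vs))}"
      by (intro card_mono) auto
    also have "\<dots> \<le> 3" using less.prems(2) faces(1) by auto
    finally have "length vs = 3" using P distinct_card[of vs] by simp
    then obtain a b c where vs: "vs = [a, b, c]"
      by (auto simp: numeral_3_eq_3 length_Suc_conv)
    have "E = tree_edges a (Node Leaf b Leaf) c"
      unfolding E vs by (auto simp: closed_walk_edges_def)
    moreover have "vs = outline a (Node Leaf b Leaf) c" unfolding vs by simp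
    ultimately show ?thesis by blast
  next
    case False
    then obtain e where e: "e \<in> E" "e \<notin> closed_walk_edges vs" by auto
    then obtain a b where "e = {a, b}" "a \<noteq> b" using edge_pair P(2) by (metis card_2_iff subsetD)
    then obtain as u ms w bs where uw: "e = {u, w}" and vs: "vs = as @ u # ms @ w # bs"
      using split_list_two[of e a b vs] P(5)[OF e(1)] by blast
    have ms: "ms \<noteq> []"
    proof
      assume "ms = []"
      then have "e \<in> path_edges vs" using uw vs path_edges_append[of as u "w # bs"] by simp
      then show False using e by (simp add: closed_walk_edges_def)
    qed
    have asbs: "as @ bs \<noteq> []"
    proof
      assume "as @ bs = []"
      then have "e = {hd vs, last vs}" using uw vs by simp
      then show False using e by (simp add: closed_walk_edges_def)
    qed
    define vs1 where "vs1 = u # ms @ [w]"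
    define vs2 where "vs2 = as @ u # w # bs"
    define E1 where "E1 = {f \<in> E. f \<subseteq> set vs1}"
    define E2 where "E2 = {f \<in> E. f \<subseteq> set vs2}"
    note split = polygon_split[OF poly vs ms asbs, folded uw, OF e(1), folded vs1_def vs2_def, folded E1_def E2_def]
    have "length vs1 < length vs" using asbs vs by (auto simp: vs1_def)
    then obtain x1 t1 y1 where t1: "vs1 = outline x1 t1 y1" "E1 = tree_edges x1 t1 y1"
      using less.hyps[OF _ split(1)] less.prems(2) split(4) by blast
    have "length vs2 < length vs" using ms vs by (auto simp: vs2_def)
    then obtain x t2 y where t2: "vs2 = outline x t2 y" "E2 = tree_edges x t2 y"
      using less.hyps[OF _ split(2)] less.prems(2) split(4) by blast
    have "x1 = u" "inorder t1 = ms" "y1 = w" using t1(1) by (auto simp: vs1_def)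
    then obtain t where "outline x t y = as @ u # ms @ w # bs" "tree_edges x t y = E2 \<union> E1"
      using graft_tree[of x t2 y as u w bs t1] t1 t2 by (auto simp: vs2_def)
    then show ?thesis using vs split(3) by (intro exI[of _ x] exI[of _ t] exI[of _ y]) auto
  qed
qed

text \<open>
  As long as the root triangle has a side that is not an outer edge, this side is a chord that
  splits the polygon into two polygons with smaller trees.
\<close>
lemma tree_imp_triangular_faces:
  assumes "polygon (outline x t y) (tree_edges x t y)" "F \<in> inner_faces (outline x t y) (tree_edges x t y)"
  shows "\<exists>vs. length vs = 3 \<and> bounded_by_cycle G g F vs"
  using assms
proof (induction "size t" arbitrary: x t y rule: less_induct)
  case less
  note poly = less.prems(1)
  have P: "tree_edges x t y \<subseteq> edges G" "distinct (outline x t y)" "length (outline x t y) \<ge> 3"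
    using poly unfolding polygon_def by auto
  then obtain l z r where t: "t = Node l z r" by (cases t) auto
  consider "l = Leaf" "r = Leaf" | "l \<noteq> Leaf" | "r \<noteq> Leaf" by blast
  then show ?case
  proof cases
    case 1
    have vs: "outline x t y = [x, z, y]" using 1 t by simp
    have cyc: "tree_edges x t y = closed_walk_edges (outline x t y)"
      using 1 t by (auto simp: closed_walk_edges_def)
    note faces = chordless_inner_faces[OF poly cyc]
    have "F = inside (outer_curve (outline x t y))" using less.prems(2) faces(1) by auto
    then have "frontier F = drawn_edges g (cycle_edges (outline x t y))"
      using faces(2) cycle_edges_closed_walk[of "outline x t y"] by (simp add: outer_curve_def)
    moreover have "is_cycle G (outline x t y)"
      using P polygon_verts[OF poly] cycle_edges_closed_walk[of "outline x t y"] cyc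
      unfolding is_cycle_def by auto
    ultimately show ?thesis unfolding bounded_by_cycle_def using vs by (intro exI[of _ "outline x t y"]) auto
  next
    case 2
    have edge: "{x, z} \<in> tree_edges x t y" using root_edge[of x z l] t by simp
    have ne: "inorder l \<noteq> []" using 2 by (cases l) auto
    have vs: "outline x t y = [] @ x # inorder l @ z # inorder r @ [y]" by (simp add: t)
    have ne': "[] @ inorder r @ [y] \<noteq> []" by simp
    note split = polygon_split[OF poly vs ne ne' edge]
    note within = tree_edges_within[OF P(2)[unfolded t], folded t]
    have "polygon (outline x l z) (tree_edges x l z)"
      using split(1) unfolding within(1) .
    moreover have "polygon (outline x (Node Leaf z r) y) (tree_edges x (Node Leaf z r) y)"
      using split(2) unfolding append_Nil within(2) by simp
    moreover have "F \<in> inner_faces (outline x l z) (tree_edges x l z) \<union>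
            inner_faces (outline x (Node Leaf z r) y) (tree_edges x (Node Leaf z r) y)"
      using less.prems(2) unfolding split(4) append_Nil within(1,2) by simp
    moreover have "size l < size t" "size (Node Leaf z r) < size t" using t 2 by (auto simp: neq_Leaf_iff)
    ultimately show ?thesis using less.hyps[of l x z] less.hyps[of "Node Leaf z r" x y] by blast
  next
    case 3
    have edge: "{z, y} \<in> tree_edges x t y" using root_edge[of z y r] t by simp
    have ne: "inorder r \<noteq> []" using 3 by (cases r) auto
    have vs: "outline x t y = (x # inorder l) @ z # inorder r @ y # []" by (simp add: t)
    have ne': "(x # inorder l) @ [] \<noteq> []" by simp
    note split = polygon_split[OF poly vs ne ne' edge]
    note within = tree_edges_within[OF P(2)[unfolded t], folded t]
    have "polygon (outline z r y) (tree_edges z r y)"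
      using split(1) unfolding within(3) .
    moreover have "polygon (outline x (Node l z Leaf) y) (tree_edges x (Node l z Leaf) y)"
      using split(2) unfolding within(4) by simp
    moreover have "F \<in> inner_faces (outline z r y) (tree_edges z r y) \<union>
            inner_faces (outline x (Node l z Leaf) y) (tree_edges x (Node l z Leaf) y)"
      using less.prems(2) unfolding split(4) within(3,4) by simp
    moreover have "size r < size t" "size (Node l z Leaf) < size t" using t 3 by (auto simp: neq_Leaf_iff)
    ultimately show ?thesis using less.hyps[of r z y] less.hyps[of "Node l z Leaf" x y] by blast
  qed
qed

end

section \<open>Mops and triangulated polygons\<close>

lemma faces_polygon:
  assumes plane: "plane_graph G p g" and poly: "polygon G p g vs (edges G)" and vs: "set vs = verts G"
  shows "faces G p g = insert (outside (outer_curve g vs)) (inner_faces g vs (edges G))"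
proof -
  let ?J = "outer_curve g vs" and ?D = "drawn_edges g (edges G)"
  have P: "closed_walk_edges vs \<subseteq> edges G" "distinct vs" "length vs \<ge> 3"
    using poly unfolding polygon_def[OF plane] by auto
  note Jord = outer_curve_Jordan[OF plane P]
  have JD: "?J \<subseteq> ?D" unfolding outer_curve_def[OF plane] by (rule drawn_edges_mono[OF P(1)])
  have DJ: "?D \<subseteq> inside ?J \<union> ?J" by (rule drawn_in_polygon[OF plane poly])
  have "p ` verts G \<subseteq> ?D" using outer_curve_vertices[OF plane poly] vs JD by auto
  then have "- (p ` verts G \<union> ?D) = - ?D" by auto
  also have "\<dots> = outside ?J \<union> (inside ?J - ?D)"
    using JD DJ Jord(8,9) by blast
  finally have "- (p ` verts G \<union> ?D) = outside ?J \<union> (inside ?J - ?D)" .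
  moreover have "open (inside ?J - ?D)"
    using Jord(2) closed_drawn[OF plane order_refl] by (rule open_Diff)
  moreover have "outside ?J \<inter> (inside ?J - ?D) = {}" using Jord(8) by blast
  ultimately have "faces G p g = components (outside ?J) \<union> inner_faces g vs (edges G)"
    unfolding faces_def inner_faces_def[OF plane] using components_Un_disjoint_open[OF Jord(4)] by simp
  moreover have "outside ?J \<noteq> {}" using Jord(7) by auto
  then have "components (outside ?J) = {outside ?J}" using Jord(5) components_eq_sing_iff by blast
  ultimately show ?thesis by simp
qed

lemma polygon_tree_mop:
  assumes plane: "plane_graph G p g" and poly: "polygon G p g (outline x t y) (edges G)"
    and verts: "verts G = set (outline x t y)" and edges: "edges G = tree_edges x t y"
  shows "mop G"
proof -
  let ?vs = "outline x t y"
  have P: "closed_walk_edges ?vs \<subseteq> edges G" "distinct ?vs" "length ?vs \<ge> 3"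
    using poly unfolding polygon_def[OF plane] by auto
  note Jord = outer_curve_Jordan[OF plane P]
  have cyc: "cycle_edges ?vs = closed_walk_edges ?vs" by (rule cycle_edges_closed_walk) simp
  note faces = faces_polygon[OF plane poly verts[symmetric]]
  have inner: "\<exists>us. length us = 3 \<and> bounded_by_cycle G g F us" if "F \<in> inner_faces g ?vs (edges G)" for F
    using tree_imp_triangular_faces[OF plane] poly that edges by simp
  have inner_bounded: "bounded F" if "F \<in> inner_faces g ?vs (edges G)" for F
    using that in_components_subset[of F] bounded_subset[OF Jord(6)]
    unfolding inner_faces_def[OF plane] by blast
  have "is_cycle G ?vs" unfolding is_cycle_def cyc using P verts by auto
  then have outer: "bounded_by_cycle G g (outside (outer_curve g ?vs)) ?vs"
    unfolding bounded_by_cycle_def cyc using Jord(11) by (simp add: outer_curve_def[OF plane])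
  have "triangulated_disc G p g"
    unfolding triangulated_disc_def faces using plane inner inner_bounded outer Jord(7) by blast
  moreover have "p ` verts G \<subseteq> frontier F" if "F \<in> faces G p g" "\<not> bounded F" for F
    using that inner_bounded outer_curve_vertices[OF plane poly] Jord(11) unfolding faces verts by auto
  ultimately show ?thesis unfolding mop_def by blast
qed

text \<open>
  The unbounded face is the whole outside of the outer cycle: it is contained in the outside, and its
  frontier is the cycle itself, which the connected outside does not meet.  Consequently every edge
  off the cycle is a chord in the inside, and \<open>polygon_imp_tree\<close> applies.
\<close>
lemma mop_imp_tree:
  assumes "mop G"
  shows "\<exists>x t y. distinct (outline x t y) \<and> verts G = set (outline x t y) \<and> edges G = tree_edges x t y"
proof -
  obtain p g where td: "triangulated_disc G p g"
    and outer: "\<And>F. F \<in> faces G p g \<Longrightarrow> \<not> bounded F \<Longrightarrow> p ` verts G \<subseteq> frontier F"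
    using assms unfolding mop_def by blast
  then have plane: "plane_graph G p g"
    and tri: "\<And>F. F \<in> faces G p g \<Longrightarrow> bounded F \<Longrightarrow> \<exists>vs. length vs = 3 \<and> bounded_by_cycle G g F vs"
    and disc: "\<And>F. F \<in> faces G p g \<Longrightarrow> \<not> bounded F \<Longrightarrow> \<exists>vs. bounded_by_cycle G g F vs"
    unfolding triangulated_disc_def by blast+
  have finV: "finite (verts G)" using plane unfolding plane_graph_def simple_graph_def by auto
  let ?D = "drawn_edges g (edges G)"
  have "bounded ?D" unfolding drawn_edges_def
    using finite_edges[OF plane] edge_arc(1)[OF plane] bounded_arc_image by (intro bounded_UN) auto
  then have "bounded (p ` verts G \<union> ?D)" using finV by (simp add: finite_imp_bounded)
  then obtain F where F: "F \<in> faces G p g" "\<not> bounded F"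
    unfolding faces_def using cobounded_unbounded_components[of "- (p ` verts G \<union> ?D)"] by auto
  then obtain vs where vs: "is_cycle G vs" "frontier F = drawn_edges g (cycle_edges vs)"
    using disc unfolding bounded_by_cycle_def by blast
  then have vs_dist: "distinct vs" "length vs \<ge> 3" and vsG: "set vs \<subseteq> verts G"
    unfolding is_cycle_def by auto
  have cyc: "cycle_edges vs = closed_walk_edges vs" using vs_dist by (intro cycle_edges_closed_walk) auto
  have cwG: "closed_walk_edges vs \<subseteq> edges G" using vs(1) unfolding is_cycle_def cyc by auto
  let ?J = "outer_curve g vs"
  note Jord = outer_curve_Jordan[OF plane cwG vs_dist]
  have FJ: "frontier F = ?J" using vs(2) unfolding cyc outer_curve_def[OF plane] .
  have verts: "set vs = verts G"
  proof
    show "verts G \<subseteq> set vs"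
    proof
      fix v assume v: "v \<in> verts G"
      then have "p v \<in> drawn_edges g (closed_walk_edges vs)" using outer[OF F] FJ unfolding outer_curve_def[OF plane] by auto
      then have "v \<in> \<Union>(closed_walk_edges vs)" by (rule vertex_on_drawn[OF plane v cwG])
      then show "v \<in> set vs" using closed_walk_edges_subset[OF _ vs_dist(2)] by blast
    qed
  qed (fact vsG)
  have "connected F" and F_sub: "F \<subseteq> - ?D"
    using F(1) in_components_connected in_components_subset unfolding faces_def by blast+
  have JD: "?J \<subseteq> ?D" unfolding outer_curve_def[OF plane] by (rule drawn_edges_mono[OF cwG])
  \<comment> \<open>The face \<open>F\<close> avoids the outer cycle and is not bounded, whereas the inside is.\<close>
  have "F \<subseteq> outside ?J"
  proof -
    have "F \<subseteq> inside ?J \<union> outside ?J" using F_sub JD Jord(9) by blast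
    then have "F \<subseteq> inside ?J \<or> F \<subseteq> outside ?J"
      using connectedD[OF \<open>connected F\<close> Jord(2) Jord(4)] Jord(8) by blast
    then show ?thesis using F(2) bounded_subset[OF Jord(6)] by blast
  qed
  moreover have "F \<noteq> {}" using F(2) by auto
  moreover have "outside ?J \<inter> ?J = {}" using outside_no_overlap by blast
  ultimately have "outside ?J \<subseteq> F"
    using connected_Int_frontier[OF Jord(5), of F] FJ by blast
  then have outD: "outside ?J \<inter> ?D = {}" using F_sub by blast
  have poly: "polygon G p g vs (edges G)"
    unfolding polygon_def[OF plane]
  proof (intro conjI ballI)
    fix e assume e: "e \<in> edges G - closed_walk_edges vs"
    have "(path_image (g e) - p ` e) \<inter> ?J = {}"
      unfolding outer_curve_def[OF plane] using e open_edge_avoids[OF plane _ cwG] by blast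
    moreover have "path_image (g e) \<subseteq> ?D" using e unfolding drawn_edges_def by auto
    ultimately show "path_image (g e) - p ` e \<subseteq> inside ?J" using outD Jord(9) by blast
  qed (use vs_dist cwG edge_pair[OF plane] verts in auto)
  have "card {v \<in> verts G. p v \<in> frontier F'} \<le> 3" if "F' \<in> inner_faces g vs (edges G)" for F'
  proof -
    have "F' \<in> faces G p g" using that faces_polygon[OF plane poly verts] by auto
    moreover have "bounded F'"
      using that in_components_subset[of F'] bounded_subset[OF Jord(6)]
      unfolding inner_faces_def[OF plane] by blast
    ultimately obtain us where us: "length us = 3" "is_cycle G us" "frontier F' = drawn_edges g (cycle_edges us)"
      using tri unfolding bounded_by_cycle_def by blast
    have cyc': "cycle_edges us = closed_walk_edges us" using us(1) by (intro cycle_edges_closed_walk) auto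
    have "closed_walk_edges us \<subseteq> edges G" using us(2) unfolding is_cycle_def cyc' by auto
    note cwG' = this
    have "{v \<in> verts G. p v \<in> frontier F'} \<subseteq> set us"
    proof
      fix v assume "v \<in> {v \<in> verts G. p v \<in> frontier F'}"
      then have "v \<in> \<Union>(closed_walk_edges us)"
        using vertex_on_drawn[OF plane _ cwG'] unfolding us(3) cyc' by blast
      then obtain e where "e \<in> closed_walk_edges us" "v \<in> e" by auto
      then show "v \<in> set us" using closed_walk_edges_subset[of e us] us(1) by auto
    qed
    then have "card {v \<in> verts G. p v \<in> frontier F'} \<le> card (set us)" by (intro card_mono) auto
    then show ?thesis using card_length[of us] us(1) by linarith
  qed
  from polygon_imp_tree[OF plane poly this] obtain x t y where
    "vs = outline x t y" "edges G = tree_edges x t y" by blast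
  then show ?thesis using vs_dist(1) verts by (intro exI[of _ x] exI[of _ t] exI[of _ y]) auto
qed

section \<open>The upper bound\<close>

lemma neighbours_simple:
  assumes "simple_graph G"
  shows "neighbours G v = {w. {v, w} \<in> edges G}"
proof -
  have "w \<in> verts G" if "{v, w} \<in> edges G" for w using assms that unfolding simple_graph_def by auto
  then show ?thesis unfolding neighbours_def by (auto simp: insert_commute)
qed

lemma closed_nbhd_dominated:
  assumes "simple_graph G"
  shows "closed_nbhd G S = dominated (edges G) S"
  unfolding closed_nbhd_def neighbours_simple[OF assms] dominated_def by auto

lemma finite_isolating_cards:
  assumes "finite (verts G)"
  shows "finite {card S | S. star_isolating k G S}"
proof (rule finite_subset)
  show "{card S | S. star_isolating k G S} \<subseteq> card ` Pow (verts G)" unfolding star_isolating_def by auto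
qed (use assms in simp)

text \<open>
  The centre of a copy of the star would have \<open>k + 1\<close> neighbours that are not dominated.
\<close>
lemma star_isolating_low_degree:
  assumes G: "simple_graph G" and S: "S \<subseteq> verts G"
    and low: "\<And>v. v \<in> verts G - dominated (edges G) S \<Longrightarrow>
               card ({w. {v, w} \<in> edges G} - dominated (edges G) S) \<le> k"
  shows "star_isolating k G S"
  unfolding star_isolating_def closed_nbhd_dominated[OF G]
proof (intro conjI S notI)
  let ?D = "dominated (edges G) S"
  assume "contains_copy (delete_verts G ?D) (star (k + 1))"
  then obtain f where f: "inj_on f (verts (star (k + 1)))" "f ` verts (star (k + 1)) \<subseteq> verts (delete_verts G ?D)"
     "\<forall>e\<in>edges (star (k + 1)). f ` e \<in> edges (delete_verts G ?D)"
    unfolding contains_copy_def by blast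
  have verts_star: "verts (star (k + 1)) = {0..k + 1}" by (simp add: star_def)
  have leaf: "{f 0, f i} \<in> edges G \<and> f i \<notin> ?D" if "i \<in> {1..k + 1}" for i
  proof -
    have "{0, i} \<in> edges (star (k + 1))" using that by (auto simp: star_def)
    then have "f ` {0, i} \<in> edges (delete_verts G ?D)" using f(3) by blast
    then show ?thesis by (simp add: delete_verts_def)
  qed
  then have "f ` {1..k+1} \<subseteq> {w. {f 0, w} \<in> edges G} - ?D" by blast
  moreover have "finite ({w. {f 0, w} \<in> edges G} - ?D)"
  proof -
    have "{w. {f 0, w} \<in> edges G} \<subseteq> verts G" using neighbours_simple[OF G, of "f 0"]
      unfolding neighbours_def by blast
    moreover have "finite (verts G)" using G unfolding simple_graph_def by simp
    ultimately show ?thesis using finite_subset by blast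
  qed
  ultimately have "card (f ` {1..k+1}) \<le> card ({w. {f 0, w} \<in> edges G} - ?D)" by (rule card_mono[rotated])
  moreover have "card (f ` {1..k+1}) = k + 1"
    using inj_on_subset[OF f(1), of "{1..k+1}"] verts_star by (subst card_image) auto
  moreover have "f 0 \<in> f ` verts (star (k + 1))" unfolding verts_star by simp
  then have "f 0 \<in> verts G - ?D" using f(2) by (auto simp: delete_verts_def)
  ultimately show False using low[of "f 0"] by simp
qed

lemma mop_simple: "mop G \<Longrightarrow> simple_graph G"
  unfolding mop_def triangulated_disc_def plane_graph_def by blast

text \<open>
  A set for the core with \<open>d = k + 2\<close> is isolating in the whole graph, because each vertex has at
  most two neighbours of degree two.
\<close>
lemma iota_upper_bound:
  assumes "mop G" and n: "graph_order G \<ge> 2 * k + 3" and k: "k \<ge> 1"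
  shows "(k + 2) * iota k G \<le> graph_order G - num_deg2 G" "num_deg2 G \<le> graph_order G"
proof -
  obtain x t y where dist: "distinct (outline x t y)" and V: "verts G = set (outline x t y)"
    and E: "edges G = tree_edges x t y" using mop_imp_tree[OF assms(1)] by blast
  have G: "simple_graph G" by (rule mop_simple[OF assms(1)])
  then have finV: "finite (verts G)" unfolding simple_graph_def by simp
  have order: "graph_order G = size t + 2" using distinct_card[OF dist] by (simp add: graph_order_def V)
  define Z where "Z = {v \<in> verts G. card {w. {v, w} \<in> edges G} = 2}"
  have Z2: "num_deg2 G = card Z" unfolding num_deg2_def Z_def degree_def neighbours_simple[OF G] ..
  have "has_core (verts G) (edges G) Z"
    using degree_two_core[OF dist] order n k unfolding Z_def V E by simp
  then obtain x' h y' where h: "distinct (outline x' h y')" "set (outline x' h y') = verts G - Z"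
      "tree_edges x' h y' = {e \<in> edges G. e \<inter> Z = {}}"
    and indep: "\<And>e v w. e \<in> edges G \<Longrightarrow> v \<in> e \<inter> Z \<Longrightarrow> w \<in> e \<inter> Z \<Longrightarrow> v = w"
    and two: "\<And>v. \<exists>a b. {w \<in> Z. {v, w} \<in> edges G} \<subseteq> {a, b}" and half: "2 * card Z \<le> card (verts G)"
    unfolding has_core_def by (elim conjE exE) (rule that; blast)
  have ZV: "Z \<subseteq> verts G" unfolding Z_def by auto
  have finZ: "finite Z" using ZV finV finite_subset by blast
  show "num_deg2 G \<le> graph_order G" unfolding Z2 graph_order_def using card_mono[OF finV ZV] .
  have size_h: "size h + 2 = graph_order G - num_deg2 G"
    using distinct_card[OF h(1)] card_Diff_subset[OF finZ ZV] h(2) unfolding Z2 graph_order_def by simp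
  have "k + 2 \<le> size h + 2" using size_h half n unfolding Z2 graph_order_def by linarith
  then obtain S where S: "leaves_low_degree (k + 2) (verts G - Z) {e \<in> edges G. e \<inter> Z = {}} S"
    and card_S: "(k + 2) * card S \<le> size h + 2"
    using mop_low_degree_set[OF h(1), of "k + 2"] k unfolding h(2,3) by auto
  let ?E = "{e \<in> edges G. e \<inter> Z = {}}" and ?D = "dominated (edges G) S"
  have S_sub: "S \<subseteq> verts G - Z" and low: "\<And>v. v \<in> verts G - Z \<Longrightarrow> v \<notin> dominated ?E S \<Longrightarrow>
      card ({w. {v, w} \<in> ?E} - dominated ?E S) + 4 \<le> k + 2"
    using S unfolding leaves_low_degree_def by blast+
  have sub: "dominated ?E S \<subseteq> ?D" unfolding dominated_def by auto
  have nbV: "{w. {v, w} \<in> edges G} \<subseteq> verts G" for v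
    using G unfolding simple_graph_def by auto
  have "star_isolating k G S"
  proof (rule star_isolating_low_degree[OF G])
    show "S \<subseteq> verts G" using S_sub by auto
    fix v assume v: "v \<in> verts G - ?D"
    show "card ({w. {v, w} \<in> edges G} - ?D) \<le> k"
    proof (cases "v \<in> Z")
      case False
      obtain a b where ab: "{w \<in> Z. {v, w} \<in> edges G} \<subseteq> {a, b}" using two[of v] by meson
      let ?A = "{w. {v, w} \<in> ?E} - dominated ?E S"
      have "?A \<subseteq> verts G" using nbV[of v] by auto
      then have finA: "finite ?A" using finV finite_subset by blast
      have "{w. {v, w} \<in> edges G} - ?D \<subseteq> ?A \<union> {a, b}" using ab sub False by blast
      then have "card ({w. {v, w} \<in> edges G} - ?D) \<le> card (?A \<union> {a, b})"
        using finA by (intro card_mono) auto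
      also have "\<dots> \<le> card ?A + card {a, b}" by (rule card_Un_le)
      also have "card {a, b} \<le> 2" by (simp add: card_insert_if)
      finally have "card ({w. {v, w} \<in> edges G} - ?D) \<le> card ?A + 2" by simp
      moreover have "card ?A + 4 \<le> k + 2" using low[of v] v False sub by blast
      ultimately show ?thesis by linarith
    next
      case True
      have fin: "finite {w. {v, w} \<in> edges G}" using nbV[of v] finV finite_subset by blast
      show ?thesis
      proof (cases "k = 1")
        case k1: True
        have "w \<in> ?D" if w: "{v, w} \<in> edges G" for w
        proof -
          have "card {v, w} = 2" using G w unfolding simple_graph_def by blast
          then have "v \<noteq> w" by auto
          then have "w \<in> verts G - Z" using indep[OF w, of v w] True nbV[of v] w by auto
          then have "w \<in> dominated ?E S" using low[of w] k1 by fastforce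
          then show ?thesis using sub by auto
        qed
        then have "{w. {v, w} \<in> edges G} - ?D = {}" by auto
        then show ?thesis by (simp only: card.empty)
      next
        case False
        have "card ({w. {v, w} \<in> edges G} - ?D) \<le> card {w. {v, w} \<in> edges G}"
          using fin by (intro card_mono) auto
        also have "\<dots> = 2" using True unfolding Z_def by auto
        finally show ?thesis using False k by linarith
      qed
    qed
  qed
  then have "iota k G \<le> card S" unfolding iota_def
    using finite_isolating_cards[OF finV] by (intro Min_le) auto
  then have "(k + 2) * iota k G \<le> (k + 2) * card S" by (rule mult_le_mono2)
  then show "(k + 2) * iota k G \<le> graph_order G - num_deg2 G" using card_S size_h by linarith
qed

section \<open>Drawing a triangulated polygon on a circle\<close>

text \<open>
  The unit circle is parametrized so that the integers \<open>0, \<dots>, n - 1\<close> are the vertices of a regular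
  \<open>n\<close>-gon.
\<close>
definition on_circle :: "nat \<Rightarrow> real \<Rightarrow> complex" where
  "on_circle n u = cis (2 * pi * u / n)"

lemma norm_on_circle [simp]: "norm (on_circle n u) = 1"
  by (simp add: on_circle_def)

lemma on_circle_n: "n > 0 \<Longrightarrow> on_circle n (real n) = on_circle n 0"
  by (simp add: on_circle_def)

text \<open>
  An affine function that vanishes on the line through the points with parameters \<open>i\<close> and \<open>j\<close>.  On
  the circle it factors into a product of two sines, which reveals its sign.
\<close>
definition chord_side :: "nat \<Rightarrow> real \<Rightarrow> real \<Rightarrow> complex \<Rightarrow> real" where
  "chord_side n i j z = Re (z * cis (- (pi * (i + j) / n))) - cos (pi * (j - i) / n)"

lemma chord_side_on_circle:
  assumes "n > 0"
  shows "chord_side n i j (on_circle n u) = - (2 * sin (pi * (u - i) / n) * sin (pi * (u - j) / n))"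
proof -
  have "chord_side n i j (on_circle n u) = cos (2 * pi * u / n - pi * (i + j) / n) - cos (pi * (j - i) / n)"
    by (simp add: chord_side_def on_circle_def cis_mult)
  also have "\<dots> = 2 * sin ((2 * pi * u / n - pi * (i + j) / n + pi * (j - i) / n) / 2) *
      sin ((pi * (j - i) / n - (2 * pi * u / n - pi * (i + j) / n)) / 2)"
    by (rule cos_diff_cos)
  also have "(2 * pi * u / n - pi * (i + j) / n + pi * (j - i) / n) / 2 = pi * (u - i) / n"
    using assms by (simp add: field_simps)
  also have "(pi * (j - i) / n - (2 * pi * u / n - pi * (i + j) / n)) / 2 = - (pi * (u - j) / n)"
    using assms by (simp add: field_simps)
  finally show ?thesis by simp
qed

lemma sin_chord_pos: "n > 0 \<Longrightarrow> 0 < a \<Longrightarrow> a < real n \<Longrightarrow> sin (pi * a / n) > 0"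
  by (intro sin_gt_zero) (simp_all add: field_simps)

lemma sin_chord_neg: "n > 0 \<Longrightarrow> a < 0 \<Longrightarrow> - a < real n \<Longrightarrow> sin (pi * a / n) < 0"
  using sin_chord_pos[of n "- a"] by simp

lemma chord_side_endpoints:
  assumes "n > 0"
  shows "chord_side n i j (on_circle n i) = 0" "chord_side n i j (on_circle n j) = 0"
  by (simp_all add: chord_side_on_circle[OF assms])

lemma chord_side_between:
  assumes "0 \<le> i" "i < u" "u < j" "j < real n"
  shows "chord_side n i j (on_circle n u) > 0"
proof -
  have n: "n > 0" using assms by auto
  have "sin (pi * (u - i) / n) > 0" using assms n by (intro sin_chord_pos) auto
  moreover have "sin (pi * (u - j) / n) < 0" using assms n by (intro sin_chord_neg) auto
  ultimately show ?thesis unfolding chord_side_on_circle[OF n] by (simp add: mult_pos_neg)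
qed

lemma chord_side_beyond:
  assumes "0 \<le> i" "i \<le> j" "j < real n" "0 \<le> u" "u < real n" "u < i \<or> j < u"
  shows "chord_side n i j (on_circle n u) < 0"
proof -
  have n: "n > 0" using assms by auto
  from assms(6) show ?thesis
  proof
    assume "u < i"
    then have "sin (pi * (u - i) / n) < 0" "sin (pi * (u - j) / n) < 0"
      using assms n by (auto intro!: sin_chord_neg)
    then show ?thesis unfolding chord_side_on_circle[OF n] by (simp add: mult_neg_neg)
  next
    assume "j < u"
    then have "sin (pi * (u - i) / n) > 0" "sin (pi * (u - j) / n) > 0"
      using assms n by (auto intro!: sin_chord_pos)
    then show ?thesis unfolding chord_side_on_circle[OF n] by simp
  qed
qed

lemma on_circle_inj:
  assumes "0 \<le> u" "u < real n" "0 \<le> v" "v < real n" "on_circle n u = on_circle n v"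
  shows "u = v"
proof (rule ccontr)
  assume "u \<noteq> v"
  then have "chord_side n v v (on_circle n u) < 0" using assms by (intro chord_side_beyond) auto
  moreover have "chord_side n v v (on_circle n u) = 0" unfolding assms(5) using assms by (intro chord_side_endpoints) auto
  ultimately show False by simp
qed

lemma chord_side_affine: "chord_side n i j ((1 - s) *\<^sub>R a + s *\<^sub>R b) = (1 - s) * chord_side n i j a + s * chord_side n i j b"
  by (simp add: chord_side_def algebra_simps scaleR_conv_of_real)

lemma chord_inside:
  fixes a b z :: complex
  assumes "norm a = 1" "norm b = 1" "z \<in> closed_segment a b" "z \<noteq> a" "z \<noteq> b"
  shows "norm z < 1"
proof -
  have "z \<in> open_segment a b" using assms by (simp add: open_segment_def)
  then show ?thesis using dist_decreases_open_segment[of z a b 0] assms by simp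
qed

lemma convex_combination_pos:
  fixes a b r :: real
  assumes "0 < r" "r < 1" "a \<ge> 0" "b \<ge> 0" "a > 0 \<or> b > 0"
  shows "(1 - r) * a + r * b > 0"
  using assms(5)
proof
  assume "a > 0"
  then have "(1 - r) * a > 0" "r * b \<ge> 0" using assms by simp_all
  then show ?thesis by linarith
next
  assume "b > 0"
  then have "(1 - r) * a \<ge> 0" "r * b > 0" using assms by simp_all
  then show ?thesis by linarith
qed

text \<open>
  If two chords do not cross combinatorially, then the ends of the second lie weakly on one side of
  the first, and not both on its line.  Hence they meet at most in an end of the second, which is a
  point of the circle.
\<close>
lemma noncrossing_chords_disjoint:
  fixes i j k l :: nat
  assumes "i < j" "j < n" "k < l" "l < n" "{i, j} \<noteq> {k, l}"
    and nc: "\<not> (i < k \<and> k < j \<and> j < l)" "\<not> (k < i \<and> i < l \<and> l < j)"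
    and z: "z \<in> closed_segment (on_circle n i) (on_circle n j)" "z \<in> closed_segment (on_circle n k) (on_circle n l)"
  shows "norm z = 1"
proof (rule ccontr)
  assume "norm z \<noteq> 1"
  have n: "n > 0" using assms by auto
  let ?s = "chord_side n i j"
  obtain q where q: "z = (1 - q) *\<^sub>R on_circle n i + q *\<^sub>R on_circle n j"
    using z(1) by (auto simp: closed_segment_def)
  have z0: "?s z = 0" unfolding q chord_side_affine by (simp add: chord_side_endpoints[OF n])
  obtain r where r: "0 \<le> r" "r \<le> 1" "z = (1 - r) *\<^sub>R on_circle n k + r *\<^sub>R on_circle n l"
    using z(2) by (auto simp: closed_segment_def)
  have "r \<noteq> 0" "r \<noteq> 1" using r(3) \<open>norm z \<noteq> 1\<close> by auto
  then have r': "0 < r" "r < 1" using r by auto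
  have eq: "(1 - r) * ?s (on_circle n k) + r * ?s (on_circle n l) = 0"
    using z0 unfolding r(3) chord_side_affine .
  have pos: "?s (on_circle n m) > 0" if "i < m" "m < j" for m :: nat
    using that assms by (intro chord_side_between) auto
  have neg: "?s (on_circle n m) < 0" if "m < i \<or> j < m" "m < n" for m :: nat
    using that assms by (intro chord_side_beyond) auto
  have zero: "?s (on_circle n m) = 0" if "m = i \<or> m = j" for m :: nat
    using that chord_side_endpoints[OF n] by auto
  have nonneg: "?s (on_circle n m) \<ge> 0" if "i \<le> m" "m \<le> j" for m :: nat
  proof (cases "m = i \<or> m = j")
    case False
    then show ?thesis using pos[of m] that by simp
  qed (use zero in simp)
  have nonpos: "?s (on_circle n m) \<le> 0" if "\<not> (i < m \<and> m < j)" "m < n" for m :: nat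
  proof (cases "m = i \<or> m = j")
    case False
    then have "m < i \<or> j < m" using that by linarith
    then show ?thesis using neg[of m] that by simp
  qed (use zero in simp)
  consider "(i < k \<and> k < j) \<or> (i < l \<and> l < j)" | "\<not> (i < k \<and> k < j)" "\<not> (i < l \<and> l < j)" by blast
  then show False
  proof cases
    case 1
    then have "i \<le> k" "k \<le> j" "i \<le> l" "l \<le> j" using nc assms by linarith+
    then have "?s (on_circle n k) \<ge> 0" "?s (on_circle n l) \<ge> 0" using nonneg by blast+
    moreover have "?s (on_circle n k) > 0 \<or> ?s (on_circle n l) > 0" using 1 pos by blast
    ultimately show False using convex_combination_pos[OF r'] eq by fastforce
  next
    case 2
    have "?s (on_circle n k) \<le> 0" "?s (on_circle n l) \<le> 0" using nonpos 2 assms(3,4) by simp_all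
    moreover have "?s (on_circle n k) < 0 \<or> ?s (on_circle n l) < 0"
    proof -
      have "\<not> (k = i \<and> l = j)" using assms(5) by auto
      then have "k < i \<or> j < k \<or> l < i \<or> j < l" using 2 assms(1,3) by linarith
      then show ?thesis using neg[of k] neg[of l] assms(3,4) by auto
    qed
    ultimately have "(1 - r) * (- ?s (on_circle n k)) + r * (- ?s (on_circle n l)) > 0"
      using convex_combination_pos[OF r', of "- ?s (on_circle n k)" "- ?s (on_circle n l)"] by simp
    then show False using eq by simp
  qed
qed

lemma tree_edges_noncrossing:
  fixes x y :: nat
  assumes "sorted_wrt (<) (outline x t y)" "{i, j} \<in> tree_edges x t y" "{k, l} \<in> tree_edges x t y"
  shows "\<not> (i < k \<and> k < j \<and> j < l)"
  using assms
proof (induction t arbitrary: x y)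
  case Leaf
  then show ?case by (auto simp: doubleton_eq_iff)
next
  case (Node a z r)
  have sl: "sorted_wrt (<) (outline x a z)" and sr: "sorted_wrt (<) (outline z r y)"
    using Node.prems(1) by (auto simp: sorted_wrt_append)
  have xy: "x < y" using Node.prems(1) by (auto simp: sorted_wrt_append)
  have "\<forall>v \<in> set (outline x a z). x \<le> v \<and> v \<le> z" using sl by (auto simp: sorted_wrt_append less_imp_le)
  then have bl: "x \<le> v \<and> v \<le> z" if "v \<in> e" "e \<in> tree_edges x a z" for v e
    using tree_edges_subset[OF that(2)] that(1) by blast
  have "\<forall>v \<in> set (outline z r y). z \<le> v \<and> v \<le> y" using sr by (auto simp: sorted_wrt_append less_imp_le)
  then have br: "z \<le> v \<and> v \<le> y" if "v \<in> e" "e \<in> tree_edges z r y" for v e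
    using tree_edges_subset[OF that(2)] that(1) by blast
  have xz: "x \<le> z" "z \<le> y" using sl sr by (auto simp: sorted_wrt_append)
  show ?case
  proof
    assume c: "i < k \<and> k < j \<and> j < l"
    have b: "x \<le> v \<and> v \<le> y" if "v \<in> e" "e \<in> tree_edges x (Node a z r) y" for v e
    proof -
      have "e = {x, y} \<or> e \<in> tree_edges x a z \<or> e \<in> tree_edges z r y" using that(2) by simp
      then show ?thesis using bl[OF that(1)] br[OF that(1)] xz xy that(1) by fastforce
    qed
    have ij: "x \<le> i" "j \<le> y" "x \<le> k" "l \<le> y"
      using b[OF _ Node.prems(2)] b[OF _ Node.prems(3)] by auto
    have "{i, j} \<noteq> {x, y}" using c ij xy by (auto simp: doubleton_eq_iff)
    moreover have "{k, l} \<noteq> {x, y}" using c ij xy by (auto simp: doubleton_eq_iff)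
    ultimately consider "{i, j} \<in> tree_edges x a z" "{k, l} \<in> tree_edges x a z"
      | "{i, j} \<in> tree_edges x a z" "{k, l} \<in> tree_edges z r y"
      | "{i, j} \<in> tree_edges z r y" "{k, l} \<in> tree_edges x a z"
      | "{i, j} \<in> tree_edges z r y" "{k, l} \<in> tree_edges z r y"
      using Node.prems by auto
    then show False
    proof cases
      case 1 then show ?thesis using Node.IH(1)[OF sl 1] c by simp
    next
      case 2 then show ?thesis using bl[of j, OF _ 2(1)] br[of k, OF _ 2(2)] c by simp
    next
      case 3 then show ?thesis using br[of i, OF _ 3(1)] bl[of k, OF _ 3(2)] c by simp
    next
      case 4 then show ?thesis using Node.IH(2)[OF sr 4] c by simp
    qed
  qed
qed

lemma path_edges_outline: "path_edges (outline x t y) \<subseteq> tree_edges x t y"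
proof (induction t arbitrary: x y)
  case (Node l z r)
  have "path_edges (outline x (Node l z r) y) = path_edges (outline x l z) \<union> path_edges (outline z r y)"
    using path_edges_append[of "x # inorder l" z "inorder r @ [y]"] by simp
  then show ?case using Node.IH(1)[of x z] Node.IH(2)[of z y] unfolding tree_edges.simps by blast
qed simp

lemma closed_walk_outline: "closed_walk_edges (outline x t y) \<subseteq> tree_edges x t y"
  using path_edges_outline[of x t y] root_edge[of x y t] unfolding closed_walk_edges_def by auto

definition circle_arc :: "nat \<Rightarrow> nat \<Rightarrow> real \<Rightarrow> complex" where
  "circle_arc n a = (\<lambda>s. on_circle n (real a + s))"

text \<open>
  Edges of the outer cycle become arcs of the circle, the last case being the edge that
  closes the cycle; other edges become straight chords.
\<close>
definition circle_drawing :: "nat \<Rightarrow> nat set \<Rightarrow> real \<Rightarrow> complex" where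
  "circle_drawing n e =
     (if Max e = Suc (Min e) then circle_arc n (Min e)
      else if Min e = 0 \<and> Suc (Max e) = n then circle_arc n (Max e)
      else linepath (on_circle n (Min e)) (on_circle n (Max e)))"

lemma cycle_edges_upt: "cycle_edges [0..<n] = {{a, Suc a mod n} | a. a < n}"
  unfolding cycle_edges_def setcompr_eq_image by (intro image_cong) auto

lemma circle_drawing_outer:
  assumes "a < n" "n \<ge> 3"
  shows "circle_drawing n {a, Suc a mod n} = circle_arc n a"
proof (cases "Suc a < n")
  case True
  then have "Min {a, Suc a mod n} = a" "Max {a, Suc a mod n} = Suc a" by auto
  then show ?thesis by (simp add: circle_drawing_def)
next
  case False
  then have "Suc a = n" using assms by simp
  then have "Min {a, Suc a mod n} = 0" "Max {a, Suc a mod n} = a" by auto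
  then show ?thesis using assms \<open>Suc a = n\<close> by (simp add: circle_drawing_def)
qed

lemma circle_drawing_chord:
  assumes "i < j" "j < n" "{i, j} \<notin> cycle_edges [0..<n]"
  shows "circle_drawing n {i, j} = linepath (on_circle n i) (on_circle n j)"
proof -
  have m: "Min {i, j} = i" "Max {i, j} = j" using assms by auto
  have "j \<noteq> Suc i"
  proof
    assume "j = Suc i"
    then have "{i, j} = {i, Suc i mod n}" using assms by simp
    then show False using assms unfolding cycle_edges_upt by auto
  qed
  moreover have "\<not> (i = 0 \<and> Suc j = n)"
  proof
    assume "i = 0 \<and> Suc j = n"
    then have "{i, j} = {j, Suc j mod n}" by auto
    then show False using assms unfolding cycle_edges_upt by blast
  qed
  ultimately show ?thesis unfolding circle_drawing_def m by auto
qed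

lemma on_circle_eqD:
  assumes "0 \<le> u" "u < real n" "0 \<le> v" "v \<le> real n" "on_circle n u = on_circle n v"
  shows "u = v \<or> (u = 0 \<and> v = real n)"
proof (cases "v = real n")
  case True
  then have "on_circle n u = on_circle n 0" using assms on_circle_n[of n] by auto
  then have "u = 0" using assms by (intro on_circle_inj[of u n 0]) auto
  then show ?thesis using True by simp
next
  case False
  then show ?thesis using assms on_circle_inj[of u n v] by simp
qed

lemma path_image_circle_arc: "path_image (circle_arc n a) = on_circle n ` {real a..real a + 1}"
proof -
  have "(\<lambda>s. real a + s) ` {0..1} = {real a..real a + 1}" by simp
  then show ?thesis unfolding path_image_def circle_arc_def by (metis image_image)
qed

lemma arc_circle_arc:
  assumes "a < n" "n \<ge> 2"
  shows "arc (circle_arc n a)"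
  unfolding arc_def
proof
  show "path (circle_arc n a)"
    unfolding path_def circle_arc_def on_circle_def by (intro continuous_intros) (use assms in auto)
  have *: "s = t" if "s \<in> {0..1}" "t \<in> {0..1}" "s \<le> t" "circle_arc n a s = circle_arc n a t" for s t
  proof (cases "s = t")
    case False
    have "real a + 1 \<le> real n" using assms by linarith
    then have "real a + s = real a + t \<or> (real a + s = 0 \<and> real a + t = real n)"
      using that False unfolding circle_arc_def by (intro on_circle_eqD) auto
    then show ?thesis
    proof
      assume "real a + s = 0 \<and> real a + t = real n"
      then have "real n \<le> 1" using that by simp
      then show ?thesis using assms by simp
    qed simp
  qed
  show "inj_on (circle_arc n a) {0..1}"
  proof (rule inj_onI)
    fix s t :: real assume "s \<in> {0..1}" "t \<in> {0..1}" "circle_arc n a s = circle_arc n a t"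
    then show "s = t" using *[of s t] *[of t s] by (metis linear)
  qed
qed

lemma on_circle_Suc_mod:
  assumes "a < n"
  shows "on_circle n (real (Suc a mod n)) = on_circle n (real a + 1)"
proof (cases "Suc a < n")
  case False
  then have "Suc a = n" using assms by simp
  then have "real a + 1 = real n" "Suc a mod n = 0" by auto
  then show ?thesis using on_circle_n[of n] assms by simp
qed (simp add: add.commute)

lemma unit_circle_param:
  assumes "norm z = 1" "n > 0"
  shows "\<exists>a<n. z \<in> on_circle n ` {real a..real a + 1}"
proof -
  obtain t where t: "0 \<le> t" "t < 2 * pi" "z = Complex (cos t) (sin t)"
    using complex_unimodular_polar[OF assms(1)] by blast
  define u where "u = real n * t / (2 * pi)"
  have u: "0 \<le> u" "u < real n" using t assms by (auto simp: u_def field_simps)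
  have "z = on_circle n u" using t assms by (simp add: on_circle_def u_def cis.ctr)
  moreover have "u \<in> {real (nat \<lfloor>u\<rfloor>)..real (nat \<lfloor>u\<rfloor>) + 1}" using u(1) by (auto simp: le_floor_iff)
  moreover have "nat \<lfloor>u\<rfloor> < n" using u by (simp add: nat_less_iff floor_less_iff)
  ultimately show ?thesis by blast
qed

text \<open>
  The outer curve is the unit circle and its inside contains the open disc, in which all chords lie;
  hence the drawing is a polygon in the sense of \<open>polygon\<close>.
\<close>
theorem circle_mop:
  fixes n :: nat
  assumes n: "n \<ge> 3" and out: "outline 0 t (n - 1) = [0..<n]"
  shows "mop \<lparr>verts = {..<n}, edges = tree_edges 0 t (n - 1)\<rparr>" (is "mop ?G")
proof -
  define E where "E = tree_edges 0 t (n - 1)"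
  define G where "G = \<lparr>verts = {..<n}, edges = E\<rparr>"
  have sel: "verts G = {..<n}" "edges G = E" by (simp_all add: G_def)
  define p where "p v = on_circle n (real v)" for v
  define g where "g = circle_drawing n"
  have cyc: "closed_walk_edges [0..<n] = {{a, Suc a mod n} | a. a < n}"
    using cycle_edges_closed_walk[of "[0..<n]"] cycle_edges_upt[of n] n by simp
  have cycE: "closed_walk_edges [0..<n] \<subseteq> E"
    using closed_walk_outline[of 0 t "n - 1"] unfolding out E_def .
  have dist: "distinct (outline 0 t (n - 1))" unfolding out by simp
  have EV: "e \<subseteq> {..<n}" "card e = 2" if "e \<in> E" for e
    using tree_edges_subset[of e 0 t "n - 1"] card_tree_edge[OF _ dist] that unfolding E_def out by auto
  have pair: "\<exists>i j. e = {i, j} \<and> i < j \<and> j < n" if e: "e \<in> E" for e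
  proof -
    obtain i j where "e = {i, j}" "i \<noteq> j" using EV(2)[OF e] by (auto simp: card_2_iff)
    then have "e = {min i j, max i j}" "min i j < max i j" "max i j < n" using EV(1)[OF e] by auto
    then show ?thesis by blast
  qed
  have edge_cases: "(\<exists>a<n. e = {a, Suc a mod n} \<and> path_image (g e) = on_circle n ` {real a..real a + 1} \<and>
         p ` e = {on_circle n (real a), on_circle n (real a + 1)} \<and> g e = circle_arc n a) \<or>
      (e \<notin> closed_walk_edges [0..<n] \<and> (\<exists>i j. e = {i, j} \<and> i < j \<and> j < n \<and> g e = linepath (p i) (p j)))"
    if e: "e \<in> E" for e
  proof (cases "e \<in> closed_walk_edges [0..<n]")
    case True
    then obtain a where a: "a < n" "e = {a, Suc a mod n}" unfolding cyc by auto
    then have "g e = circle_arc n a" unfolding g_def using circle_drawing_outer[OF a(1) n] by simp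
    moreover have "p ` e = {on_circle n (real a), on_circle n (real a + 1)}"
      unfolding a(2) p_def using on_circle_Suc_mod[OF a(1)] by simp
    ultimately show ?thesis using a path_image_circle_arc by auto
  next
    case False
    obtain i j where ij: "e = {i, j}" "i < j" "j < n" using pair[OF e] by auto
    have "e \<notin> cycle_edges [0..<n]" using False cycle_edges_closed_walk[of "[0..<n]"] n by simp
    then have "g e = linepath (p i) (p j)"
      unfolding g_def p_def ij(1) by (intro circle_drawing_chord ij(2,3))
    then show ?thesis using ij False by blast
  qed
  have p_norm: "norm (p v) = 1" for v by (simp add: p_def)
  have p_inj: "inj_on p {..<n}"
  proof (rule inj_onI)
    fix u v assume "u \<in> {..<n}" "v \<in> {..<n}" "p u = p v"
    then have "real u = real v" unfolding p_def by (intro on_circle_inj[of _ n]) auto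
    then show "u = v" by simp
  qed
  have open_arc: "\<exists>u. z = on_circle n u \<and> real a < u \<and> u < real a + 1"
    if z: "z \<in> on_circle n ` {real a..real a + 1}" and nz: "z \<notin> {on_circle n (real a), on_circle n (real a + 1)}" for z a
  proof -
    obtain u where u: "z = on_circle n u" "real a \<le> u" "u \<le> real a + 1" using z by auto
    then have "u \<noteq> real a" "u \<noteq> real a + 1" using nz by auto
    then show ?thesis using u by (intro exI[of _ u]) simp
  qed
  have chord_open: "norm z < 1"
    if "z \<in> path_image (g e) - p ` e" "e = {i, j}" "g e = linepath (p i) (p j)" for z e i j
    using that chord_inside[of "p i" "p j" z] p_norm by auto
  have plane: "plane_graph G p g"
    unfolding plane_graph_def sel
  proof (intro conjI ballI impI)
    show "simple_graph G" unfolding simple_graph_def sel using EV by simp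
    show "inj_on p {..<n}" by (rule p_inj)
    fix e assume e: "e \<in> E"
    from edge_cases[OF e] show "arc (g e)"
    proof (elim disjE exE conjE)
      fix a assume "a < n" "g e = circle_arc n a"
      then show ?thesis using arc_circle_arc n by simp
    next
      fix i j assume ij: "e = {i, j}" "i < j" "j < n" "g e = linepath (p i) (p j)"
      then have "p i \<noteq> p j" using p_inj by (auto simp: inj_on_def)
      then show ?thesis unfolding ij(4) by (rule arc_linepath)
    qed
    from edge_cases[OF e] show "{pathstart (g e), pathfinish (g e)} = p ` e"
      by (elim disjE exE conjE) (auto simp: circle_arc_def pathstart_def pathfinish_def linepath_def)
    from edge_cases[OF e] show "(path_image (g e) - p ` e) \<inter> p ` {..<n} = {}"
    proof (elim disjE exE conjE)
      fix a assume a: "a < n" "path_image (g e) = on_circle n ` {real a..real a + 1}"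
        "p ` e = {on_circle n (real a), on_circle n (real a + 1)}"
      show ?thesis
      proof (rule ccontr)
        assume "\<not> ?thesis"
        then obtain v where v: "v < n" "p v \<in> path_image (g e) - p ` e" by auto
        then obtain u where u: "p v = on_circle n u" "real a < u" "u < real a + 1"
          using open_arc[of "p v" a] a by auto
        have "real a + 1 \<le> real n" using a(1) by linarith
        then have "u = real v" using u v(1) unfolding p_def by (intro on_circle_inj[of u n]) auto
        then have "a < v" "v < a + 1" using u by linarith+
        then show False by simp
      qed
    next
      fix i j assume ij: "e = {i, j}" "g e = linepath (p i) (p j)"
      show ?thesis using chord_open[OF _ ij] p_norm by fastforce
    qed
    fix f assume f: "f \<in> E" and ef: "e \<noteq> f"
    show "(path_image (g e) - p ` e) \<inter> path_image (g f) = {}"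
    proof (rule ccontr)
      assume "\<not> ?thesis"
      then obtain z where z: "z \<in> path_image (g e) - p ` e" "z \<in> path_image (g f)" by auto
      from edge_cases[OF e] show False
      proof (elim disjE exE conjE)
        fix a assume a: "a < n" "e = {a, Suc a mod n}" "path_image (g e) = on_circle n ` {real a..real a + 1}"
          "p ` e = {on_circle n (real a), on_circle n (real a + 1)}"
        then obtain u where u: "z = on_circle n u" "real a < u" "u < real a + 1"
          using open_arc[of z a] z(1) by auto
        have an: "real a + 1 \<le> real n" using a(1) by linarith
        from edge_cases[OF f] show False
        proof (elim disjE exE conjE)
          fix b assume b: "b < n" "f = {b, Suc b mod n}" "path_image (g f) = on_circle n ` {real b..real b + 1}"
          then obtain v where v: "z = on_circle n v" "real b \<le> v" "v \<le> real b + 1" using z(2) by auto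
          have bn: "real b + 1 \<le> real n" using b(1) by linarith
          have "u = v \<or> (u = 0 \<and> v = real n)" using u v an bn by (intro on_circle_eqD) auto
          then have "u = v" using u by auto
          then have "a < b + 1" "b < a + 1" using u v by linarith+
          then have "a = b" by simp
          then show False using a b ef by simp
        next
          fix i j assume ij: "f = {i, j}" "i < j" "j < n" "g f = linepath (p i) (p j)"
          have "norm z = 1" using u by simp
          then have "z = p i \<or> z = p j"
            using chord_inside[of "p i" "p j" z] p_norm z(2) unfolding ij(4) by auto
          then obtain v where v: "z = on_circle n (real v)" "v < n" using ij unfolding p_def by auto
          have "u = real v" using u v an by (intro on_circle_inj[of u n]) auto
          then have "a < v" "v < a + 1" using u by linarith+
          then show False by simp
        qed
      next
        fix i j assume ij: "e = {i, j}" "i < j" "j < n" "g e = linepath (p i) (p j)"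
        have nz: "norm z < 1" using chord_open[OF z(1) ij(1,4)] .
        from edge_cases[OF f] show False
        proof (elim disjE exE conjE)
          fix b assume "path_image (g f) = on_circle n ` {real b..real b + 1}"
          then show False using z(2) nz by auto
        next
          fix k l assume kl: "f = {k, l}" "k < l" "l < n" "g f = linepath (p k) (p l)"
          have sorted: "sorted_wrt (<) (outline 0 t (n - 1))" unfolding out by simp
          have "norm z = 1"
          proof (rule noncrossing_chords_disjoint[OF ij(2,3) kl(2,3)])
            show "{i, j} \<noteq> {k, l}" using ef ij kl by simp
            show "\<not> (i < k \<and> k < j \<and> j < l)" "\<not> (k < i \<and> i < l \<and> l < j)"
              using tree_edges_noncrossing[OF sorted] e f unfolding E_def ij(1) kl(1) by blast+
            show "z \<in> closed_segment (on_circle n i) (on_circle n j)" using z(1) ij(4) unfolding p_def by auto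
            show "z \<in> closed_segment (on_circle n k) (on_circle n l)" using z(2) kl(4) unfolding p_def by auto
          qed
          then show False using nz by simp
        qed
      qed
    qed
  qed
  have curve: "outer_curve g [0..<n] = sphere 0 1"
  proof
    have outer_image: "path_image (g {a, Suc a mod n}) = on_circle n ` {real a..real a + 1}" if "a < n" for a
      unfolding g_def circle_drawing_outer[OF that n] by (rule path_image_circle_arc)
    show "outer_curve g [0..<n] \<subseteq> sphere 0 1"
      unfolding outer_curve_def[OF plane] drawn_edges_def cyc using outer_image by fastforce
    show "sphere 0 1 \<subseteq> outer_curve g [0..<n]"
    proof
      fix z :: complex assume "z \<in> sphere 0 1"
      then obtain a where "a < n" "z \<in> on_circle n ` {real a..real a + 1}"
        using unit_circle_param[of z n] n by auto
      then have "a < n" "z \<in> path_image (g {a, Suc a mod n})" using outer_image by auto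
      then show "z \<in> outer_curve g [0..<n]"
        unfolding outer_curve_def[OF plane] drawn_edges_def cyc by blast
    qed
  qed
  have ball: "ball 0 1 \<subseteq> inside (outer_curve g [0..<n])"
    using interior_inside_frontier[of "cball (0::complex) 1"] unfolding curve by simp
  have "polygon G p g [0..<n] E"
    unfolding polygon_def[OF plane] sel
  proof (intro conjI ballI)
    fix e assume e: "e \<in> E - closed_walk_edges [0..<n]"
    then have "\<exists>i j. e = {i, j} \<and> g e = linepath (p i) (p j)"
      using edge_cases[of e] unfolding cyc by blast
    then obtain i j where ij: "e = {i, j}" "g e = linepath (p i) (p j)" by blast
    show "path_image (g e) - p ` e \<subseteq> inside (outer_curve g [0..<n])"
      using chord_open[OF _ ij] ball by fastforce
  next
    show "length [0..<n] \<ge> 3" using n by simp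
    show "e \<subseteq> set [0..<n]" if "e \<in> E" for e using EV(1)[OF that] by auto
  qed (use cycE in auto)
  then have "mop G"
    using polygon_tree_mop[OF plane, of 0 t "n - 1"] unfolding out sel by (simp add: E_def atLeast0LessThan)
  then show ?thesis unfolding G_def E_def .
qed

section \<open>A family attaining the bound\<close>

text \<open>
  A fan with an unnamed centre \<open>u\<close>, rooted at the edge from \<open>u\<close> to \<open>b + j\<close>: the centre is joined to
  the path \<open>b, \<dots>, b + j\<close>.
\<close>
fun fan :: "nat \<Rightarrow> nat \<Rightarrow> nat tree" where
  "fan b 0 = Leaf"
| "fan b (Suc j) = Node (fan b j) (b + j) Leaf"

text \<open>
  A block occupies the vertices \<open>s, \<dots>, s + k + 3\<close>.  Its hub \<open>s + 2\<close> is adjacent to all of them;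
  for \<open>k \<ge> 1\<close>, the vertices \<open>s + 1\<close> and \<open>s + 3\<close> have degree two.
\<close>
definition block :: "nat \<Rightarrow> nat \<Rightarrow> nat tree" where
  "block k s = Node (Node Leaf (s + 1) Leaf) (s + 2) (fan (s + 3) k)"

text \<open>
  Consecutive blocks are joined by the edge between the last vertex of one and the first vertex of
  the next; the resulting inner polygon is triangulated from vertex \<open>0\<close>.
\<close>
fun chain :: "nat \<Rightarrow> nat \<Rightarrow> nat tree" where
  "chain k 0 = block k 0"
| "chain k (Suc q) =
     Node (Node (chain k q) (q * (k + 4) + k + 3) Leaf) (Suc q * (k + 4)) (block k (Suc q * (k + 4)))"

lemma inorder_fan: "inorder (fan b j) = [b..<b + j]"
  by (induction j) auto

lemma inorder_block: "inorder (block k s) = [s + 1..<s + k + 3]"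
proof -
  have "[s + 1..<s + k + 3] = [s + 1, s + 2] @ [s + 3..<s + 3 + k]"
    by (simp add: upt_conv_Cons add.commute numeral_eq_Suc)
  then show ?thesis by (simp add: block_def inorder_fan)
qed

lemma upt_split: "i \<le> j \<Longrightarrow> j \<le> m \<Longrightarrow> [i..<m] = [i..<j] @ [j..<m]"
  using upt_add_eq_append[of i j "m - j"] by simp

lemma inorder_chain: "inorder (chain k q) = [1..<q * (k + 4) + k + 3]"
proof (induction q)
  case 0
  then show ?case by (simp add: inorder_block)
next
  case (Suc q)
  let ?e = "q * (k + 4) + k + 3" and ?s = "Suc q * (k + 4)"
  have s: "?s = Suc ?e" by simp
  have "[1..<?s + k + 3] = [1..<?e] @ [?e..<?s + k + 3]" 
    by (rule upt_split) simp_all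
  also have "[?e..<?s + k + 3] = ?e # ?s # [?s + 1..<?s + k + 3]" unfolding s by (simp add: upt_conv_Cons)
  finally show ?case using Suc by (simp add: inorder_block)
qed

lemma outline_chain: "outline 0 (chain k q) (q * (k + 4) + k + 3) = [0..<Suc q * (k + 4)]"
proof -
  define e where "e = q * (k + 4) + k + 3"
  have S: "Suc q * (k + 4) = Suc e" by (simp add: e_def)
  have "e > 0" by (simp add: e_def)
  then have upt: "[0..<Suc e] = 0 # [1..<e] @ [e]" using upt_conv_Cons[of 0 e] by simp
  have inorder: "inorder (chain k q) = [1..<e]" unfolding e_def by (rule inorder_chain)
  show ?thesis unfolding e_def[symmetric] S upt inorder ..
qed

lemma tree_edges_fan: "i \<le> j \<Longrightarrow> {u, b + i} \<in> tree_edges u (fan b j) (b + j)"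
proof (induction j)
  case (Suc j)
  then show ?case by (cases "i = Suc j") auto
qed simp

lemma block_hub:
  assumes "w \<in> {s + 1, s + 3 + i}" "i \<le> k"
  shows "{s + 2, w} \<in> tree_edges s (block k s) (s + k + 3)"
proof -
  have "{s + 2, s + 3 + i} \<in> tree_edges (s + 2) (fan (s + 3) k) (s + 3 + k)"
    by (rule tree_edges_fan[OF assms(2)])
  moreover have "s + 3 + k = s + k + 3" by simp
  ultimately show ?thesis using assms(1) unfolding block_def by (auto simp: insert_commute)
qed

lemma ears_fan: "k \<ge> 1 \<Longrightarrow> ears (fan b k) = {b}"
proof (induction k)
  case (Suc k)
  then show ?case by (cases k) auto
qed simp

lemma ears_block: "k \<ge> 1 \<Longrightarrow> ears (block k s) = {s + 1, s + 3}"
  using ears_fan[of k "s + 3"] by (auto simp: block_def)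

lemma card_ears_chain: "k \<ge> 1 \<Longrightarrow> card (ears (chain k q)) = 2 * Suc q"
proof (induction q)
  case 0
  then show ?case by (simp add: ears_block)
next
  case (Suc q)
  have ne: "chain k q \<noteq> Leaf" by (cases q) (auto simp: block_def)
  have "ears (chain k (Suc q)) = ears (chain k q) \<union> ears (block k (Suc q * (k + 4)))"
    using ne by simp
  moreover have disj: "ears (chain k q) \<inter> ears (block k (Suc q * (k + 4))) = {}"
    using ears_subset[of "chain k q"] unfolding inorder_chain ears_block[OF Suc.prems] by auto
  moreover have "card (ears (block k (Suc q * (k + 4)))) = 2" by (simp add: ears_block[OF Suc.prems])
  ultimately have "card (ears (chain k (Suc q))) = card (ears (chain k q)) + 2"
    using card_Un_disjoint[OF finite_ears finite_ears disj] by (simp only:)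
  then show ?case using Suc.IH[OF Suc.prems] by simp
qed

lemma chain_block_edges: "i \<le> q \<Longrightarrow>
  tree_edges (i * (k + 4)) (block k (i * (k + 4))) (i * (k + 4) + k + 3) \<subseteq>
  tree_edges 0 (chain k q) (q * (k + 4) + k + 3)"
proof (induction q)
  case (Suc q)
  show ?case
  proof (cases "i = Suc q")
    case False
    then have "i \<le> q" using Suc.prems by simp
    then show ?thesis using Suc.IH by auto
  qed auto
qed simp

text \<open>
  Blocks are attached to the rest of the chain only through their first and last vertices.
\<close>
lemma block_interior_nbs:
  assumes "{v, w} \<in> tree_edges 0 (chain k q) (q * (k + 4) + k + 3)" "i \<le> q"
    and "i * (k + 4) < v" "v < i * (k + 4) + k + 3"
  shows "i * (k + 4) \<le> w \<and> w \<le> i * (k + 4) + k + 3"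
  using assms
proof (induction q)
  case 0
  then show ?case using tree_edges_subset[OF 0(1)] by (auto simp: inorder_chain inorder_block)
next
  case (Suc q)
  let ?e = "q * (k + 4) + k + 3" and ?s = "Suc q * (k + 4)"
  have s: "?s = Suc ?e" by simp
  have E: "{v, w} \<in> {{0, ?s + k + 3}, {0, ?s}, {?e, ?s}} \<union> tree_edges 0 (chain k q) ?e \<union>
      tree_edges ?s (block k ?s) (?s + k + 3)"
    using Suc.prems(1) by auto
  have chain_le: "v \<le> ?e \<and> w \<le> ?e" if "{v, w} \<in> tree_edges 0 (chain k q) ?e"
    using tree_edges_subset[OF that] by (auto simp: inorder_chain)
  have block_ge: "?s \<le> v \<and> ?s \<le> w \<and> w \<le> ?s + k + 3" if "{v, w} \<in> tree_edges ?s (block k ?s) (?s + k + 3)"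
    using tree_edges_subset[OF that] unfolding inorder_block by auto
  have v0: "v \<noteq> 0" using Suc.prems by simp
  show ?case
  proof (cases "i = Suc q")
    case True
    then have "?s < v" "v < ?s + k + 3" using Suc.prems by simp_all
    then have "{v, w} \<in> tree_edges ?s (block k ?s) (?s + k + 3)"
      using E chain_le v0 s by (auto simp: doubleton_eq_iff)
    then show ?thesis using block_ge True by simp
  next
    case False
    then have iq: "i \<le> q" using Suc.prems by simp
    have "i * (k + 4) \<le> q * (k + 4)" using iq by (rule mult_le_mono1)
    then have "v < ?e" using Suc.prems by linarith
    then have "{v, w} \<in> tree_edges 0 (chain k q) ?e"
      using E block_ge v0 s by (auto simp: doubleton_eq_iff)
    then show ?thesis using Suc.IH iq Suc.prems by blast
  qed
qed

definition chain_sgraph :: "nat \<Rightarrow> nat \<Rightarrow> nat sgraph" where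
  "chain_sgraph k q = \<lparr>verts = {..<Suc q * (k + 4)}, edges = tree_edges 0 (chain k q) (q * (k + 4) + k + 3)\<rparr>"

lemma mop_chain_sgraph: "mop (chain_sgraph k q)"
proof -
  have last: "Suc q * (k + 4) - 1 = q * (k + 4) + k + 3" by simp
  have "outline 0 (chain k q) (Suc q * (k + 4) - 1) = [0..<Suc q * (k + 4)]"
    unfolding last by (rule outline_chain)
  then show ?thesis using circle_mop[of "Suc q * (k + 4)" "chain k q"]
    unfolding last chain_sgraph_def by simp
qed

lemma num_deg2_chain_sgraph:
  assumes "k \<ge> 1"
  shows "2 * Suc q \<le> num_deg2 (chain_sgraph k q)"
proof -
  let ?G = "chain_sgraph k q"
  note G = mop_simple[OF mop_chain_sgraph[of k q]]
  have dist: "distinct (outline 0 (chain k q) (q * (k + 4) + k + 3))" unfolding outline_chain by simp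
  have "ears (chain k q) \<subseteq> {v \<in> verts ?G. degree ?G v = 2}"
  proof
    fix v assume v: "v \<in> ears (chain k q)"
    then have v': "v \<in> set (inorder (chain k q))" by (rule subsetD[OF ears_subset])
    then have "v \<in> set (outline 0 (chain k q) (q * (k + 4) + k + 3))" by simp
    then have "v \<in> verts ?G" unfolding outline_chain chain_sgraph_def by simp
    moreover have "degree ?G v = 2"
      using interior_degree_two_iff[OF dist v'] v unfolding degree_def neighbours_simple[OF G]
      by (simp add: chain_sgraph_def)
    ultimately show "v \<in> {v \<in> verts ?G. degree ?G v = 2}" by simp
  qed
  moreover have "finite (verts ?G)" by (simp add: chain_sgraph_def)
  ultimately have "card (ears (chain k q)) \<le> num_deg2 ?G"
    unfolding num_deg2_def by (intro card_mono) auto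
  then show ?thesis by (simp add: card_ears_chain[OF assms])
qed

text \<open>
  Otherwise no interior vertex of the block is dominated, and the hub together with \<open>s + 1\<close> and
  \<open>s + 3, \<dots>, s + k + 2\<close> is a star with \<open>k + 1\<close> leaves that survives.
\<close>
lemma isolating_set_meets_block:
  assumes S: "star_isolating k (chain_sgraph k q) S" and i: "i \<le> q"
  shows "\<exists>v\<in>S. v div (k + 4) = i"
proof (rule ccontr)
  assume none: "\<not> ?thesis"
  let ?G = "chain_sgraph k q" and ?s = "i * (k + 4)"
  let ?D = "dominated (edges ?G) S"
  note G = mop_simple[OF mop_chain_sgraph[of k q]]
  have outside: "v \<notin> S" if "?s \<le> v" "v \<le> ?s + k + 3" for v
  proof
    assume "v \<in> S"
    have "v = ?s + (v - ?s)" "v - ?s < k + 4" using that by auto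
    then have "v div (k + 4) = i" by (metis add.commute add_0 div_less div_mult_self1 zero_neq_numeral add_eq_0_iff_both_eq_0)
    then show False using none \<open>v \<in> S\<close> by blast
  qed
  have free: "v \<notin> ?D" if v: "?s < v" "v < ?s + k + 3" for v
  proof
    assume "v \<in> ?D"
    then obtain u where "u \<in> S" "{u, v} \<in> edges ?G \<or> u = v" unfolding dominated_def by auto
    moreover have "?s \<le> u \<and> u \<le> ?s + k + 3" if "{u, v} \<in> edges ?G"
      using block_interior_nbs[of v u k q i] that i v by (simp add: chain_sgraph_def insert_commute)
    ultimately show False using outside v by fastforce
  qed
  \<comment> \<open>The first leaf is \<open>s + 1\<close>, and the remaining ones follow the hub \<open>s + 2\<close>.\<close>
  define f where "f j = (if j = 0 then ?s + 2 else if j = 1 then ?s + 1 else ?s + 1 + j)" for j :: nat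
  have inj: "inj_on f {0..k + 1}" by (auto simp: inj_on_def f_def split: if_splits)
  have range: "?s < f j \<and> f j < ?s + k + 3" if "j \<le> k + 1" for j using that by (auto simp: f_def)
  have top: "?s + k + 3 < Suc q * (k + 4)"
  proof -
    have "?s + k + 3 < Suc i * (k + 4)" by simp
    also have "\<dots> \<le> Suc q * (k + 4)" using i by (intro mult_le_mono1) simp
    finally show ?thesis .
  qed
  have edge: "{f 0, f j} \<in> edges ?G" if "1 \<le> j" "j \<le> k + 1" for j
  proof -
    have "f j \<in> {?s + 1, ?s + 3 + (j - 2)}" "j - 2 \<le> k" using that by (auto simp: f_def)
    then have "{?s + 2, f j} \<in> tree_edges ?s (block k ?s) (?s + k + 3)" by (rule block_hub)
    then show ?thesis using chain_block_edges[OF i, of k] by (auto simp: chain_sgraph_def f_def)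
  qed
  have "contains_copy (delete_verts ?G ?D) (star (k + 1))"
    unfolding contains_copy_def
  proof (intro exI[of _ f] conjI ballI)
    show "inj_on f (verts (star (k + 1)))" using inj by (simp add: star_def)
    show "f ` verts (star (k + 1)) \<subseteq> verts (delete_verts ?G ?D)"
    proof
      fix v assume "v \<in> f ` verts (star (k + 1))"
      then obtain j where "j \<le> k + 1" "v = f j" by (auto simp: star_def)
      then have v: "?s < v" "v < ?s + k + 3" using range by auto
      then have "v \<in> verts ?G" using top by (simp add: chain_sgraph_def)
      then show "v \<in> verts (delete_verts ?G ?D)" using free[OF v] by (simp add: delete_verts_def)
    qed
    fix e assume "e \<in> edges (star (k + 1))"
    then obtain j where j: "1 \<le> j" "j \<le> k + 1" "e = {0, j}" by (auto simp: star_def)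
    have "f 0 \<notin> ?D" "f j \<notin> ?D" using free range[of 0] range[of j] j by auto
    then show "f ` e \<in> edges (delete_verts ?G ?D)" using edge[OF j(1,2)] j(3) by (simp add: delete_verts_def)
  qed
  then show False using S unfolding star_isolating_def closed_nbhd_dominated[OF G] by simp
qed

lemma iota_chain_sgraph_lower: "Suc q \<le> iota k (chain_sgraph k q)"
proof -
  let ?G = "chain_sgraph k q"
  note G = mop_simple[OF mop_chain_sgraph[of k q]]
  have fin: "finite (verts ?G)" by (simp add: chain_sgraph_def)
  have large: "Suc q \<le> card S" if S: "star_isolating k ?G S" for S
  proof -
    have finS: "finite S" using S fin finite_subset unfolding star_isolating_def by blast
    have "{..q} \<subseteq> (\<lambda>v. v div (k + 4)) ` S" using isolating_set_meets_block[OF S] by blast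
    then have "card {..q} \<le> card ((\<lambda>v. v div (k + 4)) ` S)" using finS by (intro card_mono) auto
    also have "\<dots> \<le> card S" using finS by (rule card_image_le)
    finally show ?thesis by simp
  qed
  have "star_isolating k ?G (verts ?G)"
    by (rule star_isolating_low_degree[OF G]) (auto simp: dominated_def)
  then have "{card S | S. star_isolating k ?G S} \<noteq> {}" by blast
  then show ?thesis unfolding iota_def
    using finite_isolating_cards[OF fin] large by (subst Min_ge_iff) auto
qed

text \<open>
  There are \<open>(k + 4) (q + 1)\<close> vertices, at least \<open>2 (q + 1)\<close> of them of degree two, so
  \<open>iota_upper_bound\<close> gives at most \<open>(k + 2) (q + 1)\<close>; the \<open>q + 1\<close> blocks give the same number as
  a lower bound.
\<close>
lemma chain_sgraph_sharp:
  assumes "k \<ge> 1" "q \<ge> 1"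
  shows "(k + 2) * iota k (chain_sgraph k q) = graph_order (chain_sgraph k q) - num_deg2 (chain_sgraph k q)"
    "graph_order (chain_sgraph k q) = Suc q * (k + 4)" "2 * k + 3 \<le> graph_order (chain_sgraph k q)"
proof -
  let ?G = "chain_sgraph k q"
  show order: "graph_order ?G = Suc q * (k + 4)" by (simp add: graph_order_def chain_sgraph_def)
  have "2 * (k + 4) \<le> Suc q * (k + 4)" using assms(2) by (intro mult_le_mono1) simp
  moreover have "2 * k + 3 \<le> 2 * (k + 4)" by simp
  ultimately show n: "2 * k + 3 \<le> graph_order ?G" unfolding order by (rule le_trans[rotated])
  have "(k + 2) * Suc q \<le> (k + 2) * iota k ?G" using iota_chain_sgraph_lower by (intro mult_le_mono2)
  moreover have "(k + 2) * iota k ?G \<le> graph_order ?G - num_deg2 ?G"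
    by (rule iota_upper_bound(1)[OF mop_chain_sgraph n assms(1)])
  moreover have "graph_order ?G = (k + 2) * Suc q + 2 * Suc q" unfolding order by (simp add: algebra_simps)
  ultimately show "(k + 2) * iota k ?G = graph_order ?G - num_deg2 ?G"
    using num_deg2_chain_sgraph[OF assms(1), of q] by linarith
qed

theorem theorem6:
  fixes k :: nat
  assumes "k \<ge> 1"
  shows "(\<forall>G :: 'a sgraph. mop G \<and> graph_order G \<ge> 2 * k + 3 \<longrightarrow>
            real (iota k G) \<le> (real (graph_order G) - real (num_deg2 G)) / (real k + 2))
       \<and> infinite {n. n \<ge> 2 * k + 3 \<and> (\<exists>G :: nat sgraph. mop G \<and> graph_order G = n \<and>
            real (iota k G) = (real n - real (num_deg2 G)) / (real k + 2))}"
proof (intro conjI allI impI)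
  fix G :: "'a sgraph"
  assume "mop G \<and> graph_order G \<ge> 2 * k + 3"
  then have "(k + 2) * iota k G \<le> graph_order G - num_deg2 G" "num_deg2 G \<le> graph_order G"
    using iota_upper_bound assms by blast+
  then have "real ((k + 2) * iota k G) \<le> real (graph_order G) - real (num_deg2 G)"
    by (simp only: of_nat_diff[symmetric] of_nat_le_iff)
  then show "real (iota k G) \<le> (real (graph_order G) - real (num_deg2 G)) / (real k + 2)"
    by (simp add: field_simps)
next
  let ?N = "{n. n \<ge> 2 * k + 3 \<and> (\<exists>G :: nat sgraph. mop G \<and> graph_order G = n \<and>
            real (iota k G) = (real n - real (num_deg2 G)) / (real k + 2))}"
  have "Suc (Suc q) * (k + 4) \<in> ?N" for q
  proof -
    let ?G = "chain_sgraph k (Suc q)"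
    note sharp = chain_sgraph_sharp[OF assms, of "Suc q"]
    have "num_deg2 ?G \<le> graph_order ?G"
      using iota_upper_bound(2)[OF mop_chain_sgraph] sharp(3) assms by simp
    then have "real ((k + 2) * iota k ?G) = real (graph_order ?G) - real (num_deg2 ?G)"
      using sharp(1) by (simp only: of_nat_diff[symmetric])
    then have "real (iota k ?G) = (real (graph_order ?G) - real (num_deg2 ?G)) / (real k + 2)"
      by (simp add: field_simps)
    then show ?thesis using sharp(2,3) mop_chain_sgraph[of k "Suc q"] by auto
  qed
  then have "range (\<lambda>q. Suc (Suc q) * (k + 4)) \<subseteq> ?N" by blast
  moreover have "infinite (range (\<lambda>q. Suc (Suc q) * (k + 4)))"
    by (rule range_inj_infinite) (auto simp: inj_on_def)
  ultimately show "infinite ?N" using finite_subset by blast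
qed

end
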